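(* Let $E\to M$ be a Lie algebroid of rank $n$. For any two sections $|\mu_1|,|\mu_2|\in\mathrm{Sec}(|\mathrm{Vol}|_E)$ the homology operators $\partial_{|\mu_1|}$ and $\partial_{|\mu_2|}$ on $\mathcal A(E)$ define the same homology, i.e. there is an isomorphism of graded vector spaces $H_*(E,\partial_{|\mu_1|})\cong H_*(E,\partial_{|\mu_2|})$. Moreover, if the line bundle $\bigwedge^{n}E^*$ is trivializable, then for every $|\mu|\in\mathrm{Sec}(|\mathrm{Vol}|_E)$ Poincaré duality holds: $H^{k}(E,d)\cong H_{n-k}(E,\partial_{|\mu|})$ for all $k$.
   Context: All objects are smooth. $E\to M$ is a Lie algebroid over a manifold $M$ with anchor $\rho:E\to TM$. $\mathcal A^i(E)=\mathrm{Sec}(\bigwedge^iE)$ and $\mathcal A(E)=\bigoplus_i\mathcal A^i(E)$; $|a|$ denotes the degree of $a$. $d$ is the Lie algebroid de Rham differential on $\mathcal A(E^* )$ and $H^*(E,d)$ is its cohomology. For $a\in\mathcal A(E)$, $i_a=i(a)$ is contraction on $\mathcal A(E^* )$, with $i_X$ the usual insertion for $X\in \mathrm{Sec}(E)$, $i_f$ multiplication by $f$ for $f\in C^\infty(M)$, and $i_{a\wedge b}=i_b\,i_a$. $|\mathrm{Vol}|_E=(\bigwedge^{\mathrm{top}}E^*\setminus 0)/\mathbb Z_2$, where $\mathbb Z_2$ acts by $\mu\mapsto-\mu$ on the line bundle with zero section removed. A section $|\mu|$ (an "odd volume form") is thus given locally by unordered pairs $\{\mu_U,-\mu_U\}$ of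 nowhere-vanishing local sections $\mu_U$ of $\bigwedge^{\mathrm{top}}E^*$ that agree on overlaps; such global sections always exist. The operator $\partial_{|\mu|}:\mathcal A(E)\to\mathcal A(E)$ of degree $-1$ is defined by the requirement that locally, for any local representative $\mu$ of $|\mu|$, $$i(\partial_{|\mu|}(a))\mu=(-1)^{|a|}\,d\,i_a\mu ,$$ which does not depend on the choice of representative $\pm\mu$. It satisfies $\partial_{|\mu|}^2=0$, and $H_*(E,\partial_{|\mu|})$ denotes the homology of $(\mathcal A(E),\partial_{|\mu|})$. The operators $\partial_{|\mu|}$ are called the homology operators for the Lie algebroid $E$. *)

theory Defs
  imports "HOL-Analysis.Analysis"
begin

section \<open>Smooth functions and manifolds\<close>

text \<open>
  The model space of dimension \<open>m\<close> is \<^term>\<open>Euclidean_space m\<close>, i.e. the sequences of reals that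
  vanish from index \<open>m\<close> on. \<open>C_k m r S f\<close>: on the open subset \<open>S\<close> of the model space all iterated
  partial derivatives of \<open>f\<close> up to order \<open>r\<close> exist and are continuous. As \<open>S\<close> is open, the
  derivative in direction \<open>i\<close> depends only on the values of \<open>f\<close> on \<open>S\<close>.
\<close>

fun C_k :: "nat \<Rightarrow> nat \<Rightarrow> (nat \<Rightarrow> real) set \<Rightarrow> ((nat \<Rightarrow> real) \<Rightarrow> real) \<Rightarrow> bool" where
  "C_k m 0 S f = continuous_on S f"
| "C_k m (Suc r) S f =
     (continuous_on S f \<and>
      (\<forall>i<m. \<exists>g. (\<forall>x\<in>S. ((\<lambda>t. f (x(i := t))) has_real_derivative g x) (at (x i))) \<and> C_k m r S g))"

definition C_infinity :: "nat \<Rightarrow> (nat \<Rightarrow> real) set \<Rightarrow> ((nat \<Rightarrow> real) \<Rightarrow> real) \<Rightarrow> bool" where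
  "C_infinity m S f \<longleftrightarrow> (\<forall>r. C_k m r S f)"

text \<open>
  The manifold is the whole type \<open>'m\<close>; its topology (Hausdorff and second countable) is the one
  given by the type classes. A chart is a pair of a domain and a coordinate map; the value of the
  coordinate map outside the domain is irrelevant.
\<close>

record 'm manifold =
  mdim :: nat
  charts :: "('m set \<times> ('m \<Rightarrow> nat \<Rightarrow> real)) set"

definition smooth_manifold ::
    "('m::{t2_space,second_countable_topology}, 'z) manifold_scheme \<Rightarrow> bool" where
  "smooth_manifold M \<longleftrightarrow>
     (\<Union>(U, \<phi>)\<in>charts M. U) = UNIV \<and>
     (\<forall>(U, \<phi>)\<in>charts M. open U \<and> openin (Euclidean_space (mdim M)) (\<phi> ` U) \<and>
        homeomorphism U (\<phi> ` U) \<phi> (inv_into U \<phi>)) \<and>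
     (\<forall>(U, \<phi>)\<in>charts M. \<forall>(V, \<psi>)\<in>charts M. \<forall>i<mdim M.
        C_infinity (mdim M) (\<psi> ` (U \<inter> V)) (\<lambda>x. \<phi> (inv_into V \<psi> x) i))"

definition smooth_fun_on :: "('m, 'z) manifold_scheme \<Rightarrow> 'm set \<Rightarrow> ('m \<Rightarrow> real) \<Rightarrow> bool" where
  "smooth_fun_on M U f \<longleftrightarrow>
     (\<forall>(V, \<phi>)\<in>charts M. C_infinity (mdim M) (\<phi> ` (U \<inter> V)) (f \<circ> inv_into V \<phi>))"

definition smooth_near ::
    "('m::topological_space, 'z) manifold_scheme \<Rightarrow> 'm \<Rightarrow> ('m \<Rightarrow> real) \<Rightarrow> bool" where
  "smooth_near M p f \<longleftrightarrow> (\<exists>U. open U \<and> p \<in> U \<and> smooth_fun_on M U f)"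

text \<open>
  A tangent vector at \<open>p\<close> is a derivation on germs of smooth functions at \<open>p\<close>. A germ is given by
  any representative; on functions that are not smooth near \<open>p\<close> the derivation is extended by 0,
  so that equality of tangent vectors is equality in HOL.
\<close>

definition tangent_space ::
    "('m::topological_space, 'z) manifold_scheme \<Rightarrow> 'm \<Rightarrow> (('m \<Rightarrow> real) \<Rightarrow> real) set" where
  "tangent_space M p = {D.
     (\<forall>f. \<not> smooth_near M p f \<longrightarrow> D f = 0) \<and>
     (\<forall>f g. smooth_near M p f \<longrightarrow> smooth_near M p g \<longrightarrow> (\<forall>\<^sub>F q in nhds p. f q = g q) \<longrightarrow> D f = D g) \<and>
     (\<forall>f g. smooth_near M p f \<longrightarrow> smooth_near M p g \<longrightarrow> D (\<lambda>q. f q + g q) = D f + D g) \<and>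
     (\<forall>c f. smooth_near M p f \<longrightarrow> D (\<lambda>q. c * f q) = c * D f) \<and>
     (\<forall>f g. smooth_near M p f \<longrightarrow> smooth_near M p g \<longrightarrow>
        D (\<lambda>q. f q * g q) = f p * D g + g p * D f)}"

definition smooth_vector_field_on ::
    "('m::topological_space, 'z) manifold_scheme \<Rightarrow> 'm set \<Rightarrow> ('m \<Rightarrow> ('m \<Rightarrow> real) \<Rightarrow> real) \<Rightarrow> bool" where
  "smooth_vector_field_on M U Y \<longleftrightarrow>
     (\<forall>p\<in>U. Y p \<in> tangent_space M p) \<and>
     (\<forall>V f. open V \<longrightarrow> V \<subseteq> U \<longrightarrow> smooth_fun_on M V f \<longrightarrow> smooth_fun_on M V (\<lambda>p. Y p f))"


section \<open>Vector bundles and Lie algebroids\<close>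

text \<open>
  The fibres are subspaces of an ambient real vector space \<open>'v\<close>, which is only a carrier: it has no
  topology and no relation between different fibres is assumed. The smooth structure is given by
  local frames, i.e. by local trivializations \<open>U \<times> \<real>\<^sup>n \<cong> E|U\<close>, with smooth transition functions.
\<close>

record ('m, 'v) vector_bundle = "'m manifold" +
  bundle_rank :: nat
  fibre :: "'m \<Rightarrow> 'v set"
  frames :: "('m set \<times> (nat \<Rightarrow> 'm \<Rightarrow> 'v)) set"

definition smooth_vector_bundle ::
    "('m::{t2_space,second_countable_topology}, 'v::real_vector, 'z) vector_bundle_scheme \<Rightarrow> bool" where
  "smooth_vector_bundle E \<longleftrightarrow>
     smooth_manifold E \<and>
     (\<forall>p. subspace (fibre E p)) \<and>
     (\<Union>(U, e)\<in>frames E. U) = UNIV \<and>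
     (\<forall>(U, e)\<in>frames E. open U \<and>
        (\<forall>p\<in>U. inj_on (\<lambda>i. e i p) {..<bundle_rank E} \<and>
           independent ((\<lambda>i. e i p) ` {..<bundle_rank E}) \<and>
           span ((\<lambda>i. e i p) ` {..<bundle_rank E}) = fibre E p)) \<and>
     (\<forall>(U, e)\<in>frames E. \<forall>(V, e')\<in>frames E. \<exists>g.
        (\<forall>i<bundle_rank E. \<forall>j<bundle_rank E. smooth_fun_on E (U \<inter> V) (g i j)) \<and>
        (\<forall>p\<in>U \<inter> V. \<forall>j<bundle_rank E. e' j p = (\<Sum>i<bundle_rank E. g i j p *\<^sub>R e i p)))"

definition smooth_section_on ::
    "('m, 'v::real_vector, 'z) vector_bundle_scheme \<Rightarrow> 'm set \<Rightarrow> ('m \<Rightarrow> 'v) \<Rightarrow> bool" where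
  "smooth_section_on E U X \<longleftrightarrow>
     (\<forall>p\<in>U. X p \<in> fibre E p) \<and>
     (\<forall>(V, e)\<in>frames E. \<exists>c.
        (\<forall>i<bundle_rank E. smooth_fun_on E (U \<inter> V) (c i)) \<and>
        (\<forall>p\<in>U \<inter> V. X p = (\<Sum>i<bundle_rank E. c i p *\<^sub>R e i p)))"

definition Sec :: "('m, 'v::real_vector, 'z) vector_bundle_scheme \<Rightarrow> ('m \<Rightarrow> 'v) set" where
  "Sec E = {X. smooth_section_on E UNIV X}"

text \<open>
  The anchor is the bundle map \<open>\<rho> : E \<rightarrow> TM\<close>; \<open>anchor E p v f\<close> is the derivative of \<open>f\<close> along
  \<open>\<rho>(v)\<close> at \<open>p\<close>. The bracket is relevant on global smooth sections only.
\<close>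

record ('m, 'v) lie_algebroid = "('m, 'v) vector_bundle" +
  bracket :: "('m \<Rightarrow> 'v) \<Rightarrow> ('m \<Rightarrow> 'v) \<Rightarrow> 'm \<Rightarrow> 'v"
  anchor :: "'m \<Rightarrow> 'v \<Rightarrow> ('m \<Rightarrow> real) \<Rightarrow> real"

definition smooth_lie_algebroid ::
    "('m::{t2_space,second_countable_topology}, 'v::real_vector) lie_algebroid \<Rightarrow> bool" where
  "smooth_lie_algebroid E \<longleftrightarrow>
     smooth_vector_bundle E \<and>
     \<comment> \<open>the anchor is a smooth vector bundle morphism over the identity\<close>
     (\<forall>p. \<forall>v\<in>fibre E p. anchor E p v \<in> tangent_space E p) \<and>
     (\<forall>p f. \<forall>v\<in>fibre E p. \<forall>w\<in>fibre E p. anchor E p (v + w) f = anchor E p v f + anchor E p w f) \<and>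
     (\<forall>p f c. \<forall>v\<in>fibre E p. anchor E p (c *\<^sub>R v) f = c * anchor E p v f) \<and>
     (\<forall>U X. open U \<longrightarrow> smooth_section_on E U X \<longrightarrow>
        smooth_vector_field_on E U (\<lambda>p. anchor E p (X p))) \<and>
     \<comment> \<open>the bracket is a Lie bracket on \<open>Sec E\<close>\<close>
     (\<forall>X\<in>Sec E. \<forall>Y\<in>Sec E. bracket E X Y \<in> Sec E) \<and>
     (\<forall>X\<in>Sec E. \<forall>Y\<in>Sec E. \<forall>Z\<in>Sec E. \<forall>c p.
        bracket E (\<lambda>q. c *\<^sub>R X q + Y q) Z p = c *\<^sub>R bracket E X Z p + bracket E Y Z p) \<and>
     (\<forall>X\<in>Sec E. \<forall>Y\<in>Sec E. \<forall>p. bracket E X Y p = - bracket E Y X p) \<and>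
     (\<forall>X\<in>Sec E. \<forall>Y\<in>Sec E. \<forall>Z\<in>Sec E. \<forall>p.
        bracket E X (bracket E Y Z) p + bracket E Y (bracket E Z X) p
          + bracket E Z (bracket E X Y) p = 0) \<and>
     \<comment> \<open>Leibniz rule\<close>
     (\<forall>X\<in>Sec E. \<forall>Y\<in>Sec E. \<forall>f. smooth_fun_on E UNIV f \<longrightarrow>
        (\<forall>p. bracket E X (\<lambda>q. f q *\<^sub>R Y q) p = f p *\<^sub>R bracket E X Y p + anchor E p (X p) f *\<^sub>R Y p)) \<and>
     \<comment> \<open>the anchor intertwines the brackets\<close>
     (\<forall>X\<in>Sec E. \<forall>Y\<in>Sec E. \<forall>U f. open U \<longrightarrow> smooth_fun_on E U f \<longrightarrow>
        (\<forall>p\<in>U. anchor E p (bracket E X Y p) f =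
           anchor E p (X p) (\<lambda>q. anchor E q (Y q) f) - anchor E p (Y p) (\<lambda>q. anchor E q (X q) f)))"


section \<open>Exterior powers and contraction\<close>

text \<open>
  All degrees are integers, so that the spaces of negative degree are zero without special cases.
  An element of \<open>\<Lambda>\<^sup>k V\<^sup>*\<close> is an alternating \<open>k\<close>-linear map on \<open>V\<close>, applied to the list of its
  arguments and extended by 0 to all other lists.
\<close>

type_synonym 'v form = "'v list \<Rightarrow> real"
type_synonym 'v multivector = "'v form \<Rightarrow> real"

definition alt_forms :: "'v::real_vector set \<Rightarrow> int \<Rightarrow> 'v form set" where
  "alt_forms V k = {\<omega>.
     (\<forall>vs. \<not> (int (length vs) = k \<and> set vs \<subseteq> V) \<longrightarrow> \<omega> vs = 0) \<and>
     (\<forall>us x y ws. int (length (us @ x # ws)) = k \<longrightarrow> set (us @ x # y # ws) \<subseteq> V \<longrightarrow>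
        \<omega> (us @ (x + y) # ws) = \<omega> (us @ x # ws) + \<omega> (us @ y # ws)) \<and>
     (\<forall>us x ws c. int (length (us @ x # ws)) = k \<longrightarrow> set (us @ x # ws) \<subseteq> V \<longrightarrow>
        \<omega> (us @ (c *\<^sub>R x) # ws) = c * \<omega> (us @ x # ws)) \<and>
     (\<forall>vs. \<not> distinct vs \<longrightarrow> \<omega> vs = 0)}"

text \<open>
  The decomposable multivector \<open>v\<^sub>1 \<and> \<dots> \<and> v\<^sub>k\<close> is realized as the functional \<open>\<omega> \<mapsto> \<omega>(v\<^sub>1, \<dots>, v\<^sub>k)\<close> on
  \<open>\<Lambda>\<^sup>k V\<^sup>*\<close> (extended by 0), and \<open>\<Lambda>\<^sup>k V\<close> is the span of the decomposables. This uses the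
  pairing that identifies \<open>\<Lambda>\<^sup>k V\<close> with a space of functionals on \<open>\<Lambda>\<^sup>k V\<^sup>*\<close>: alternating maps
  separate the elements of \<open>\<Lambda>\<^sup>k V\<close>.
\<close>

definition wedge :: "'v::real_vector set \<Rightarrow> 'v list \<Rightarrow> 'v multivector" where
  "wedge V vs = (\<lambda>\<omega>. if \<omega> \<in> alt_forms V (int (length vs)) then \<omega> vs else 0)"

definition ext_power :: "'v::real_vector set \<Rightarrow> int \<Rightarrow> 'v multivector set" where
  "ext_power V k = {a. \<exists>(N::nat) c vs.
     (\<forall>j<N. int (length (vs j)) = k \<and> set (vs j) \<subseteq> V) \<and>
     a = (\<lambda>\<omega>. \<Sum>j<N. c j * wedge V (vs j) \<omega>)}"

text \<open>
  \<open>(i\<^sub>a \<omega>)(w\<^sub>1, \<dots>) = a(\<omega>(\<hyphen>, w\<^sub>1, \<dots>))\<close>. For \<open>a = v\<^sub>1 \<and> \<dots> \<and> v\<^sub>k\<close> this is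
  \<open>\<omega>(v\<^sub>1, \<dots>, v\<^sub>k, w\<^sub>1, \<dots>)\<close>; hence \<open>i\<^sub>X\<close> is the usual insertion, \<open>i\<^sub>f\<close> is multiplication by \<open>f\<close> and
  \<open>i(a \<and> b) = i\<^sub>b i\<^sub>a\<close>. If the number of the \<open>w\<close>'s does not match, the argument of \<open>a\<close> is 0 or
  not of degree \<open>k\<close> and the value is 0.
\<close>

definition contract :: "'v multivector \<Rightarrow> 'v form \<Rightarrow> 'v form" where
  "contract a \<omega> = (\<lambda>ws. a (\<lambda>vs. \<omega> (vs @ ws)))"

definition increasing_lists :: "nat \<Rightarrow> int \<Rightarrow> nat list set" where
  "increasing_lists n k = {I. sorted_wrt (<) I \<and> set I \<subseteq> {..<n} \<and> int (length I) = k}"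

text \<open>
  \<open>Forms E U k\<close> are the smooth sections of \<open>\<Lambda>\<^sup>k E\<^sup>*\<close> over the open set \<open>U\<close>, extended by 0 outside
  \<open>U\<close>; \<open>Forms E UNIV k\<close> is \<open>\<A>\<^sup>k(E\<^sup>*)\<close> and \<open>Multivectors E k\<close> is \<open>\<A>\<^sup>k(E)\<close>. Smoothness is smoothness
  of the components in the frames induced by the local frames of \<open>E\<close>.
\<close>

definition smooth_form_on ::
    "('m, 'v::real_vector, 'z) vector_bundle_scheme \<Rightarrow> 'm set \<Rightarrow> int \<Rightarrow> ('m \<Rightarrow> 'v form) \<Rightarrow> bool" where
  "smooth_form_on E U k \<omega> \<longleftrightarrow>
     (\<forall>p\<in>U. \<omega> p \<in> alt_forms (fibre E p) k) \<and>
     (\<forall>(V, e)\<in>frames E. \<forall>I\<in>increasing_lists (bundle_rank E) k.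
        smooth_fun_on E (U \<inter> V) (\<lambda>p. \<omega> p (map (\<lambda>i. e i p) I)))"

definition Forms ::
    "('m, 'v::real_vector, 'z) vector_bundle_scheme \<Rightarrow> 'm set \<Rightarrow> int \<Rightarrow> ('m \<Rightarrow> 'v form) set" where
  "Forms E U k = {\<omega>. smooth_form_on E U k \<omega> \<and> (\<forall>p. p \<notin> U \<longrightarrow> \<omega> p = (\<lambda>_. 0))}"

definition Multivectors ::
    "('m, 'v::real_vector, 'z) vector_bundle_scheme \<Rightarrow> int \<Rightarrow> ('m \<Rightarrow> 'v multivector) set" where
  "Multivectors E k = {a.
     (\<forall>p. a p \<in> ext_power (fibre E p) k) \<and>
     (\<forall>(V, e)\<in>frames E. \<exists>c.
        (\<forall>I\<in>increasing_lists (bundle_rank E) k. smooth_fun_on E V (c I)) \<and>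
        (\<forall>p\<in>V. a p = (\<lambda>\<omega>. \<Sum>I\<in>increasing_lists (bundle_rank E) k.
                             c I p * wedge (fibre E p) (map (\<lambda>i. e i p) I) \<omega>)))}"


section \<open>The Lie algebroid de Rham differential\<close>

definition remove_nth :: "nat \<Rightarrow> 'a list \<Rightarrow> 'a list" where
  "remove_nth i xs = take i xs @ drop (Suc i) xs"

text \<open>
  The right-hand side of the Cartan-Koszul formula for \<open>(d\<omega>)(X\<^sub>0, \<dots>, X\<^sub>k)\<close> at the point \<open>p\<close>.
  The form \<open>\<omega>\<close> only has to be defined near \<open>p\<close>, whereas the \<open>X\<^sub>i\<close> are global sections.
\<close>

definition koszul ::
    "('m, 'v::real_vector) lie_algebroid \<Rightarrow> ('m \<Rightarrow> 'v form) \<Rightarrow> ('m \<Rightarrow> 'v) list \<Rightarrow> 'm \<Rightarrow> real" where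
  "koszul E \<omega> Xs p =
     (\<Sum>i<length Xs. (-1) ^ i *
        anchor E p ((Xs ! i) p) (\<lambda>q. \<omega> q (map (\<lambda>X. X q) (remove_nth i Xs)))) +
     (\<Sum>j<length Xs. \<Sum>i<j. (-1) ^ (i + j) *
        \<omega> p (bracket E (Xs ! i) (Xs ! j) p # map (\<lambda>X. X p) (remove_nth i (remove_nth j Xs))))"

text \<open>
  The differential of a form of degree \<open>k\<close> over the open set \<open>U\<close>. As every vector in \<open>E\<close> over \<open>U\<close> is
  the value of a global section, the condition determines the form over \<open>U\<close>.
\<close>

definition dR ::
    "('m, 'v::real_vector) lie_algebroid \<Rightarrow> 'm set \<Rightarrow> int \<Rightarrow> ('m \<Rightarrow> 'v form) \<Rightarrow> 'm \<Rightarrow> 'v form" where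
  "dR E U k \<omega> = (THE \<eta>. \<eta> \<in> Forms E U (k + 1) \<and>
     (\<forall>Xs. set Xs \<subseteq> Sec E \<longrightarrow> int (length Xs) = k + 1 \<longrightarrow>
        (\<forall>p\<in>U. \<eta> p (map (\<lambda>X. X p) Xs) = koszul E \<omega> Xs p)))"


section \<open>Odd volume forms and homology operators\<close>

text \<open>
  A point of \<open>|Vol|\<^sub>E\<close> over \<open>p\<close> is the orbit \<open>{w, -w}\<close> of a nonzero \<open>w \<in> \<Lambda>\<^sup>n E\<^sub>p\<^sup>*\<close>.
  \<open>local_representative E \<nu> U \<mu>\<close>: \<open>\<mu>\<close> is a nowhere vanishing smooth section over the open set \<open>U\<close>
  representing \<open>\<nu>\<close> there.
\<close>

definition local_representative ::
    "('m::topological_space, 'v::real_vector, 'z) vector_bundle_scheme \<Rightarrow> ('m \<Rightarrow> 'v form set) \<Rightarrow>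
      'm set \<Rightarrow> ('m \<Rightarrow> 'v form) \<Rightarrow> bool" where
  "local_representative E \<nu> U \<mu> \<longleftrightarrow>
     open U \<and> \<mu> \<in> Forms E U (int (bundle_rank E)) \<and>
     (\<forall>p\<in>U. \<mu> p \<noteq> (\<lambda>_. 0) \<and> \<nu> p = {\<mu> p, (\<lambda>vs. - \<mu> p vs)})"

definition odd_volume_forms ::
    "('m::topological_space, 'v::real_vector, 'z) vector_bundle_scheme \<Rightarrow> ('m \<Rightarrow> 'v form set) set" where
  "odd_volume_forms E = {\<nu>. \<forall>p. \<exists>U \<mu>. p \<in> U \<and> local_representative E \<nu> U \<mu>}"

text \<open>\<open>homology_op E \<nu> k\<close> is the component \<open>\<A>\<^sup>k(E) \<rightarrow> \<A>\<^sup>k\<^sup>-\<^sup>1(E)\<close> of the operator \<open>\<partial>\<^sub>\<nu>\<close>.\<close>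

definition homology_op ::
    "('m::topological_space, 'v::real_vector) lie_algebroid \<Rightarrow> ('m \<Rightarrow> 'v form set) \<Rightarrow> int \<Rightarrow>
      ('m \<Rightarrow> 'v multivector) \<Rightarrow> 'm \<Rightarrow> 'v multivector" where
  "homology_op E \<nu> k a = (THE b. b \<in> Multivectors E (k - 1) \<and>
     (\<forall>U \<mu>. local_representative E \<nu> U \<mu> \<longrightarrow>
        (\<forall>p\<in>U. contract (b p) (\<mu> p) =
           (\<lambda>ws. (-1) powi k *
              dR E U (int (bundle_rank E) - k) (\<lambda>q. contract (a q) (\<mu> q)) p ws))))"

text \<open>
  Trivializability of the line bundle \<open>\<Lambda>\<^sup>n E\<^sup>*\<close>: there is a fibrewise linear bijection
  \<open>\<Phi> : \<Lambda>\<^sup>n E\<^sup>* \<rightarrow> M \<times> \<real>\<close> that is smooth together with its inverse, i.e. local sections are smooth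
  if and only if their images are.
\<close>

definition top_power_trivializable ::
    "('m::topological_space, 'v::real_vector, 'z) vector_bundle_scheme \<Rightarrow> bool" where
  "top_power_trivializable E \<longleftrightarrow> (\<exists>\<Phi> :: 'm \<Rightarrow> 'v form \<Rightarrow> real.
     (\<forall>p. bij_betw (\<Phi> p) (alt_forms (fibre E p) (int (bundle_rank E))) UNIV \<and>
        (\<forall>\<omega>\<in>alt_forms (fibre E p) (int (bundle_rank E)).
         \<forall>\<eta>\<in>alt_forms (fibre E p) (int (bundle_rank E)). \<forall>c.
           \<Phi> p (\<lambda>vs. c * \<omega> vs + \<eta> vs) = c * \<Phi> p \<omega> + \<Phi> p \<eta>)) \<and>
     (\<forall>U \<omega>. open U \<longrightarrow> (\<forall>p\<in>U. \<omega> p \<in> alt_forms (fibre E p) (int (bundle_rank E))) \<longrightarrow>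
        (smooth_form_on E U (int (bundle_rank E)) \<omega> \<longleftrightarrow> smooth_fun_on E U (\<lambda>p. \<Phi> p (\<omega> p)))))"


section \<open>Homology\<close>

record 'a vspace =
  vcarrier :: "'a set"
  vadd :: "'a \<Rightarrow> 'a \<Rightarrow> 'a"
  vscale :: "real \<Rightarrow> 'a \<Rightarrow> 'a"

definition vspace_iso :: "('a \<Rightarrow> 'b) \<Rightarrow> 'a vspace \<Rightarrow> 'b vspace \<Rightarrow> bool" where
  "vspace_iso \<phi> V W \<longleftrightarrow>
     bij_betw \<phi> (vcarrier V) (vcarrier W) \<and>
     (\<forall>x\<in>vcarrier V. \<forall>y\<in>vcarrier V. \<phi> (vadd V x y) = vadd W (\<phi> x) (\<phi> y)) \<and>
     (\<forall>c. \<forall>x\<in>vcarrier V. \<phi> (vscale V c x) = vscale W c (\<phi> x))"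

definition vspace_isomorphic :: "'a vspace \<Rightarrow> 'b vspace \<Rightarrow> bool" where
  "vspace_isomorphic V W \<longleftrightarrow> (\<exists>\<phi>. vspace_iso \<phi> V W)"

definition graded_isomorphic :: "(int \<Rightarrow> 'a vspace) \<Rightarrow> (int \<Rightarrow> 'b vspace) \<Rightarrow> bool" where
  "graded_isomorphic V W \<longleftrightarrow> (\<exists>\<Phi>. \<forall>k. vspace_iso (\<Phi> k) (V k) (W k))"

text \<open>
  The quotient \<open>Z / B\<close> of spaces of sections (forms or multivector fields, both of type
  \<open>'m \<Rightarrow> 'x \<Rightarrow> real\<close>), with cosets \<open>z + B\<close> as elements. In the scalar multiplication \<open>B\<close> is added
  because of the scalar 0.
\<close>

definition quotient_vspace ::
    "('m \<Rightarrow> 'x \<Rightarrow> real) set \<Rightarrow> ('m \<Rightarrow> 'x \<Rightarrow> real) set \<Rightarrow> ('m \<Rightarrow> 'x \<Rightarrow> real) set vspace" where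
  "quotient_vspace Z B = \<lparr>
     vcarrier = (\<lambda>z. {(\<lambda>p x. z p x + b p x) | b. b \<in> B}) ` Z,
     vadd = (\<lambda>P Q. {(\<lambda>p x. y p x + z p x) | y z. y \<in> P \<and> z \<in> Q}),
     vscale = (\<lambda>c P. {(\<lambda>p x. c * z p x + b p x) | z b. z \<in> P \<and> b \<in> B})\<rparr>"

text \<open>\<open>H\<^sup>k(E, d)\<close> and \<open>H\<^sub>k(E, \<partial>\<^sub>\<nu>)\<close>.\<close>

definition cohomology ::
    "('m, 'v::real_vector) lie_algebroid \<Rightarrow> int \<Rightarrow> ('m \<Rightarrow> 'v form) set vspace" where
  "cohomology E k = quotient_vspace
     {\<omega> \<in> Forms E UNIV k. dR E UNIV k \<omega> = (\<lambda>_ _. 0)}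
     (dR E UNIV (k - 1) ` Forms E UNIV (k - 1))"

definition homology ::
    "('m::topological_space, 'v::real_vector) lie_algebroid \<Rightarrow> ('m \<Rightarrow> 'v form set) \<Rightarrow> int \<Rightarrow>
      ('m \<Rightarrow> 'v multivector) set vspace" where
  "homology E \<nu> k = quotient_vspace
     {a \<in> Multivectors E k. homology_op E \<nu> k a = (\<lambda>_ _. 0)}
     (homology_op E \<nu> (k + 1) ` Multivectors E (k + 1))"

end

theory Submission
  imports Defs
begin

text \<open>
  Two odd volume forms differ by a positive smooth function \<open>h\<close>. As \<open>i\<^sub>a(h\<mu>) = i\<^sub>h\<^sub>a\<mu>\<close>, multiplication
  by \<open>h\<close> intertwines the two homology operators. A trivialization of the top exterior power singles
  out the positive one of the two values \<open>\<plusminus>\<mu>\<close> at each point, hence a global volume form \<open>\<mu>\<close>, and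
  \<open>a \<mapsto> i\<^sub>a\<mu>\<close> then intertwines the homology operator with \<open>d\<close> up to sign. That all operators are well
  defined rests on two facts. The Koszul formula is tensorial: by Cartan's formula
  \<open>i\<^sub>X d = L\<^sub>X - d i\<^sub>X\<close> and induction on the degree it is alternating and \<open>C\<^sup>\<infinity>\<close>-linear, hence by bump
  functions its value at a point depends only on the values of its arguments there. And contraction
  with a volume form is a fibrewise isomorphism, because it maps the basis element \<open>e\<^sub>I\<close> to a nonzero
  multiple of the dual of the complementary \<open>e\<^sub>J\<close>.
\<close>

text \<open>Both \<open>dR\<close> and \<open>homology_op\<close> are definite descriptions, so that
  nothing can be read off from them before the described object is known to exist and to be unique.
  Uniqueness is checked pointwise; existence is the obstacle. The Koszul formula takes global
  sections and contains brackets and derivatives, so that neither C-infinity-linearity nor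
  alternation is visible term by term, and the double sum over deleted indices makes a direct check
  unwieldy. A recursion on the list of arguments replaces indices by list structure: operators on
  sections are closed under fixing the first argument, and the Koszul sums enter only when they are
  identified with the recursion. The boundary operator is found fibre by fibre, by inverting the
  contraction with a chosen representative. Two representatives differ by a sign at each point, and
  the sign has to be locally constant before it can be pulled through \<open>dR\<close>, which
  commutes with constants but not with functions. Smoothness of the result is recovered from the
  explicit inverse in components.\<close>

section \<open>Smooth functions in coordinates\<close>

text \<open>The derivative of \<open>flat_exp k\<close> is a combination of \<open>flat_exp (k + 1)\<close> and \<open>flat_exp (k + 2)\<close>, so that
  smoothness of \<open>flat_exp k \<circ> f\<close> follows by induction from the chain rule in one variable.\<close>

definition flat_exp :: "nat \<Rightarrow> real \<Rightarrow> real" where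
  "flat_exp k x = (if x \<le> 0 then 0 else inverse x ^ k * exp (- inverse x))"

lemma flat_exp_nonpos: "x \<le> 0 \<Longrightarrow> flat_exp k x = 0"
  by (simp add: flat_exp_def)

lemma flat_exp_pos: "x > 0 \<Longrightarrow> flat_exp k x > 0"
  by (simp add: flat_exp_def)

lemma flat_exp_nonneg: "flat_exp k x \<ge> 0"
  by (simp add: flat_exp_def)

text \<open>Under y = 1/x the limit from the right becomes that of y^k / exp y at infinity; on the
  left the function vanishes.\<close>

lemma flat_exp_tendsto_0: "(flat_exp k \<longlongrightarrow> 0) (at 0)"
proof -
  have "((\<lambda>y::real. y ^ k / exp y) \<longlongrightarrow> 0) at_top"
    by (rule tendsto_power_div_exp_0)
  then have lim: "((\<lambda>x::real. inverse x ^ k / exp (inverse x)) \<longlongrightarrow> 0) (at_right 0)"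
    by (rule filterlim_compose) (rule filterlim_inverse_at_top_right)
  have ev: "\<forall>\<^sub>F x in at_right (0::real). flat_exp k x = inverse x ^ k / exp (inverse x)"
    unfolding eventually_at_right_field
    by (intro exI[of _ 1]) (auto simp: flat_exp_def exp_minus divide_inverse)
  have r: "(flat_exp k \<longlongrightarrow> 0) (at_right 0)"
    by (rule tendsto_cong[OF ev, THEN iffD2, OF lim])
  have "\<forall>\<^sub>F x in at_left (0::real). flat_exp k x = 0"
    unfolding eventually_at_left_field
    by (intro exI[of _ "-1"]) (auto simp: flat_exp_def)
  then have "(flat_exp k \<longlongrightarrow> 0) (at_left 0)"
    by (rule tendsto_eventually)
  with r show ?thesis
    by (simp add: filterlim_split_at)
qed

lemma DERIV_flat_exp:
  "(flat_exp k has_real_derivative (flat_exp (k + 2) x - k * flat_exp (k + 1) x)) (at x)"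
proof -
  consider "x < 0" | "x = 0" | "x > 0" by linarith
  then show ?thesis
  proof cases
    case 1
    have "((\<lambda>_. 0::real) has_real_derivative 0) (at x)" by simp
    moreover have "\<forall>\<^sub>F y in nhds x. flat_exp k y = 0"
      using eventually_nhds_in_open[of "{..<0}" x] 1
      by (auto elim!: eventually_mono simp: flat_exp_def)
    ultimately show ?thesis
      using 1 by (subst DERIV_cong_ev[OF refl _ refl, where g = "\<lambda>_. 0"]) (auto simp: flat_exp_nonpos)
  next
    case 2
    \<comment> \<open>The difference quotient at 0 is \<open>flat_exp (k + 1)\<close>, and the
      claimed derivative at 0 is 0.\<close>
    have "((\<lambda>y. (flat_exp k y - flat_exp k 0) / (y - 0)) \<longlongrightarrow> 0) (at 0)"
      using flat_exp_tendsto_0[of "k + 1"]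
      by (rule Lim_transform_eventually)
        (auto simp: flat_exp_def field_simps intro!: always_eventually)
    then show ?thesis
      using 2 by (simp add: has_field_derivative_iff flat_exp_nonpos)
  next
    case 3
    have p: "((\<lambda>y. inverse y ^ k) has_real_derivative (- real k * inverse x ^ (k + 1))) (at x)"
      using DERIV_power[OF DERIV_inverse'[OF DERIV_ident[of "at x"]], of k] 3
      by (cases k) (simp_all add: algebra_simps)
    have "((\<lambda>y. exp (- inverse y)) has_real_derivative (exp (- inverse x) * inverse x ^ 2)) (at x)"
      using 3 by (auto intro!: derivative_eq_intros simp: power2_eq_square)
    from DERIV_mult[OF p this]
    have "((\<lambda>y::real. inverse y ^ k * exp (- inverse y)) has_real_derivative
        (flat_exp (k + 2) x - k * flat_exp (k + 1) x)) (at x)"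
      using 3 by (simp add: flat_exp_def algebra_simps power2_eq_square)
    moreover have "\<forall>\<^sub>F y in nhds x. flat_exp k y = inverse y ^ k * exp (- inverse y)"
      using eventually_nhds_in_open[of "{0<..}" x] 3
      by (auto elim!: eventually_mono simp: flat_exp_def)
    ultimately show ?thesis
      by (subst DERIV_cong_ev[OF refl _ refl])
  qed
qed

lemma isCont_flat_exp: "isCont (flat_exp k) x"
  by (rule DERIV_isCont[OF DERIV_flat_exp])

section \<open>The classes \<open>C_k\<close>: restriction, localization and arithmetic\<close>

lemma C_k_continuous: "C_k m r S f \<Longrightarrow> continuous_on S f"
  by (cases r) auto

text \<open>The derivative clause inside \<open>C_k\<close>, named so that one order of
  differentiability can be peeled off at a time.\<close>

definition has_partial :: "nat \<Rightarrow> (nat \<Rightarrow> real) set \<Rightarrow> ((nat \<Rightarrow> real) \<Rightarrow> real) \<Rightarrow> ((nat \<Rightarrow> real) \<Rightarrow> real) \<Rightarrow> bool" where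
  "has_partial i S f g \<longleftrightarrow> (\<forall>x\<in>S. ((\<lambda>t. f (x(i := t))) has_real_derivative g x) (at (x i)))"

lemma has_partialD:
  "has_partial i S f g \<Longrightarrow> x \<in> S \<Longrightarrow> ((\<lambda>t. f (x(i := t))) has_real_derivative g x) (at (x i))"
  by (simp add: has_partial_def)

lemma has_partialI:
  "(\<And>x. x \<in> S \<Longrightarrow> ((\<lambda>t. f (x(i := t))) has_real_derivative g x) (at (x i))) \<Longrightarrow> has_partial i S f g"
  by (simp add: has_partial_def)

lemma C_k_Suc_iff:
  "C_k m (Suc r) S f \<longleftrightarrow> continuous_on S f \<and> (\<forall>i<m. \<exists>g. has_partial i S f g \<and> C_k m r S g)"
  by (simp only: C_k.simps has_partial_def)

lemma C_k_SucE:
  assumes "C_k m (Suc r) S f" "i < m"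
  obtains g where "has_partial i S f g" "C_k m r S g"
  using assms unfolding C_k_Suc_iff by blast

lemma C_k_SucI:
  assumes "continuous_on S f"
    and "\<And>i. i < m \<Longrightarrow> \<exists>g. has_partial i S f g \<and> C_k m r S g"
  shows "C_k m (Suc r) S f"
  using assms unfolding C_k_Suc_iff by blast

lemma C_k_mono: "C_k m r S f \<Longrightarrow> T \<subseteq> S \<Longrightarrow> C_k m r T f"
proof (induction r arbitrary: f)
  case 0
  then show ?case by (auto intro: continuous_on_subset)
next
  case (Suc r)
  show ?case
  proof (rule C_k_SucI)
    show "continuous_on T f" using Suc.prems C_k_continuous continuous_on_subset by blast
    fix i assume "i < m"
    with Suc.prems(1) obtain g
      where g: "has_partial i S f g" "C_k m r S g"
      by (rule C_k_SucE)
    show "\<exists>g. has_partial i T f g \<and> C_k m r T g"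
      using g(1) Suc.IH[OF g(2) Suc.prems(2)] Suc.prems(2) unfolding has_partial_def by blast
  qed
qed

lemma openin_Euclidean_space_open:
  assumes "openin (Euclidean_space m) T"
  obtains T' where "open T'" "T = T' \<inter> {x. \<forall>i\<ge>m. x i = 0}"
  using assms unfolding Euclidean_space_def openin_subtopology
  by (auto simp: euclidean_product_topology)

text \<open>\<open>S\<close> is open only relative to the sequences that vanish from index
  \<open>m\<close> on. A line in a direction \<open>i < m\<close> stays among these sequences, hence
  near \<open>x\<close> it stays in \<open>S\<close>. This makes partial derivatives on
  \<open>S\<close> independent of values off \<open>S\<close>.\<close>

lemma eventually_line_in_openin:
  assumes "openin (Euclidean_space m) S" "x \<in> S" "i < m"
  shows "\<forall>\<^sub>F t in nhds (x i). x(i := t) \<in> S"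
proof -
  obtain S' where S': "open S'" "S = S' \<inter> {x. \<forall>i\<ge>m. x i = 0}"
    using openin_Euclidean_space_open[OF assms(1)] .
  have "continuous_on UNIV (\<lambda>t. x(i := t))"
  proof (rule continuous_on_coordinatewise_then_product)
    show "continuous_on UNIV (\<lambda>t. (x(i := t)) j)" for j
      by (cases "j = i") auto
  qed
  then have "open ((\<lambda>t. x(i := t)) -` S')"
    using S'(1) by (simp add: continuous_on_open_vimage)
  moreover have "x i \<in> (\<lambda>t. x(i := t)) -` S'" using assms S' by auto
  ultimately have "\<forall>\<^sub>F t in nhds (x i). t \<in> (\<lambda>t. x(i := t)) -` S'"
    by (rule eventually_nhds_in_open)
  then show ?thesis
    by (rule eventually_mono) (use assms S' in auto)
qed

lemma C_k_cong:
  assumes "openin (Euclidean_space m) S" "\<And>x. x \<in> S \<Longrightarrow> f x = g x" "C_k m r S f"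
  shows "C_k m r S g"
proof (cases r)
  case 0
  then show ?thesis using assms(2,3) by (auto cong: continuous_on_cong)
next
  case (Suc r')
  have "((\<lambda>t. g (x(i := t))) has_real_derivative d) (at (x i))"
    if "((\<lambda>t. f (x(i := t))) has_real_derivative d) (at (x i))" "x \<in> S" "i < m" for x i d
  proof -
    have "\<forall>\<^sub>F t in nhds (x i). g (x(i := t)) = f (x(i := t))"
      using eventually_line_in_openin[OF assms(1) that(2,3)]
      by (rule eventually_mono) (simp add: assms(2))
    with that(1) show ?thesis
      by (subst DERIV_cong_ev[OF refl _ refl])
  qed
  note deriv = this
  show ?thesis unfolding Suc
  proof (rule C_k_SucI)
    show "continuous_on S g"
      using C_k_continuous[OF assms(3)] assms(2) by (auto cong: continuous_on_cong)
    fix i assume "i < m"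
    with assms(3)[unfolded Suc] obtain h
      where h: "has_partial i S f h" "C_k m r' S h"
      by (rule C_k_SucE)
    show "\<exists>h. has_partial i S g h \<and> C_k m r' S h"
      using h(2) has_partialD[OF h(1), THEN deriv] \<open>i < m\<close> has_partialI by blast
  qed
qed

lemma continuous_on_openin_local:
  fixes f :: "(nat \<Rightarrow> real) \<Rightarrow> real"
  assumes H: "\<And>x. x \<in> S \<Longrightarrow> \<exists>T. openin (Euclidean_space m) T \<and> x \<in> T \<and> T \<subseteq> S \<and> continuous_on T f"
  shows "continuous_on S f"
proof -
  have S: "S \<subseteq> {x. \<forall>i\<ge>m. x i = 0}"
  proof
    fix x assume "x \<in> S"
    from H[OF this] openin_subset show "x \<in> {x. \<forall>i\<ge>m. x i = 0}"
      unfolding topspace_Euclidean_space[symmetric] by blast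
  qed
  have "continuous (at x within S) f" if "x \<in> S" for x
  proof -
    obtain T where T: "openin (Euclidean_space m) T" "x \<in> T" "T \<subseteq> S" "continuous_on T f"
      using H[OF \<open>x \<in> S\<close>] by blast
    obtain T' where T': "open T'" "T = T' \<inter> {x. \<forall>i\<ge>m. x i = 0}"
      using openin_Euclidean_space_open[OF T(1)] .
    have "at x within S = at x within T"
      by (rule at_within_nhd[of x T']) (use S T T' in auto)
    then show ?thesis
      using T(4,2) by (simp add: continuous_on_eq_continuous_within)
  qed
  then show ?thesis by (simp add: continuous_on_eq_continuous_within)
qed

lemma C_k_local:
  assumes "\<And>x. x \<in> S \<Longrightarrow> \<exists>T. openin (Euclidean_space m) T \<and> x \<in> T \<and> T \<subseteq> S \<and> C_k m r T f"
  shows "C_k m r S f"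
  using assms
proof (induction r arbitrary: f)
  case 0
  then show ?case using continuous_on_openin_local[of S m f] by simp
next
  case (Suc r)
  have partials: "\<exists>g. has_partial i S f g \<and> C_k m r S g" if "i < m" for i
  proof -
    \<comment> \<open>The hypothesis provides a derivative on each \<open>T\<close> separately.
      Choosing it pointwise glues these functions, since uniqueness of derivatives forces
      \<open>g\<close> to agree with every local one.\<close>
    define g where "g x = (SOME d. ((\<lambda>t. f (x(i := t))) has_real_derivative d) (at (x i)))" for x
    have g: "g x = d" if "((\<lambda>t. f (x(i := t))) has_real_derivative d) (at (x i))" for x d
      unfolding g_def using that by (intro some_equality) (auto intro: DERIV_unique)
    have *: "\<exists>T. openin (Euclidean_space m) T \<and> x \<in> T \<and> T \<subseteq> S \<and> C_k m r T g \<and>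
        ((\<lambda>t. f (x(i := t))) has_real_derivative g x) (at (x i))" if "x \<in> S" for x
    proof -
      obtain T where T: "openin (Euclidean_space m) T" "x \<in> T" "T \<subseteq> S" "C_k m (Suc r) T f"
        using Suc.prems \<open>x \<in> S\<close> by blast
      from T(4) \<open>i < m\<close> obtain h
        where h: "has_partial i T f h" "C_k m r T h"
        by (rule C_k_SucE)
      have gh: "g x = h x" if "x \<in> T" for x
        using g has_partialD[OF h(1)] that by blast
      then have "C_k m r T g"
        using C_k_cong[OF T(1) _ h(2)] by simp
      then show ?thesis using T has_partialD[OF h(1) T(2)] gh[OF T(2)] by auto
    qed
    then have "C_k m r S g"
      by (intro Suc.IH) blast
    moreover have "has_partial i S f g"
      using * by (intro has_partialI) blast
    ultimately show ?thesis by blast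
  qed
  have "continuous_on S f"
    using Suc.prems C_k_continuous by (intro continuous_on_openin_local[of S m]) metis
  then show ?case using partials by (rule C_k_SucI)
qed

lemma C_k_const: "C_k m r S (\<lambda>_. c)"
proof (induction r arbitrary: c)
  case (Suc r)
  show ?case using Suc[of 0] by (auto intro!: exI[of _ "\<lambda>_. 0"])
qed auto

lemma C_k_add: "C_k m r S f \<Longrightarrow> C_k m r S g \<Longrightarrow> C_k m r S (\<lambda>x. f x + g x)"
proof (induction r arbitrary: f g)
  case (Suc r)
  have "\<exists>h. has_partial i S (\<lambda>x. f x + g x) h \<and> C_k m r S h"
    if "i < m" for i
  proof -
    obtain f' where f': "has_partial i S f f'" "C_k m r S f'"
      by (rule C_k_SucE[OF Suc.prems(1) \<open>i < m\<close>])
    obtain g' where g': "has_partial i S g g'" "C_k m r S g'"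
      by (rule C_k_SucE[OF Suc.prems(2) \<open>i < m\<close>])
    show ?thesis
      using f'(1) g'(1) Suc.IH[OF f'(2) g'(2)] by (intro exI[of _ "\<lambda>x. f' x + g' x"]) (auto simp: has_partial_def intro!: derivative_intros)
  qed
  then show ?case using Suc.prems by (intro C_k_SucI) (auto intro: continuous_intros C_k_continuous)
qed (auto intro: continuous_intros)

text \<open>The product, quotient and chain rules contain the undifferentiated functions next to
  their derivatives; in an induction on the order these have to enter with one order less.\<close>

lemma C_k_Suc: "C_k m (Suc r) S f \<Longrightarrow> C_k m r S f"
proof (induction r arbitrary: f)
  case (Suc r)
  show ?case
  proof (rule C_k_SucI)
    show "continuous_on S f" using Suc.prems C_k_continuous by blast
    fix i assume "i < m"
    with Suc.prems obtain g
      where "has_partial i S f g" "C_k m (Suc r) S g"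
      by (rule C_k_SucE)
    then show "\<exists>g. has_partial i S f g \<and> C_k m r S g"
      using Suc.IH by blast
  qed
qed auto

lemma C_k_mult: "C_k m r S f \<Longrightarrow> C_k m r S g \<Longrightarrow> C_k m r S (\<lambda>x. f x * g x)"
proof (induction r arbitrary: f g)
  case (Suc r)
  have "\<exists>h. has_partial i S (\<lambda>x. f x * g x) h \<and> C_k m r S h"
    if "i < m" for i
  proof -
    obtain f' where f': "has_partial i S f f'" "C_k m r S f'"
      by (rule C_k_SucE[OF Suc.prems(1) \<open>i < m\<close>])
    obtain g' where g': "has_partial i S g g'" "C_k m r S g'"
      by (rule C_k_SucE[OF Suc.prems(2) \<open>i < m\<close>])
    have "C_k m r S (\<lambda>x. f' x * g x + g' x * f x)"
      using Suc.IH f'(2) g'(2) Suc.prems[THEN C_k_Suc] C_k_add by blast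
    moreover have "has_partial i S (\<lambda>x. f x * g x) (\<lambda>x. f' x * g x + g' x * f x)"
    proof (rule has_partialI)
      fix x assume x: "x \<in> S"
      show "((\<lambda>t. f (x(i := t)) * g (x(i := t))) has_real_derivative f' x * g x + g' x * f x) (at (x i))"
        using DERIV_mult[OF has_partialD[OF f'(1) x] has_partialD[OF g'(1) x]] by simp
    qed
    ultimately show ?thesis by blast
  qed
  then show ?case using Suc.prems by (intro C_k_SucI) (auto intro: continuous_intros C_k_continuous)
qed (auto intro: continuous_intros)

lemma C_k_inverse:
  assumes "\<And>x. x \<in> S \<Longrightarrow> f x \<noteq> 0"
  shows "C_k m r S f \<Longrightarrow> C_k m r S (\<lambda>x. inverse (f x))"
proof (induction r)
  case (Suc r)
  have "\<exists>h. has_partial i S (\<lambda>x. inverse (f x)) h \<and> C_k m r S h"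
    if "i < m" for i
  proof -
    obtain f' where f': "has_partial i S f f'" "C_k m r S f'"
      by (rule C_k_SucE[OF Suc.prems(1) \<open>i < m\<close>])
    have "C_k m r S (\<lambda>x. inverse (f x))" using Suc C_k_Suc by blast
    then have "C_k m r S (\<lambda>x. (- 1) * (inverse (f x) * f' x * inverse (f x)))"
      using f'(2) by (intro C_k_mult C_k_const)
    moreover have "has_partial i S (\<lambda>x. inverse (f x)) (\<lambda>x. (- 1) * (inverse (f x) * f' x * inverse (f x)))"
    proof (rule has_partialI)
      fix x assume x: "x \<in> S"
      show "((\<lambda>t. inverse (f (x(i := t)))) has_real_derivative
          (- 1) * (inverse (f x) * f' x * inverse (f x))) (at (x i))"
        using DERIV_inverse'[OF has_partialD[OF f'(1) x]] assms[OF x] by simp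
    qed
    ultimately show ?thesis by blast
  qed
  then show ?case using Suc.prems assms by (intro C_k_SucI) (auto intro: continuous_intros C_k_continuous)
qed (use assms in \<open>auto intro: continuous_intros\<close>)

lemma C_k_flat_exp: "C_k m r S f \<Longrightarrow> C_k m r S (\<lambda>x. flat_exp k (f x))"
proof (induction r arbitrary: k)
  have cont: "continuous_on S (\<lambda>x. flat_exp k (f x))" if "continuous_on S f" for k
    using continuous_on_compose2[of UNIV "flat_exp k" S f] that isCont_flat_exp
    by (simp add: continuous_at_imp_continuous_on)
  {
    case 0
    then show ?case using cont by simp
  next
    case (Suc r)
    have "\<exists>h. has_partial i S (\<lambda>x. flat_exp k (f x)) h \<and> C_k m r S h"
      if "i < m" for i
    proof -
      obtain f' where f': "has_partial i S f f'" "C_k m r S f'"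
        by (rule C_k_SucE[OF Suc.prems(1) \<open>i < m\<close>])
      have "C_k m r S (\<lambda>x. (flat_exp (k + 2) (f x) + (- real k) * flat_exp (k + 1) (f x)) * f' x)"
        using f'(2) Suc.IH[OF C_k_Suc[OF Suc.prems]] by (intro C_k_mult C_k_const C_k_add)
      moreover have "has_partial i S (\<lambda>x. flat_exp k (f x))
          (\<lambda>x. (flat_exp (k + 2) (f x) + (- real k) * flat_exp (k + 1) (f x)) * f' x)"
      proof (rule has_partialI)
        fix x assume "x \<in> S"
        have "(flat_exp k has_real_derivative (flat_exp (k + 2) (f x) + (- real k) * flat_exp (k + 1) (f x)))
            (at (f (x(i := x i))))"
          using DERIV_flat_exp[of k "f x"] by simp
        from DERIV_chain2[OF this f'(1)[THEN has_partialD, OF \<open>x \<in> S\<close>]]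
        show "((\<lambda>t. flat_exp k (f (x(i := t)))) has_real_derivative
          (flat_exp (k + 2) (f x) + (- real k) * flat_exp (k + 1) (f x)) * f' x) (at (x i))" .
      qed
      ultimately show ?thesis by blast
    qed
    then show ?case using Suc.prems cont C_k_continuous by (intro C_k_SucI) auto
  }
qed

section \<open>Smooth functions on manifolds\<close>

text \<open>Tychonoff, with an interval in each of the first \<open>m\<close> coordinates and the
  point 0 in all others. The supports of bump functions are cut out of such boxes.\<close>

lemma compact_box:
  fixes a b :: "nat \<Rightarrow> real"
  shows "compact {x. (\<forall>i<m. a i \<le> x i \<and> x i \<le> b i) \<and> (\<forall>i\<ge>m. x i = (0::real))}"
proof -
  have "compactin (product_topology (\<lambda>i. euclidean) UNIV) (PiE UNIV (\<lambda>i. if i < m then {a i..b i} else {0::real}))"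
    by (auto simp: compactin_PiE compactin_euclidean_iff)
  then have "compact (PiE UNIV (\<lambda>i. if i < m then {a i..b i} else {0::real}))"
    by (simp add: euclidean_product_topology compactin_euclidean_iff)
  moreover have "PiE UNIV (\<lambda>i. if i < m then {a i..b i} else {0::real}) =
      {x. (\<forall>i<m. a i \<le> x i \<and> x i \<le> b i) \<and> (\<forall>i\<ge>m. x i = (0::real))}"
    by (auto simp: PiE_iff Ball_def split: if_splits)
  ultimately show ?thesis by simp
qed

lemma openin_Euclidean_space_contains_box:
  assumes "openin (Euclidean_space m) S" "x \<in> S"
  obtains e where "e > 0" "\<And>y. (\<forall>i<m. \<bar>y i - x i\<bar> \<le> e) \<Longrightarrow> (\<forall>i\<ge>m. y i = 0) \<Longrightarrow> y \<in> S"
proof -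
  obtain T where T: "open T" "S = T \<inter> {x. \<forall>i\<ge>m. x i = 0}"
    using openin_Euclidean_space_open[OF assms(1)] .
  have "openin (product_topology (\<lambda>i. euclidean) UNIV) T" using T(1) by (simp add: euclidean_product_topology)
  from product_topology_open_contains_basis[OF this, of x] T(2) assms(2)
  obtain X where X: "x \<in> PiE UNIV X" "\<And>i. openin euclidean (X i)" "PiE UNIV X \<subseteq> T" by blast
  have "\<exists>e>0. cball (x i) e \<subseteq> X i" for i
    using X(1,2) open_contains_cball[of "X i"] by (auto simp: PiE_iff)
  then obtain e where e: "\<And>i. e i > 0" "\<And>i. cball (x i) (e i) \<subseteq> X i" by metis
  \<comment> \<open>The basic open set leaves a radius for every coordinate, but only the first
    \<open>m\<close> can differ from those of \<open>x\<close>. The inserted 1 keeps the minimum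
    defined for \<open>m = 0\<close>.\<close>
  define e0 where "e0 = Min (insert 1 (e ` {..<m}))"
  have e0: "e0 > 0" "\<And>i. i < m \<Longrightarrow> e0 \<le> e i" using e(1) by (auto simp: e0_def)
  show ?thesis
  proof (rule that[OF e0(1)])
    fix y :: "nat \<Rightarrow> real" assume y: "\<forall>i<m. \<bar>y i - x i\<bar> \<le> e0" "\<forall>i\<ge>m. y i = 0"
    have "y i \<in> X i" for i
    proof (cases "i < m")
      case True
      then have "dist (x i) (y i) \<le> e i" using y(1) e0(2)[of i] by (fastforce simp: dist_real_def)
      then show ?thesis using e(2)[of i] by auto
    next
      case False
      then have "y i = x i" using y(2) T(2) assms(2) by auto
      then show ?thesis using X(1) by auto
    qed
    then show "y \<in> S" using X(3) T(2) y(2) by (auto simp: PiE_iff)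
  qed
qed

section \<open>Smooth functions on a manifold and bump functions\<close>

locale manifold =
  fixes M :: "('m::{t2_space,second_countable_topology}, 'z) manifold_scheme"
  assumes smooth_manifold: "smooth_manifold M"
begin

abbreviation smooth_on :: "'m set \<Rightarrow> ('m \<Rightarrow> real) \<Rightarrow> bool" where
  "smooth_on \<equiv> smooth_fun_on M"

lemma chart_homeomorphism:
  assumes "(V, \<phi>) \<in> charts M"
  shows "open V" "openin (Euclidean_space (mdim M)) (\<phi> ` V)" "homeomorphism V (\<phi> ` V) \<phi> (inv_into V \<phi>)"
  using smooth_manifold assms unfolding smooth_manifold_def by auto

lemma chart_inv [simp]:
  assumes "(V, \<phi>) \<in> charts M" "q \<in> V"
  shows "inv_into V \<phi> (\<phi> q) = q"
  using chart_homeomorphism(3)[OF assms(1)] assms(2) by (auto simp: homeomorphism_def)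

lemma chart_cover: obtains V \<phi> where "(V, \<phi>) \<in> charts M" "p \<in> V"
proof -
  have "(\<Union>(U, \<phi>)\<in>charts M. U) = UNIV"
    using smooth_manifold unfolding smooth_manifold_def by (rule conjunct1)
  then have "p \<in> (\<Union>(U, \<phi>)\<in>charts M. U)" by simp
  then obtain A where "A \<in> charts M" "p \<in> fst A" by (auto simp: case_prod_beta)
  then show ?thesis using that[of "fst A" "snd A"] by simp
qed

lemma chart_openin:
  assumes "(V, \<phi>) \<in> charts M" "open W"
  shows "openin (Euclidean_space (mdim M)) (\<phi> ` (W \<inter> V))"
proof -
  have "openin (top_of_set (\<phi> ` V)) (\<phi> ` (W \<inter> V))"
    using assms chart_homeomorphism[OF assms(1)]
    by (intro homeomorphism_imp_open_map) (auto simp: openin_open)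
  then obtain T where T: "open T" "\<phi> ` (W \<inter> V) = \<phi> ` V \<inter> T" by (auto simp: openin_open)
  have "openin (Euclidean_space (mdim M)) (topspace (Euclidean_space (mdim M)) \<inter> T)"
    using T(1) unfolding topspace_Euclidean_space Euclidean_space_def openin_subtopology
    by (auto simp: euclidean_product_topology)
  then have "openin (Euclidean_space (mdim M)) (\<phi> ` V \<inter> (topspace (Euclidean_space (mdim M)) \<inter> T))"
    using chart_homeomorphism(2)[OF assms(1)] by blast
  moreover have "\<phi> ` V \<inter> (topspace (Euclidean_space (mdim M)) \<inter> T) = \<phi> ` V \<inter> T"
    using openin_subset[OF chart_homeomorphism(2)[OF assms(1)]] by blast
  ultimately show ?thesis using T(2) by simp
qed

lemma smooth_onI:
  assumes "\<And>V \<phi> r. (V, \<phi>) \<in> charts M \<Longrightarrow> C_k (mdim M) r (\<phi> ` (U \<inter> V)) (f \<circ> inv_into V \<phi>)"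
  shows "smooth_on U f"
  using assms unfolding smooth_fun_on_def C_infinity_def by blast

lemma smooth_onD:
  assumes "smooth_on U f" "(V, \<phi>) \<in> charts M"
  shows "C_k (mdim M) r (\<phi> ` (U \<inter> V)) (f \<circ> inv_into V \<phi>)"
  using assms unfolding smooth_fun_on_def C_infinity_def by blast

lemma smooth_on_subset: "smooth_on U f \<Longrightarrow> W \<subseteq> U \<Longrightarrow> smooth_on W f"
  by (rule smooth_onI, rule C_k_mono, erule (1) smooth_onD) auto

lemma smooth_on_cong:
  assumes "open U" "\<And>q. q \<in> U \<Longrightarrow> f q = g q" "smooth_on U f"
  shows "smooth_on U g"
proof (rule smooth_onI)
  fix V \<phi> r assume V: "(V, \<phi>) \<in> charts M"
  show "C_k (mdim M) r (\<phi> ` (U \<inter> V)) (g \<circ> inv_into V \<phi>)"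
    by (rule C_k_cong[OF chart_openin[OF V assms(1)] _ smooth_onD[OF assms(3) V]])
      (use V assms(2) in auto)
qed

lemma smooth_on_local:
  assumes "\<And>p. p \<in> U \<Longrightarrow> \<exists>W g. open W \<and> p \<in> W \<and> W \<subseteq> U \<and> smooth_on W g \<and> (\<forall>q\<in>W. f q = g q)"
  shows "smooth_on U f"
proof (rule smooth_onI)
  fix V \<phi> r assume V: "(V, \<phi>) \<in> charts M"
  show "C_k (mdim M) r (\<phi> ` (U \<inter> V)) (f \<circ> inv_into V \<phi>)"
  proof (rule C_k_local)
    fix x assume "x \<in> \<phi> ` (U \<inter> V)"
    then obtain p where p: "p \<in> U" "p \<in> V" "x = \<phi> p" by auto
    from assms[OF p(1)] obtain W g
      where W: "open W" "p \<in> W" "W \<subseteq> U" "smooth_on W g" "\<forall>q\<in>W. f q = g q" by blast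
    have "smooth_on W f" by (rule smooth_on_cong[OF W(1) _ W(4)]) (use W(5) in auto)
    then show "\<exists>T. openin (Euclidean_space (mdim M)) T \<and> x \<in> T \<and> T \<subseteq> \<phi> ` (U \<inter> V) \<and>
        C_k (mdim M) r T (f \<circ> inv_into V \<phi>)"
      using chart_openin[OF V W(1)] p W smooth_onD[OF _ V]
      by (intro exI[of _ "\<phi> ` (W \<inter> V)"]) auto
  qed
qed

lemma smooth_on_const [simp]: "smooth_on U (\<lambda>_. c)"
  by (rule smooth_onI) (simp add: o_def C_k_const)

lemma smooth_on_add: "smooth_on U f \<Longrightarrow> smooth_on U g \<Longrightarrow> smooth_on U (\<lambda>q. f q + g q)"
  by (rule smooth_onI) (drule (1) smooth_onD, drule (1) smooth_onD, drule (1) C_k_add, simp add: o_def)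

lemma smooth_on_mult: "smooth_on U f \<Longrightarrow> smooth_on U g \<Longrightarrow> smooth_on U (\<lambda>q. f q * g q)"
  by (rule smooth_onI) (drule (1) smooth_onD, drule (1) smooth_onD, drule (1) C_k_mult, simp add: o_def)

lemma smooth_on_flat_exp: "smooth_on U f \<Longrightarrow> smooth_on U (\<lambda>q. flat_exp k (f q))"
  by (rule smooth_onI) (drule (1) smooth_onD, drule C_k_flat_exp, simp add: o_def)

lemma smooth_on_inverse:
  assumes "smooth_on U f" "\<And>q. q \<in> U \<Longrightarrow> f q \<noteq> 0"
  shows "smooth_on U (\<lambda>q. inverse (f q))"
proof (rule smooth_onI)
  fix V \<phi> r assume V: "(V, \<phi>) \<in> charts M"
  have "C_k (mdim M) r (\<phi> ` (U \<inter> V)) (\<lambda>x. inverse ((f \<circ> inv_into V \<phi>) x))"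
    by (rule C_k_inverse[OF _ smooth_onD[OF assms(1) V]]) (use V assms(2) in auto)
  then show "C_k (mdim M) r (\<phi> ` (U \<inter> V)) ((\<lambda>q. inverse (f q)) \<circ> inv_into V \<phi>)"
    by (simp add: o_def)
qed

lemma smooth_on_minus: "smooth_on U f \<Longrightarrow> smooth_on U (\<lambda>q. - f q)"
  using smooth_on_mult[OF smooth_on_const[of U "-1"], of f] by simp

lemma smooth_on_diff: "smooth_on U f \<Longrightarrow> smooth_on U g \<Longrightarrow> smooth_on U (\<lambda>q. f q - g q)"
  using smooth_on_add[OF _ smooth_on_minus, of U f g] by simp

lemma smooth_on_divide:
  assumes "smooth_on U f" "smooth_on U g" "\<And>q. q \<in> U \<Longrightarrow> g q \<noteq> 0"
  shows "smooth_on U (\<lambda>q. f q / g q)"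
  using smooth_on_mult[OF assms(1) smooth_on_inverse[OF assms(2,3)]] by (simp add: divide_inverse)

lemma smooth_on_sum:
  "(\<And>i. i \<in> I \<Longrightarrow> smooth_on U (f i)) \<Longrightarrow> smooth_on U (\<lambda>q. \<Sum>i\<in>I. f i q)"
  by (induction I rule: infinite_finite_induct) (auto intro: smooth_on_add)

lemma smooth_on_imp_continuous_on:
  assumes "open U" "smooth_on U f"
  shows "continuous_on U f"
proof -
  have "isCont f p" if "p \<in> U" for p
  proof -
    obtain V \<phi> where V: "(V, \<phi>) \<in> charts M" "p \<in> V" by (rule chart_cover)
    have "continuous_on (\<phi> ` (U \<inter> V)) (f \<circ> inv_into V \<phi>)"
      using smooth_onD[OF assms(2) V(1)] C_k_continuous by blast
    moreover have "continuous_on (U \<inter> V) \<phi>"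
      using chart_homeomorphism(3)[OF V(1)] by (auto simp: homeomorphism_def intro: continuous_on_subset)
    ultimately have "continuous_on (U \<inter> V) ((f \<circ> inv_into V \<phi>) \<circ> \<phi>)"
      by (rule continuous_on_compose[rotated])
    then have "continuous_on (U \<inter> V) f"
      by (rule continuous_on_eq) (use V in auto)
    then show ?thesis
      using V(2) that continuous_on_eq_continuous_at[OF open_Int[OF assms(1) chart_homeomorphism(1)[OF V(1)]]]
      by blast
  qed
  then show ?thesis by (simp add: continuous_at_imp_continuous_on)
qed

lemma smooth_on_coordinate:
  assumes "(V, \<phi>) \<in> charts M" "i < mdim M"
  shows "smooth_on V (\<lambda>q. \<phi> q i)"
proof -
  have "C_infinity (mdim M) (\<psi> ` (V \<inter> W)) (\<lambda>x. \<phi> (inv_into W \<psi> x) i)" if "(W, \<psi>) \<in> charts M" for W \<psi>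
    using smooth_manifold assms that unfolding smooth_manifold_def by blast
  then show ?thesis unfolding smooth_fun_on_def by (auto simp: o_def)
qed

text \<open>With \<open>R\<close> the squared coordinate distance from \<open>p\<close>, the
  function is the usual quotient that is 1 where \<open>R\<close> is at most e^2/4 and 0 where
  \<open>R\<close> is at least e^2. Its extension by 0 is smooth because the set \<open>C\<close>,
  off which it vanishes, is the image of a compact set and hence closed in the Hausdorff manifold:
  the chart domain and the complement of \<open>C\<close> form an open cover.\<close>

lemma bump_function:
  assumes "open W" "p \<in> W"
  obtains \<beta> C N where "closed C" "C \<subseteq> W" "open N" "p \<in> N" "smooth_on UNIV \<beta>"
    "\<forall>q\<in>N. \<beta> q = 1" "\<forall>q. q \<notin> C \<longrightarrow> \<beta> q = 0"
proof -
  obtain V \<phi> where V: "(V, \<phi>) \<in> charts M" "p \<in> V" by (rule chart_cover)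
  let ?m = "mdim M"
  note hom = chart_homeomorphism[OF V(1)]
  obtain e where e: "e > 0"
    "\<And>y. (\<forall>i<?m. \<bar>y i - \<phi> p i\<bar> \<le> e) \<Longrightarrow> (\<forall>i\<ge>?m. y i = 0) \<Longrightarrow> y \<in> \<phi> ` (W \<inter> V)"
    by (rule openin_Euclidean_space_contains_box[OF chart_openin[OF V(1) assms(1)], of "\<phi> p"])
      (use V assms in auto)
  define R where "R x = (\<Sum>i<?m. (x i - \<phi> p i)\<^sup>2)" for x
  have R: "\<bar>x i - \<phi> p i\<bar> \<le> e" if "R x \<le> e\<^sup>2" "i < ?m" for x i
  proof -
    have "(x i - \<phi> p i)\<^sup>2 \<le> R x" unfolding R_def using that(2) by (intro member_le_sum) auto
    then have "\<bar>x i - \<phi> p i\<bar>\<^sup>2 \<le> e\<^sup>2" using that(1) by simp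
    then show ?thesis by (rule power2_le_imp_le) (use e(1) in simp)
  qed
  define K where "K = {x. R x \<le> e\<^sup>2 \<and> (\<forall>i\<ge>?m. x i = 0)}"
  have "K = {x. (\<forall>i<?m. \<phi> p i - e \<le> x i \<and> x i \<le> \<phi> p i + e) \<and> (\<forall>i\<ge>?m. x i = 0)} \<inter> {x. R x \<le> e\<^sup>2}"
    using R by (fastforce simp: K_def abs_le_iff)
  moreover have "closed {x. R x \<le> e\<^sup>2}"
    unfolding R_def by (intro closed_Collect_le continuous_intros continuous_on_product_coordinates)
  ultimately have "compact K"
    using compact_Int_closed[OF compact_box] by simp
  have KS: "K \<subseteq> \<phi> ` (W \<inter> V)"
    using e(2) R by (auto simp: K_def)
  define C where "C = inv_into V \<phi> ` K"
  have "continuous_on K (inv_into V \<phi>)"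
    by (rule continuous_on_subset[of "\<phi> ` V"]) (use hom(3) KS in \<open>auto simp: homeomorphism_def\<close>)
  then have C: "closed C" "C \<subseteq> W"
    using KS V(1) compact_imp_closed[OF compact_continuous_image[OF _ \<open>compact K\<close>]]
    by (auto simp: C_def)
  have inC: "q \<in> C" if "q \<in> V" "R (\<phi> q) \<le> e\<^sup>2" for q
  proof -
    have "\<phi> q \<in> K"
      using openin_subset[OF hom(2)] that by (auto simp: K_def topspace_Euclidean_space)
    then show ?thesis using chart_inv[OF V(1) that(1)] unfolding C_def by (metis imageI)
  qed
  have smR: "smooth_on V (\<lambda>q. R (\<phi> q))"
    unfolding R_def power2_eq_square
    by (intro smooth_on_sum smooth_on_mult smooth_on_diff smooth_on_coordinate[OF V(1)]) auto
  define N where "N = {q \<in> V. R (\<phi> q) < e\<^sup>2 / 4}"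
  have N: "open N" "p \<in> N"
  proof -
    have "continuous_on V (\<lambda>q. R (\<phi> q))"
      using smooth_on_imp_continuous_on[OF hom(1) smR] .
    then have "open ((\<lambda>q. R (\<phi> q)) -` {..<e\<^sup>2 / 4} \<inter> V)"
      using iffD1[OF continuous_on_open_vimage[OF hom(1)]] open_lessThan by blast
    moreover have "(\<lambda>q. R (\<phi> q)) -` {..<e\<^sup>2 / 4} \<inter> V = N" by (auto simp: N_def)
    ultimately show "open N" by simp
    show "p \<in> N" using V(2) e(1) by (simp add: N_def R_def)
  qed
  define g where "g q = flat_exp 0 (e\<^sup>2 - R (\<phi> q)) / (flat_exp 0 (e\<^sup>2 - R (\<phi> q)) + flat_exp 0 (R (\<phi> q) - e\<^sup>2 / 4))" for q
  \<comment> \<open>As e^2/4 < e^2, at least one of the two arguments is positive for every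
    \<open>t\<close>, so that the denominator of \<open>g\<close> never vanishes.\<close>
  have pos: "flat_exp 0 (e\<^sup>2 - t) + flat_exp 0 (t - e\<^sup>2 / 4) > 0" for t
  proof (cases "t < e\<^sup>2")
    case True
    then show ?thesis using flat_exp_pos[of "e\<^sup>2 - t"] flat_exp_nonneg[of 0] by (simp add: add_pos_nonneg)
  next
    case False
    moreover have "e\<^sup>2 / 4 < e\<^sup>2" using e(1) by simp
    ultimately have "t - e\<^sup>2 / 4 > 0" by linarith
    then show ?thesis using flat_exp_pos[of "t - e\<^sup>2 / 4"] flat_exp_nonneg[of 0] by (simp add: add_nonneg_pos)
  qed
  have smg: "smooth_on V g"
    unfolding g_def
    by (intro smooth_on_divide smooth_on_add smooth_on_flat_exp smooth_on_diff smR smooth_on_const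
        pos[THEN less_imp_neq, THEN not_sym])
  define \<beta> where "\<beta> q = (if q \<in> V then g q else 0)" for q
  have \<beta>0: "\<beta> q = 0" if "q \<notin> C" for q
  proof -
    have "q \<in> V \<Longrightarrow> flat_exp 0 (e\<^sup>2 - R (\<phi> q)) = 0"
      using inC[of q] that by (intro flat_exp_nonpos) linarith
    then show ?thesis by (simp add: \<beta>_def g_def)
  qed
  have "smooth_on UNIV \<beta>"
  proof (rule smooth_on_local)
    fix q
    show "\<exists>W g. open W \<and> q \<in> W \<and> W \<subseteq> UNIV \<and> smooth_on W g \<and> (\<forall>q\<in>W. \<beta> q = g q)"
    proof (cases "q \<in> V")
      case True
      then show ?thesis using smg hom(1) by (intro exI[of _ V] exI[of _ g]) (auto simp: \<beta>_def)
    next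
      case False
      then have "q \<in> - C" using KS V(1) by (auto simp: C_def)
      then show ?thesis using C(1) \<beta>0 by (intro exI[of _ "- C"] exI[of _ "\<lambda>_. 0"]) auto
    qed
  qed
  moreover have "\<beta> q = 1" if "q \<in> N" for q
    using that pos[of "R (\<phi> q)"] by (auto simp: \<beta>_def g_def N_def flat_exp_nonpos)
  ultimately show ?thesis using that[OF C N] \<beta>0 by blast
qed

end

section \<open>Alternating forms and contraction\<close>

context
  fixes V :: "'v::real_vector set" and \<omega> :: "'v form" and k :: int
  assumes \<omega>: "\<omega> \<in> alt_forms V k" and V: "subspace V"
begin

lemma alt_forms_zero: "\<not> (int (length vs) = k \<and> set vs \<subseteq> V) \<Longrightarrow> \<omega> vs = 0"
  using \<omega> unfolding alt_forms_def by blast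

lemma alt_forms_not_distinct: "\<not> distinct vs \<Longrightarrow> \<omega> vs = 0"
  using \<omega> unfolding alt_forms_def by blast

text \<open>Extension by 0 makes additivity hold for arbitrary \<open>us\<close> and
  \<open>ws\<close>: if they have the wrong length or leave \<open>V\<close>, all three values are
  0.\<close>

lemma alt_forms_add:
  assumes "x \<in> V" "y \<in> V"
  shows "\<omega> (us @ (x + y) # ws) = \<omega> (us @ x # ws) + \<omega> (us @ y # ws)"
proof (cases "int (length (us @ x # ws)) = k \<and> set us \<subseteq> V \<and> set ws \<subseteq> V")
  case True
  have "\<forall>us x y ws. int (length (us @ x # ws)) = k \<longrightarrow> set (us @ x # y # ws) \<subseteq> V \<longrightarrow>
      \<omega> (us @ (x + y) # ws) = \<omega> (us @ x # ws) + \<omega> (us @ y # ws)"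
    using \<omega> unfolding alt_forms_def mem_Collect_eq by (elim conjE)
  then show ?thesis using True assms by simp
next
  case False
  then have "\<omega> (us @ z # ws) = 0" for z by (intro alt_forms_zero) auto
  then show ?thesis by simp
qed

lemma alt_forms_scale:
  assumes "x \<in> V"
  shows "\<omega> (us @ (c *\<^sub>R x) # ws) = c * \<omega> (us @ x # ws)"
proof (cases "int (length (us @ x # ws)) = k \<and> set us \<subseteq> V \<and> set ws \<subseteq> V")
  case True
  have "\<forall>us x ws c. int (length (us @ x # ws)) = k \<longrightarrow> set (us @ x # ws) \<subseteq> V \<longrightarrow>
        \<omega> (us @ (c *\<^sub>R x) # ws) = c * \<omega> (us @ x # ws)"
    using \<omega> unfolding alt_forms_def mem_Collect_eq by (elim conjE)
  then show ?thesis using True assms by simp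
next
  case False
  then have "\<omega> (us @ z # ws) = 0" for z by (intro alt_forms_zero) auto
  then show ?thesis by simp
qed

text \<open>Polarization of the vanishing value with \<open>x + y\<close> in both slots. If
  \<open>x\<close> or \<open>y\<close> lies outside \<open>V\<close>, both sides are 0 by the
  extension.\<close>

lemma alt_forms_swap: "\<omega> (us @ x # y # ws) = - \<omega> (us @ y # x # ws)"
proof (cases "x \<in> V \<and> y \<in> V")
  case True
  then have xy: "x \<in> V" "y \<in> V" "x + y \<in> V" using V by (auto simp: subspace_add)
  have "0 = \<omega> (us @ (x + y) # (x + y) # ws)"
    by (simp add: alt_forms_not_distinct)
  also have "\<dots> = \<omega> ((us @ [x]) @ (x + y) # ws) + \<omega> ((us @ [y]) @ (x + y) # ws)"
    using alt_forms_add[OF xy(1,2), of us "(x + y) # ws"] by simp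
  also have "\<dots> = \<omega> (us @ x # y # ws) + \<omega> (us @ y # x # ws)"
    unfolding alt_forms_add[OF xy(1,2)] by (simp add: alt_forms_not_distinct)
  finally show ?thesis by simp
next
  case False
  then have "\<omega> (us @ x # y # ws) = 0" "\<omega> (us @ y # x # ws) = 0"
    by (auto intro!: alt_forms_zero)
  then show ?thesis by simp
qed

lemma alt_forms_sum:
  assumes "\<And>i. i \<in> I \<Longrightarrow> e i \<in> V"
  shows "\<omega> (us @ (\<Sum>i\<in>I. c i *\<^sub>R e i) # ws) = (\<Sum>i\<in>I. c i * \<omega> (us @ e i # ws))"
proof -
  have zero: "\<omega> (us @ 0 # ws) = 0"
    using alt_forms_scale[of 0 us 0 ws] subspace_0[OF V] by simp
  show ?thesis using assms
  proof (induction I rule: infinite_finite_induct)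
    case (insert i I)
    have "c i *\<^sub>R e i \<in> V" "(\<Sum>i\<in>I. c i *\<^sub>R e i) \<in> V"
      using insert V by (auto intro: subspace_scale subspace_sum)
    then show ?case using insert by (simp add: alt_forms_add alt_forms_scale)
  qed (simp_all add: zero)
qed

lemma alt_forms_slice:
  assumes "set us \<subseteq> V"
  shows "(\<lambda>vs. \<omega> (us @ vs)) \<in> alt_forms V (k - int (length us))"
  unfolding alt_forms_def mem_Collect_eq
proof (intro conjI allI impI)
  fix us' x y ws assume "set (us' @ x # y # ws) \<subseteq> V"
  then show "\<omega> (us @ us' @ (x + y) # ws) = \<omega> (us @ us' @ x # ws) + \<omega> (us @ us' @ y # ws)"
    using alt_forms_add[of x y "us @ us'" ws] by simp
next
  fix us' x ws and c :: real assume "set (us' @ x # ws) \<subseteq> V"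
  then show "\<omega> (us @ us' @ (c *\<^sub>R x) # ws) = c * \<omega> (us @ us' @ x # ws)"
    using alt_forms_scale[of x "us @ us'" c ws] by simp
next
  fix vs assume "\<not> (int (length vs) = k - int (length us) \<and> set vs \<subseteq> V)"
  then show "\<omega> (us @ vs) = 0" using assms by (intro alt_forms_zero) auto
qed (auto intro: alt_forms_not_distinct)

lemma alt_forms_slice_right:
  assumes "set ws \<subseteq> V"
  shows "(\<lambda>vs. \<omega> (vs @ ws)) \<in> alt_forms V (k - int (length ws))"
  unfolding alt_forms_def mem_Collect_eq
proof (intro conjI allI impI)
  fix us x y ws' assume "set (us @ x # y # ws') \<subseteq> V"
  then show "\<omega> ((us @ (x + y) # ws') @ ws) = \<omega> ((us @ x # ws') @ ws) + \<omega> ((us @ y # ws') @ ws)"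
    using alt_forms_add[of x y us "ws' @ ws"] by simp
next
  fix us x ws' and c :: real assume "set (us @ x # ws') \<subseteq> V"
  then show "\<omega> ((us @ (c *\<^sub>R x) # ws') @ ws) = c * \<omega> ((us @ x # ws') @ ws)"
    using alt_forms_scale[of x us c "ws' @ ws"] by simp
next
  fix vs assume "\<not> (int (length vs) = k - int (length ws) \<and> set vs \<subseteq> V)"
  then show "\<omega> (vs @ ws) = 0" using assms by (intro alt_forms_zero) auto
qed (auto intro: alt_forms_not_distinct)

end

lemma alt_forms_frame_zero:
  assumes "\<omega> \<in> alt_forms V k" "subspace V" "\<not> (distinct J \<and> int (length J) = k)"
  shows "\<omega> (map e J) = 0"
proof (cases "distinct J")
  case True
  then show ?thesis using assms(3) by (intro alt_forms_zero[OF assms(1,2)]) simp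
next
  case False
  then show ?thesis by (intro alt_forms_not_distinct[OF assms(1,2)]) (simp add: distinct_map)
qed

lemma alt_forms_lincomb:
  assumes "\<omega> \<in> alt_forms V k" "\<eta> \<in> alt_forms V k"
  shows "(\<lambda>vs. c * \<omega> vs + d * \<eta> vs) \<in> alt_forms V k"
  using assms by (simp add: alt_forms_def algebra_simps)

lemma zero_alt_forms: "(\<lambda>_. 0) \<in> alt_forms V k"
  by (simp add: alt_forms_def)

lemma alt_forms_scaled: "\<omega> \<in> alt_forms V k \<Longrightarrow> (\<lambda>vs. c * \<omega> vs) \<in> alt_forms V k"
  using alt_forms_lincomb[of \<omega> V k "\<lambda>_. 0" c 0] zero_alt_forms[of V k] by simp

lemma alt_forms_sum_mem:
  assumes "\<And>i. i \<in> I \<Longrightarrow> \<omega> i \<in> alt_forms V k"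
  shows "(\<lambda>vs. \<Sum>i\<in>I. c i * \<omega> i vs) \<in> alt_forms V k"
  using assms
proof (induction I rule: infinite_finite_induct)
  case (insert i I)
  then show ?case using alt_forms_lincomb[of "\<omega> i" V k "\<lambda>vs. \<Sum>i\<in>I. c i * \<omega> i vs" "c i" 1] by simp
qed (simp_all add: zero_alt_forms)

text \<open>The parity of the transpositions that insertion sort performs. Following
  \<open>insort\<close> and \<open>sort\<close> in this way, rather than using the sign of a
  permutation, lets \<open>alt_forms_sort\<close> go by induction on the list.\<close>

fun insort_sign :: "nat \<Rightarrow> nat list \<Rightarrow> real" where
  "insort_sign x [] = 1"
| "insort_sign x (y # ys) = (if x \<le> y then 1 else - insort_sign x ys)"

fun sort_sign :: "nat list \<Rightarrow> real" where
  "sort_sign [] = 1"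
| "sort_sign (x # xs) = sort_sign xs * insort_sign x (sort xs)"

lemma sort_sign_square: "sort_sign J * sort_sign J = 1"
proof -
  have "insort_sign x ys * insort_sign x ys = 1" for x ys
    by (induction ys) auto
  then show ?thesis by (induction J) (auto simp: algebra_simps)
qed

lemma alt_forms_insort:
  assumes "\<omega> \<in> alt_forms V k" "subspace V"
  shows "\<omega> (us @ map e (x # ys)) = insort_sign x ys * \<omega> (us @ map e (insort x ys))"
proof (induction ys arbitrary: us)
  case (Cons y ys)
  show ?case
  proof (cases "x \<le> y")
    case False
    then have "\<omega> (us @ map e (x # y # ys)) = - \<omega> ((us @ [e y]) @ map e (x # ys))"
      using alt_forms_swap[OF assms, of us "e x" "e y"] by simp
    also have "\<dots> = - (insort_sign x ys * \<omega> ((us @ [e y]) @ map e (insort x ys)))"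
      by (subst Cons) simp
    finally show ?thesis using False by simp
  qed simp
qed simp

lemma alt_forms_sort:
  assumes "\<omega> \<in> alt_forms V k" "subspace V"
  shows "\<omega> (us @ map e J) = sort_sign J * \<omega> (us @ map e (sort J))"
proof (induction J arbitrary: us)
  case (Cons x J)
  have "\<omega> (us @ map e (x # J)) = \<omega> ((us @ [e x]) @ map e J)" by simp
  also have "\<dots> = sort_sign J * \<omega> (us @ map e (x # sort J))" by (subst Cons) simp
  finally show ?case by (simp add: alt_forms_insort[OF assms, of us e x "sort J", simplified])
qed simp

section \<open>Increasing multi-indices and their complements\<close>

lemma increasing_listsD:
  assumes "I \<in> increasing_lists n k"
  shows "sorted I" "distinct I" "set I \<subseteq> {..<n}" "int (length I) = k"
  using assms by (auto simp: increasing_lists_def strict_sorted_iff)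

lemma finite_increasing_lists [simp]: "finite (increasing_lists n k)"
proof (rule finite_subset)
  show "increasing_lists n k \<subseteq> {I. set I \<subseteq> {..<n} \<and> length I = nat k}"
    by (auto simp: increasing_lists_def)
qed (simp add: finite_lists_length_eq)

text \<open>The complementary multi-index: the contraction of a volume form with the basis
  multivector of \<open>I\<close> has exactly one nonzero component, and it sits here.\<close>

definition compl_list :: "nat \<Rightarrow> nat list \<Rightarrow> nat list" where
  "compl_list n I = sorted_list_of_set ({..<n} - set I)"

lemma compl_list_increasing:
  assumes "I \<in> increasing_lists n k"
  shows "compl_list n I \<in> increasing_lists n (int n - k)"
proof -
  note I = increasing_listsD[OF assms]
  have "card (set I) = length I" using I(2) by (rule distinct_card)
  moreover have "card ({..<n} - set I) = n - card (set I)" "card (set I) \<le> n"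
    using I(3) card_mono[of "{..<n}" "set I"] by (auto simp: card_Diff_subset)
  ultimately show ?thesis
    using I by (auto simp: increasing_lists_def compl_list_def)
qed

lemma increasing_lists_eqI:
  assumes "I \<in> increasing_lists n k" "J \<in> increasing_lists n l" "set I = set J"
  shows "I = J"
  using increasing_listsD[OF assms(1)] increasing_listsD[OF assms(2)] assms(3)
  by (intro sorted_distinct_set_unique)

lemma set_compl_list [simp]: "set (compl_list n I) = {..<n} - set I"
  by (simp add: compl_list_def)

lemma compl_list_compl_list:
  assumes "I \<in> increasing_lists n k"
  shows "compl_list n (compl_list n I) = I"
  by (rule increasing_lists_eqI[OF compl_list_increasing[OF compl_list_increasing[OF assms]] assms])
    (use increasing_listsD[OF assms] in auto)

lemma upt_increasing: "[0..<n] \<in> increasing_lists n (int n)"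
  by (auto simp: increasing_lists_def)

lemma increasing_lists_full:
  assumes "I \<in> increasing_lists n (int n)"
  shows "I = [0..<n]"
proof -
  note I = increasing_listsD[OF assms]
  have "set I = {..<n}"
    using I by (intro card_subset_eq) (auto simp: distinct_card)
  then have "set I = set [0..<n]" by (simp only: set_upt lessThan_atLeast0)
  then show ?thesis by (rule increasing_lists_eqI[OF assms upt_increasing])
qed

lemma sort_append_compl_list:
  assumes "I \<in> increasing_lists n k"
  shows "sort (I @ compl_list n I) = [0..<n]"
proof (rule sorted_distinct_set_unique)
  show "distinct (sort (I @ compl_list n I))"
    using increasing_listsD[OF assms] by (auto simp: compl_list_def)
  show "set (sort (I @ compl_list n I)) = set [0..<n]"
    using increasing_listsD[OF assms] by auto
qed auto

text \<open>By counting: disjoint multi-indices of lengths \<open>k\<close> and \<open>n - k\<close>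
  exhaust the indices below \<open>n\<close>. This removes the off-diagonal terms of a
  contraction.\<close>

lemma not_compl_list_imp_not_disjoint:
  assumes "I \<in> increasing_lists n k" "J \<in> increasing_lists n (int n - k)" "I \<noteq> compl_list n J"
  shows "\<not> distinct (I @ J)"
proof
  assume d: "distinct (I @ J)"
  note I = increasing_listsD[OF assms(1)] and J = increasing_listsD[OF assms(2)]
  have "set (I @ J) = {..<n}"
  proof (rule card_subset_eq)
    show "set (I @ J) \<subseteq> {..<n}" using I J by simp
    show "card (set (I @ J)) = card {..<n}" using I(4) J(4) distinct_card[OF d] by simp
  qed simp
  then have "set I = set (compl_list n J)" using d by auto
  with increasing_lists_eqI[OF assms(1) compl_list_increasing[OF assms(2)]] assms(3) show False by simp
qed

text \<open>The two conventions of extension by 0 fit together: if the slice of \<open>\<mu>\<close>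
  is not a form of the degree that \<open>wedge\<close> expects, then the value on the right is 0 as
  well.\<close>

lemma contract_wedge:
  assumes "\<mu> \<in> alt_forms V m" "subspace V"
  shows "contract (wedge V vs) \<mu> ws = \<mu> (vs @ ws)"
proof (cases "(\<lambda>us. \<mu> (us @ ws)) \<in> alt_forms V (int (length vs))")
  case False
  have "\<mu> (vs @ ws) = 0"
  proof (rule ccontr)
    assume "\<mu> (vs @ ws) \<noteq> 0"
    then have "int (length (vs @ ws)) = m" "set (vs @ ws) \<subseteq> V"
      using alt_forms_zero[OF assms(1)] assms(2) by blast+
    moreover from this have "m - int (length ws) = int (length vs)" by simp
    ultimately show False using False alt_forms_slice_right[OF assms, of ws] by simp
  qed
  with False show ?thesis by (simp add: contract_def wedge_def)
qed (simp add: contract_def wedge_def)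

definition frame_comb :: "'v::real_vector set \<Rightarrow> (nat \<Rightarrow> 'v) \<Rightarrow> nat \<Rightarrow> int \<Rightarrow> (nat list \<Rightarrow> real) \<Rightarrow> 'v multivector" where
  "frame_comb V e n k c = (\<lambda>\<omega>. \<Sum>I\<in>increasing_lists n k. c I * wedge V (map e I) \<omega>)"

lemma contract_frame_comb:
  assumes "\<mu> \<in> alt_forms V m" "subspace V"
  shows "contract (frame_comb V e n k c) \<mu> = (\<lambda>ws. \<Sum>I\<in>increasing_lists n k. c I * \<mu> (map e I @ ws))"
  using contract_wedge[OF assms] by (auto simp: frame_comb_def contract_def)

lemma frame_comb_cong:
  "(\<And>I. I \<in> increasing_lists n k \<Longrightarrow> c I = d I) \<Longrightarrow> frame_comb V e n k c = frame_comb V e n k d"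
  by (simp add: frame_comb_def)

section \<open>Linear algebra of a single fibre with a chosen basis\<close>

locale framed_space =
  fixes V :: "'v::real_vector set" and e :: "nat \<Rightarrow> 'v" and n :: nat
  assumes subspace: "subspace V" and inj: "inj_on e {..<n}"
    and indep: "independent (e ` {..<n})" and span: "span (e ` {..<n}) = V"
begin

lemma frame_in: "i < n \<Longrightarrow> e i \<in> V"
  using span span_base[of "e i" "e ` {..<n}"] by auto

lemma frame_list_in: "set J \<subseteq> {..<n} \<Longrightarrow> set (map e J) \<subseteq> V"
  using frame_in by auto

lemma frame_expansion:
  assumes "v \<in> V"
  obtains c where "v = (\<Sum>i<n. c i *\<^sub>R e i)"
proof -
  have "v \<in> range (\<lambda>u. \<Sum>w\<in>e ` {..<n}. u w *\<^sub>R w)"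
    using assms span span_finite[of "e ` {..<n}"] by simp
  then obtain u where "v = (\<Sum>w\<in>e ` {..<n}. u w *\<^sub>R w)" by auto
  then have "v = (\<Sum>i<n. u (e i) *\<^sub>R e i)" by (simp add: sum.reindex[OF inj])
  then show ?thesis by (rule that)
qed

lemma frame_coeff_zero:
  assumes "(\<Sum>i<n. c i *\<^sub>R e i) = 0" "i < n"
  shows "c i = 0"
proof -
  let ?u = "\<lambda>w. c (inv_into {..<n} e w)"
  have "(\<Sum>w\<in>e ` {..<n}. ?u w *\<^sub>R w) = 0"
    using assms(1) inj by (simp add: sum.reindex)
  then have "?u (e i) = 0"
    using independentD[OF indep, of "e ` {..<n}" ?u "e i"] assms(2) by simp
  then show ?thesis using inj assms(2) by simp
qed

text \<open>The point is the order of quantifiers: the coefficients do not depend on the form. Hence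
  forms are determined by their components, and decomposable multivectors, which are functionals on
  forms, become combinations of basis multivectors. The vectors are expanded one at a time and move
  into the prefix \<open>J\<close> of basis indices.\<close>

lemma frame_expansion_forms:
  assumes "set vs \<subseteq> V" "set J \<subseteq> {..<n}"
  shows "\<exists>c. \<forall>\<omega>\<in>alt_forms V k. \<omega> (map e J @ vs) = (\<Sum>I\<in>increasing_lists n k. c I * \<omega> (map e I))"
  using assms
proof (induction vs arbitrary: J)
  case Nil
  show ?case
  proof (cases "distinct J \<and> int (length J) = k")
    case True
    then have s: "sort J \<in> increasing_lists n k"
      using Nil by (auto simp: increasing_lists_def strict_sorted_iff)
    have "\<omega> (map e J @ []) = (\<Sum>I\<in>increasing_lists n k. (if I = sort J then sort_sign J else 0) * \<omega> (map e I))"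
      if "\<omega> \<in> alt_forms V k" for \<omega>
      using alt_forms_sort[OF that subspace, of "[]" e J] s by (simp add: if_distrib[of "\<lambda>x. x * _"] cong: if_cong)
    then show ?thesis by (intro exI[of _ "\<lambda>I. if I = sort J then sort_sign J else 0"] ballI)
  next
    case False
    then show ?thesis using alt_forms_frame_zero[OF _ subspace False] by (intro exI[of _ "\<lambda>_. 0"]) simp
  qed
next
  case (Cons v vs)
  from Cons.prems(1) have "v \<in> V" by simp
  then obtain a where a: "v = (\<Sum>i<n. a i *\<^sub>R e i)" by (rule frame_expansion)
  have "\<exists>c. \<forall>\<omega>\<in>alt_forms V k. \<omega> (map e (J @ [i]) @ vs) = (\<Sum>I\<in>increasing_lists n k. c I * \<omega> (map e I))"
    if "i < n" for i
    by (rule Cons.IH) (use Cons.prems that in auto)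
  then obtain c where c: "\<forall>i<n. \<forall>\<omega>\<in>alt_forms V k. \<omega> (map e (J @ [i]) @ vs) = (\<Sum>I\<in>increasing_lists n k. c i I * \<omega> (map e I))"
    by metis
  have "\<omega> (map e J @ v # vs) = (\<Sum>I\<in>increasing_lists n k. (\<Sum>i<n. a i * c i I) * \<omega> (map e I))"
    if \<omega>: "\<omega> \<in> alt_forms V k" for \<omega>
  proof -
    have "e i \<in> V" if "i \<in> {..<n}" for i using that frame_in by simp
    note alt_forms_sum[OF \<omega> subspace this, where us = "map e J" and c = a and ws = vs and I = "{..<n}"]
    then have "\<omega> (map e J @ v # vs) = (\<Sum>i<n. a i * \<omega> (map e (J @ [i]) @ vs))" by (simp add: a)
    also have "\<dots> = (\<Sum>i<n. \<Sum>I\<in>increasing_lists n k. a i * (c i I * \<omega> (map e I)))"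
      by (intro sum.cong[OF refl]) (subst c[rule_format, OF _ \<omega>], simp_all add: sum_distrib_left)
    also have "\<dots> = (\<Sum>I\<in>increasing_lists n k. \<Sum>i<n. a i * (c i I * \<omega> (map e I)))" by (rule sum.swap)
    finally show ?thesis by (simp add: sum_distrib_right mult.assoc)
  qed
  then show ?case by (intro exI[of _ "\<lambda>I. \<Sum>i<n. a i * c i I"] ballI)
qed

lemma frame_eqI:
  assumes \<omega>: "\<omega> \<in> alt_forms V k" and \<eta>: "\<eta> \<in> alt_forms V k"
    and eq: "\<And>I. I \<in> increasing_lists n k \<Longrightarrow> \<omega> (map e I) = \<eta> (map e I)"
  shows "\<omega> = \<eta>"
proof
  fix vs
  show "\<omega> vs = \<eta> vs"
  proof (cases "set vs \<subseteq> V")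
    case True
    obtain c where "\<forall>\<omega>\<in>alt_forms V k. \<omega> vs = (\<Sum>I\<in>increasing_lists n k. c I * \<omega> (map e I))"
      using frame_expansion_forms[OF True, of "[]" k] by auto
    from bspec[OF this \<omega>] bspec[OF this \<eta>] show ?thesis by (simp add: eq)
  next
    case False
    then show ?thesis using alt_forms_zero[OF \<omega> subspace] alt_forms_zero[OF \<eta> subspace] by simp
  qed
qed

lemma volume_frame_nonzero:
  assumes "\<mu> \<in> alt_forms V (int n)" "\<mu> \<noteq> (\<lambda>_. 0)"
  shows "\<mu> (map e [0..<n]) \<noteq> 0"
  using frame_eqI[OF assms(1) zero_alt_forms] increasing_lists_full assms(2) by metis

lemma contract_frame_comb_alt:
  assumes "\<mu> \<in> alt_forms V (int n)"
  shows "contract (frame_comb V e n k c) \<mu> \<in> alt_forms V (int n - k)"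
  unfolding contract_frame_comb[OF assms subspace]
proof (rule alt_forms_sum_mem)
  fix I assume I: "I \<in> increasing_lists n k"
  show "(\<lambda>ws. \<mu> (map e I @ ws)) \<in> alt_forms V (int n - k)"
    using alt_forms_slice[OF assms subspace frame_list_in[of I]] increasing_listsD[OF I] by simp
qed

text \<open>In the induced bases the contraction with a volume form is a diagonal matrix up to
  passing to complements: for \<open>I\<close> other than the complement of \<open>J\<close> the
  list \<open>I @ J\<close> has a repetition, and the remaining one sorts to the full list of
  indices.\<close>

lemma contract_frame_comb_component:
  assumes \<mu>: "\<mu> \<in> alt_forms V (int n)" and J: "J \<in> increasing_lists n (int n - k)"
  shows "contract (frame_comb V e n k c) \<mu> (map e J) =
    c (compl_list n J) * sort_sign (compl_list n J @ J) * \<mu> (map e [0..<n])"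
proof -
  let ?J' = "compl_list n J"
  have J': "?J' \<in> increasing_lists n k" using compl_list_increasing[OF J] by simp
  have "contract (frame_comb V e n k c) \<mu> (map e J) = (\<Sum>I\<in>increasing_lists n k. c I * \<mu> (map e (I @ J)))"
    by (simp add: contract_frame_comb[OF \<mu> subspace])
  also have "\<dots> = (\<Sum>I\<in>increasing_lists n k. if I = ?J' then c I * \<mu> (map e (I @ J)) else 0)"
  proof (rule sum.cong[OF refl])
    fix I assume "I \<in> increasing_lists n k"
    then have "\<mu> (map e (I @ J)) = 0" if "I \<noteq> ?J'"
      using not_compl_list_imp_not_disjoint[OF _ J that] distinct_map[of e "I @ J"]
      by (intro alt_forms_not_distinct[OF \<mu> subspace]) blast
    then show "c I * \<mu> (map e (I @ J)) = (if I = ?J' then c I * \<mu> (map e (I @ J)) else 0)" by simp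
  qed
  also have "\<dots> = c ?J' * \<mu> (map e (?J' @ J))" using J' by simp
  also have "\<mu> (map e (?J' @ J)) = sort_sign (?J' @ J) * \<mu> (map e (sort (?J' @ J)))"
    using alt_forms_sort[OF \<mu> subspace, of "[]" e "?J' @ J"] by simp
  also have "sort (?J' @ J) = [0..<n]"
    using sort_append_compl_list[OF J'] compl_list_compl_list[OF J] by simp
  finally show ?thesis by simp
qed

text \<open>The inverse of this diagonal matrix. The sign stands in the numerator because it is its
  own inverse.\<close>

definition volume_coeff :: "'v form \<Rightarrow> 'v form \<Rightarrow> nat list \<Rightarrow> real" where
  "volume_coeff \<mu> \<theta> I = sort_sign (I @ compl_list n I) * \<theta> (map e (compl_list n I)) / \<mu> (map e [0..<n])"

lemma volume_coeff_contract:
  assumes \<mu>: "\<mu> \<in> alt_forms V (int n)" "\<mu> \<noteq> (\<lambda>_. 0)" and I: "I \<in> increasing_lists n k"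
  shows "volume_coeff \<mu> (contract (frame_comb V e n k c) \<mu>) I = c I"
proof -
  have "sort_sign (I @ compl_list n I) * sort_sign (I @ compl_list n I) = 1" by (rule sort_sign_square)
  then show ?thesis
    using volume_frame_nonzero[OF \<mu>] contract_frame_comb_component[OF \<mu>(1) compl_list_increasing[OF I]]
      compl_list_compl_list[OF I]
    by (simp add: volume_coeff_def)
qed

lemma contract_volume_coeff:
  assumes \<mu>: "\<mu> \<in> alt_forms V (int n)" "\<mu> \<noteq> (\<lambda>_. 0)" and \<theta>: "\<theta> \<in> alt_forms V (int n - k)"
  shows "contract (frame_comb V e n k (volume_coeff \<mu> \<theta>)) \<mu> = \<theta>"
proof (rule frame_eqI[OF contract_frame_comb_alt[OF \<mu>(1)] \<theta>])
  fix J assume J: "J \<in> increasing_lists n (int n - k)"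
  have "sort_sign (compl_list n J @ J) * sort_sign (compl_list n J @ J) = 1" by (rule sort_sign_square)
  then show "contract (frame_comb V e n k (volume_coeff \<mu> \<theta>)) \<mu> (map e J) = \<theta> (map e J)"
    using volume_frame_nonzero[OF \<mu>]
    by (simp add: contract_frame_comb_component[OF \<mu>(1) J] volume_coeff_def compl_list_compl_list[OF J])
qed

lemma frame_comb_ext_power: "frame_comb V e n k c \<in> ext_power V k"
proof -
  obtain h where h: "bij_betw h {0..<card (increasing_lists n k)} (increasing_lists n k)"
    using ex_bij_betw_nat_finite[OF finite_increasing_lists] by blast
  let ?N = "card (increasing_lists n k)"
  have hI: "h j \<in> increasing_lists n k" if "j < ?N" for j
    using h that by (auto simp: bij_betw_def)
  have "frame_comb V e n k c = (\<lambda>\<omega>. \<Sum>j<?N. c (h j) * wedge V (map e (h j)) \<omega>)"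
    unfolding frame_comb_def
    by (subst sum.reindex_bij_betw[OF h, symmetric]) (simp add: lessThan_atLeast0)
  moreover have "\<forall>j<?N. int (length (map e (h j))) = k \<and> set (map e (h j)) \<subseteq> V"
    using increasing_listsD[OF hI] frame_list_in by (auto simp del: set_map)
  ultimately show ?thesis unfolding ext_power_def by (intro CollectI exI conjI)
qed

end

section \<open>Sections and forms of a vector bundle\<close>

locale vbundle =
  fixes E :: "('m::{t2_space,second_countable_topology}, 'v::real_vector, 'z) vector_bundle_scheme"
  assumes smooth_vector_bundle: "smooth_vector_bundle E"
begin

sublocale manifold E
  using smooth_vector_bundle unfolding smooth_vector_bundle_def manifold_def by (rule conjunct1)

abbreviation rk :: nat where "rk \<equiv> bundle_rank E"

lemma frame_cover: obtains V e where "(V, e) \<in> frames E" "p \<in> V"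
proof -
  have "(\<Union>(U, e)\<in>frames E. U) = UNIV"
    using smooth_vector_bundle unfolding smooth_vector_bundle_def by (elim conjE)
  then have "p \<in> (\<Union>(U, e)\<in>frames E. U)" by simp
  then obtain A where "A \<in> frames E" "p \<in> fst A" by (auto simp: case_prod_beta)
  then show ?thesis using that[of "fst A" "snd A"] by simp
qed

lemma subspace_fibre [simp]: "subspace (fibre E p)"
proof -
  have "\<forall>p. subspace (fibre E p)"
    using smooth_vector_bundle unfolding smooth_vector_bundle_def by (elim conjE)
  then show ?thesis by blast
qed

lemma frame_open: "(V, e) \<in> frames E \<Longrightarrow> open V"
  and frame_space: "(V, e) \<in> frames E \<Longrightarrow> p \<in> V \<Longrightarrow> framed_space (fibre E p) (\<lambda>i. e i p) rk"
proof -
  have "\<forall>(U, e)\<in>frames E. open U \<and>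
        (\<forall>p\<in>U. inj_on (\<lambda>i. e i p) {..<bundle_rank E} \<and>
           independent ((\<lambda>i. e i p) ` {..<bundle_rank E}) \<and>
           span ((\<lambda>i. e i p) ` {..<bundle_rank E}) = fibre E p)"
    using smooth_vector_bundle unfolding smooth_vector_bundle_def by (elim conjE)
  then show "(V, e) \<in> frames E \<Longrightarrow> open V"
    "(V, e) \<in> frames E \<Longrightarrow> p \<in> V \<Longrightarrow> framed_space (fibre E p) (\<lambda>i. e i p) rk"
    by (auto simp: framed_space_def)
qed

lemma frame_transition:
  assumes "(U, e) \<in> frames E" "(V, e') \<in> frames E"
  obtains g where "\<forall>i<rk. \<forall>j<rk. smooth_on (U \<inter> V) (g i j)"
    "\<forall>p\<in>U \<inter> V. \<forall>j<rk. e' j p = (\<Sum>i<rk. g i j p *\<^sub>R e i p)"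
proof -
  have "\<forall>(U, e)\<in>frames E. \<forall>(V, e')\<in>frames E. \<exists>g.
        (\<forall>i<bundle_rank E. \<forall>j<bundle_rank E. smooth_fun_on E (U \<inter> V) (g i j)) \<and>
        (\<forall>p\<in>U \<inter> V. \<forall>j<bundle_rank E. e' j p = (\<Sum>i<bundle_rank E. g i j p *\<^sub>R e i p))"
    using smooth_vector_bundle unfolding smooth_vector_bundle_def by (elim conjE)
  from bspec[OF this assms(1)] have "\<forall>(V, e')\<in>frames E. \<exists>g.
        (\<forall>i<bundle_rank E. \<forall>j<bundle_rank E. smooth_fun_on E (U \<inter> V) (g i j)) \<and>
        (\<forall>p\<in>U \<inter> V. \<forall>j<bundle_rank E. e' j p = (\<Sum>i<bundle_rank E. g i j p *\<^sub>R e i p))"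
    by simp
  from bspec[OF this assms(2)] obtain g where
    "(\<forall>i<bundle_rank E. \<forall>j<bundle_rank E. smooth_fun_on E (U \<inter> V) (g i j)) \<and>
        (\<forall>p\<in>U \<inter> V. \<forall>j<bundle_rank E. e' j p = (\<Sum>i<bundle_rank E. g i j p *\<^sub>R e i p))"
    by auto
  then show ?thesis by (intro that[of g]) simp_all
qed

lemma section_fibre: "smooth_section_on E U X \<Longrightarrow> p \<in> U \<Longrightarrow> X p \<in> fibre E p"
  by (simp add: smooth_section_on_def)

lemma section_coeff:
  assumes "smooth_section_on E U X" "(V, e) \<in> frames E"
  obtains c where "\<forall>i<rk. smooth_on (U \<inter> V) (c i)"
    "\<forall>p\<in>U \<inter> V. X p = (\<Sum>i<rk. c i p *\<^sub>R e i p)"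
proof -
  have "\<forall>(V, e)\<in>frames E. \<exists>c. (\<forall>i<rk. smooth_on (U \<inter> V) (c i)) \<and>
        (\<forall>p\<in>U \<inter> V. X p = (\<Sum>i<rk. c i p *\<^sub>R e i p))"
    using assms(1) unfolding smooth_section_on_def by (elim conjE)
  from bspec[OF this assms(2)] obtain c where
    "(\<forall>i<rk. smooth_on (U \<inter> V) (c i)) \<and> (\<forall>p\<in>U \<inter> V. X p = (\<Sum>i<rk. c i p *\<^sub>R e i p))"
    by auto
  then show ?thesis by (intro that[of c]) simp_all
qed

lemma sectionI:
  assumes "\<And>p. p \<in> U \<Longrightarrow> X p \<in> fibre E p"
    and "\<And>V e. (V, e) \<in> frames E \<Longrightarrow> \<exists>c. (\<forall>i<rk. smooth_on (U \<inter> V) (c i)) \<and>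
        (\<forall>p\<in>U \<inter> V. X p = (\<Sum>i<rk. c i p *\<^sub>R e i p))"
  shows "smooth_section_on E U X"
  unfolding smooth_section_on_def using assms by auto

lemma frame_section:
  assumes "(V, e) \<in> frames E" "i < rk"
  shows "smooth_section_on E V (e i)"
proof (rule sectionI)
  show "e i p \<in> fibre E p" if "p \<in> V" for p
    using framed_space.frame_in[OF frame_space[OF assms(1) that] assms(2)] .
  fix U e' assume "(U, e') \<in> frames E"
  then obtain g where "\<forall>k<rk. \<forall>j<rk. smooth_on (U \<inter> V) (g k j)"
    "\<forall>p\<in>U \<inter> V. \<forall>j<rk. e j p = (\<Sum>k<rk. g k j p *\<^sub>R e' k p)"
    by (rule frame_transition[OF _ assms(1)])
  then show "\<exists>c. (\<forall>k<rk. smooth_on (V \<inter> U) (c k)) \<and> (\<forall>p\<in>V \<inter> U. e i p = (\<Sum>k<rk. c k p *\<^sub>R e' k p))"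
    using assms(2) by (intro exI[of _ "\<lambda>k. g k i"]) (simp add: Int_commute)
qed

section \<open>Global sections: module operations, cut-offs and extension\<close>

lemma section_lincomb:
  assumes X: "smooth_section_on E U X" and Y: "smooth_section_on E U Y"
    and f: "smooth_on U f" and g: "smooth_on U g"
  shows "smooth_section_on E U (\<lambda>q. f q *\<^sub>R X q + g q *\<^sub>R Y q)"
proof (rule sectionI)
  show "f p *\<^sub>R X p + g p *\<^sub>R Y p \<in> fibre E p" if "p \<in> U" for p
    using section_fibre[OF X that] section_fibre[OF Y that]
    by (intro subspace_add subspace_scale subspace_fibre)
  fix V e assume V: "(V, e) \<in> frames E"
  obtain c where c: "\<forall>i<rk. smooth_on (U \<inter> V) (c i)"
    "\<forall>p\<in>U \<inter> V. X p = (\<Sum>i<rk. c i p *\<^sub>R e i p)" by (rule section_coeff[OF X V])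
  obtain d where d: "\<forall>i<rk. smooth_on (U \<inter> V) (d i)"
    "\<forall>p\<in>U \<inter> V. Y p = (\<Sum>i<rk. d i p *\<^sub>R e i p)" by (rule section_coeff[OF Y V])
  have "smooth_on (U \<inter> V) (\<lambda>p. f p * c i p + g p * d i p)" if "i < rk" for i
    by (intro smooth_on_add smooth_on_mult c(1)[rule_format] d(1)[rule_format] that smooth_on_subset[OF f] smooth_on_subset[OF g]) auto
  moreover have "f p *\<^sub>R X p + g p *\<^sub>R Y p = (\<Sum>i<rk. (f p * c i p + g p * d i p) *\<^sub>R e i p)"
    if "p \<in> U \<inter> V" for p
    using c(2)[rule_format, OF that] d(2)[rule_format, OF that]
    by (simp add: scaleR_sum_right scaleR_add_left sum.distrib)
  ultimately show "\<exists>c. (\<forall>i<rk. smooth_on (U \<inter> V) (c i)) \<and>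
      (\<forall>p\<in>U \<inter> V. f p *\<^sub>R X p + g p *\<^sub>R Y p = (\<Sum>i<rk. c i p *\<^sub>R e i p))"
    by (intro exI[of _ "\<lambda>i p. f p * c i p + g p * d i p"]) simp
qed

lemma Sec_fibre: "X \<in> Sec E \<Longrightarrow> X p \<in> fibre E p"
  by (simp add: Sec_def smooth_section_on_def)

lemma Sec_lincomb:
  "X \<in> Sec E \<Longrightarrow> Y \<in> Sec E \<Longrightarrow> smooth_on UNIV f \<Longrightarrow> smooth_on UNIV g \<Longrightarrow>
    (\<lambda>q. f q *\<^sub>R X q + g q *\<^sub>R Y q) \<in> Sec E"
  unfolding Sec_def mem_Collect_eq by (rule section_lincomb)

lemma Sec_add: "X \<in> Sec E \<Longrightarrow> Y \<in> Sec E \<Longrightarrow> (\<lambda>q. X q + Y q) \<in> Sec E"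
  using Sec_lincomb[of X Y "\<lambda>_. 1" "\<lambda>_. 1"] by simp

lemma Sec_scale: "smooth_on UNIV f \<Longrightarrow> X \<in> Sec E \<Longrightarrow> (\<lambda>q. f q *\<^sub>R X q) \<in> Sec E"
  using Sec_lincomb[of X X f "\<lambda>_. 0"] by simp

lemma Sec_zero: "(\<lambda>_. 0) \<in> Sec E"
  unfolding Sec_def mem_Collect_eq
  by (rule sectionI) (auto intro: subspace_0 exI[of _ "\<lambda>_ _. 0"])

lemma Sec_sum: "(\<And>i. i \<in> I \<Longrightarrow> X i \<in> Sec E) \<Longrightarrow> (\<lambda>q. \<Sum>i\<in>I. X i q) \<in> Sec E"
  by (induction I rule: infinite_finite_induct) (auto intro: Sec_add Sec_zero)

text \<open>The closed set \<open>C\<close> lies inside \<open>V\<close>, so that every point off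
  \<open>V\<close> has the complement of \<open>C\<close> as an open neighbourhood on which the
  extension is 0.\<close>

lemma smooth_cutoff:
  assumes V: "open V" "closed C" "C \<subseteq> V" and \<beta>: "smooth_on UNIV \<beta>" "\<And>q. q \<notin> C \<Longrightarrow> \<beta> q = 0"
    and f: "smooth_on (W \<inter> V) f" and W: "open W"
  shows "smooth_on W (\<lambda>q. if q \<in> V then \<beta> q * f q else 0)"
proof (rule smooth_on_local)
  fix p assume "p \<in> W"
  let ?f = "\<lambda>q. if q \<in> V then \<beta> q * f q else 0"
  show "\<exists>O' g. open O' \<and> p \<in> O' \<and> O' \<subseteq> W \<and> smooth_on O' g \<and> (\<forall>q\<in>O'. ?f q = g q)"
  proof (cases "p \<in> V")
    case True
    moreover have "smooth_on (W \<inter> V) (\<lambda>q. \<beta> q * f q)"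
      using \<beta>(1) f by (intro smooth_on_mult) (auto intro: smooth_on_subset)
    ultimately show ?thesis
      using \<open>p \<in> W\<close> V W by (intro exI[of _ "W \<inter> V"] exI[of _ "\<lambda>q. \<beta> q * f q"]) auto
  next
    case False
    then show ?thesis
      using \<open>p \<in> W\<close> V W \<beta>(2) by (intro exI[of _ "W \<inter> - C"] exI[of _ "\<lambda>q. 0"]) auto
  qed
qed

lemma section_cutoff:
  assumes V: "open V" "closed C" "C \<subseteq> V" and \<beta>: "smooth_on UNIV \<beta>" "\<And>q. q \<notin> C \<Longrightarrow> \<beta> q = 0"
    and X: "smooth_section_on E V X"
  shows "(\<lambda>q. if q \<in> V then \<beta> q *\<^sub>R X q else 0) \<in> Sec E"
  unfolding Sec_def mem_Collect_eq
proof (rule sectionI)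
  show "(if p \<in> V then \<beta> p *\<^sub>R X p else 0) \<in> fibre E p" for p
    using section_fibre[OF X, of p] by (auto intro: subspace_scale subspace_0)
  fix W e assume W: "(W, e) \<in> frames E"
  obtain c where c: "\<forall>i<rk. smooth_on (V \<inter> W) (c i)"
    "\<forall>p\<in>V \<inter> W. X p = (\<Sum>i<rk. c i p *\<^sub>R e i p)" by (rule section_coeff[OF X W])
  have "smooth_on W (\<lambda>q. if q \<in> V then \<beta> q * c i q else 0)" if "i < rk" for i
    by (rule smooth_cutoff[OF V \<beta>]) (use c(1)[rule_format, OF that] frame_open[OF W] in \<open>simp_all add: Int_commute\<close>)
  moreover have "(if p \<in> V then \<beta> p *\<^sub>R X p else 0) = (\<Sum>i<rk. (if p \<in> V then \<beta> p * c i p else 0) *\<^sub>R e i p)"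
    if "p \<in> W" for p
    using c(2)[rule_format, of p] that by (auto simp: scaleR_sum_right)
  ultimately show "\<exists>c. (\<forall>i<rk. smooth_on (UNIV \<inter> W) (c i)) \<and>
      (\<forall>p\<in>UNIV \<inter> W. (if p \<in> V then \<beta> p *\<^sub>R X p else 0) = (\<Sum>i<rk. c i p *\<^sub>R e i p))"
    by (intro exI[of _ "\<lambda>i q. if q \<in> V then \<beta> q * c i q else 0"]) simp
qed

text \<open>The bracket is available for global sections only. A local frame is therefore replaced
  by global sections that coincide with it near \<open>p\<close>.\<close>

lemma local_frame_extension:
  assumes "(V, e) \<in> frames E" "p \<in> V"
  obtains Y N where "\<forall>i<rk. Y i \<in> Sec E" "open N" "p \<in> N" "N \<subseteq> V"
    "\<forall>i. \<forall>q\<in>N. Y i q = e i q"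
proof -
  obtain \<beta> C N where b: "closed C" "C \<subseteq> V" "open N" "p \<in> N" "smooth_on UNIV \<beta>"
    "\<forall>q\<in>N. \<beta> q = 1" "\<forall>q. q \<notin> C \<longrightarrow> \<beta> q = 0"
    by (rule bump_function[OF frame_open[OF assms(1)] assms(2)])
  note b = b(1-5) b(6,7)[rule_format]
  let ?Y = "\<lambda>i q. if q \<in> V then \<beta> q *\<^sub>R e i q else 0"
  have "N \<subseteq> V"
  proof
    fix q assume "q \<in> N"
    then have "\<beta> q \<noteq> 0" using b(6) by simp
    then show "q \<in> V" using b(2,7) by blast
  qed
  moreover have "?Y i \<in> Sec E" if "i < rk" for i
    by (rule section_cutoff[OF frame_open[OF assms(1)] b(1,2,5,7) frame_section[OF assms(1) that]])
  moreover have "?Y i q = e i q" if "q \<in> N" for i q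
    using that b(6) \<open>N \<subseteq> V\<close> by auto
  ultimately show ?thesis using b(3,4) by (intro that[of ?Y N]) simp_all
qed

lemma Sec_extends_vector:
  assumes "v \<in> fibre E p"
  obtains X where "X \<in> Sec E" "X p = v"
proof -
  obtain V e where V: "(V, e) \<in> frames E" "p \<in> V" by (rule frame_cover)
  obtain Y N where Y: "\<forall>i<rk. Y i \<in> Sec E" "open N" "p \<in> N" "N \<subseteq> V"
    "\<forall>i. \<forall>q\<in>N. Y i q = e i q" by (rule local_frame_extension[OF V])
  obtain c where c: "v = (\<Sum>i<rk. c i *\<^sub>R e i p)"
    by (rule framed_space.frame_expansion[OF frame_space[OF V] assms])
  have "(\<lambda>q. \<Sum>i<rk. c i *\<^sub>R Y i q) \<in> Sec E"
    using Y(1) by (intro Sec_sum Sec_scale) auto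
  moreover have "(\<Sum>i<rk. c i *\<^sub>R Y i p) = v" using Y(3,5) c by simp
  ultimately show ?thesis by (rule that)
qed

text \<open>With a local frame \<open>e\<close>, \<open>X = \<Sum> c\<^sub>i e\<^sub>i\<close> near \<open>p\<close> and a bump function \<open>\<beta>\<close> at \<open>p\<close> the decomposition
  is \<open>X = (1 - \<beta>\<^sup>2) X + \<Sum> (\<beta>c\<^sub>i) (\<beta>e\<^sub>i)\<close>.\<close>

lemma Sec_vanishing_decomposition:
  assumes X: "X \<in> Sec E" "X p = 0"
  obtains g f Y where "smooth_on UNIV g" "g p = 0"
    "\<forall>i<rk. smooth_on UNIV (f i)" "\<forall>i<rk. f i p = 0" "\<forall>i<rk. Y i \<in> Sec E"
    "X = (\<lambda>q. g q *\<^sub>R X q + (\<Sum>i<rk. f i q *\<^sub>R Y i q))"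
proof -
  obtain V e where V: "(V, e) \<in> frames E" "p \<in> V" by (rule frame_cover)
  note oV = frame_open[OF V(1)]
  obtain \<beta> C N where b: "closed C" "C \<subseteq> V" "open N" "p \<in> N" "smooth_on UNIV \<beta>"
    "\<forall>q\<in>N. \<beta> q = 1" "\<forall>q. q \<notin> C \<longrightarrow> \<beta> q = 0"
    by (rule bump_function[OF oV V(2)])
  note b = b(1-5) b(6,7)[rule_format]
  obtain c where c: "\<forall>i<rk. smooth_on (UNIV \<inter> V) (c i)"
    "\<forall>q\<in>UNIV \<inter> V. X q = (\<Sum>i<rk. c i q *\<^sub>R e i q)"
    by (rule section_coeff[OF _ V(1), of UNIV X]) (use X(1) in \<open>simp_all add: Sec_def\<close>)
  let ?Y = "\<lambda>i q. if q \<in> V then \<beta> q *\<^sub>R e i q else 0"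
  let ?f = "\<lambda>i q. if q \<in> V then \<beta> q * c i q else 0"
  let ?g = "\<lambda>q. 1 - \<beta> q * \<beta> q"
  have Y: "?Y i \<in> Sec E" if "i < rk" for i
    by (rule section_cutoff[OF oV b(1,2,5,7) frame_section[OF V(1) that]])
  have f: "smooth_on UNIV (?f i)" if "i < rk" for i
    by (rule smooth_cutoff[OF oV b(1,2,5,7) c(1)[rule_format, OF that] open_UNIV])
  have f0: "?f i p = 0" if "i < rk" for i
    using framed_space.frame_coeff_zero[OF frame_space[OF V], of "\<lambda>i. c i p", OF _ that] c(2)[rule_format, of p] X(2) V(2)
    by simp
  have g: "smooth_on UNIV ?g" by (intro smooth_on_diff smooth_on_mult smooth_on_const b(5))
  have "X q = ?g q *\<^sub>R X q + (\<Sum>i<rk. ?f i q *\<^sub>R ?Y i q)" for q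
  proof (cases "q \<in> V")
    case True
    then have "(\<Sum>i<rk. ?f i q *\<^sub>R ?Y i q) = (\<beta> q * \<beta> q) *\<^sub>R X q"
      using c(2)[rule_format, of q] by (simp add: scaleR_sum_right mult_ac)
    then show ?thesis by (simp add: scaleR_diff_left)
  next
    case False
    then have "\<beta> q = 0" using b(2,7) by blast
    then show ?thesis using False by simp
  qed
  then have "X = (\<lambda>q. ?g q *\<^sub>R X q + (\<Sum>i<rk. ?f i q *\<^sub>R ?Y i q))" by (rule ext)
  then show ?thesis using that[of ?g ?f ?Y] g f f0 Y b(4,6) by simp
qed

section \<open>Forms over an open set and their values on sections\<close>

lemma FormsD:
  assumes "\<omega> \<in> Forms E U k"
  shows "p \<in> U \<Longrightarrow> \<omega> p \<in> alt_forms (fibre E p) k" "p \<notin> U \<Longrightarrow> \<omega> p = (\<lambda>_. 0)"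
    "(V, e) \<in> frames E \<Longrightarrow> I \<in> increasing_lists rk k \<Longrightarrow> smooth_on (U \<inter> V) (\<lambda>p. \<omega> p (map (\<lambda>i. e i p) I))"
  using assms unfolding Forms_def smooth_form_on_def by auto

lemma Forms_alt: "\<omega> \<in> Forms E U k \<Longrightarrow> \<omega> p \<in> alt_forms (fibre E p) k"
  using FormsD(1,2) zero_alt_forms by (cases "p \<in> U") auto

lemma FormsI:
  assumes "\<And>p. p \<in> U \<Longrightarrow> \<omega> p \<in> alt_forms (fibre E p) k" "\<And>p. p \<notin> U \<Longrightarrow> \<omega> p = (\<lambda>_. 0)"
    "\<And>V e I. (V, e) \<in> frames E \<Longrightarrow> I \<in> increasing_lists rk k \<Longrightarrow>
      smooth_on (U \<inter> V) (\<lambda>p. \<omega> p (map (\<lambda>i. e i p) I))"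
  shows "\<omega> \<in> Forms E U k"
  using assms unfolding Forms_def smooth_form_on_def by auto

lemma Forms_frame_smooth:
  assumes \<omega>: "\<omega> \<in> Forms E U k" and U: "open U" and V: "(V, e) \<in> frames E" and J: "set J \<subseteq> {..<rk}"
  shows "smooth_on (U \<inter> V) (\<lambda>p. \<omega> p (map (\<lambda>i. e i p) J))"
proof -
  have o: "open (U \<inter> V)" using U frame_open[OF V] by blast
  show ?thesis
  proof (cases "distinct J \<and> int (length J) = k")
    case True
    then have "sort J \<in> increasing_lists rk k"
      using J by (auto simp: increasing_lists_def strict_sorted_iff)
    then have "smooth_on (U \<inter> V) (\<lambda>p. sort_sign J * \<omega> p (map (\<lambda>i. e i p) (sort J)))"
      using FormsD(3)[OF \<omega> V] by (intro smooth_on_mult smooth_on_const) auto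
    moreover have "\<omega> p (map (\<lambda>i. e i p) J) = sort_sign J * \<omega> p (map (\<lambda>i. e i p) (sort J))" for p
      using alt_forms_sort[OF Forms_alt[OF \<omega>] subspace_fibre, of p "[]" "\<lambda>i. e i p" J] by simp
    ultimately show ?thesis by simp
  next
    case False
    then show ?thesis by (simp add: alt_forms_frame_zero[OF Forms_alt[OF \<omega>] subspace_fibre])
  qed
qed

text \<open>Smoothness of a form is given on frame vectors. Each section is expanded in the frame
  with smooth coefficients, one slot at a time; \<open>J\<close> collects the frame indices that
  replace the sections already treated.\<close>

lemma Forms_Sec_smooth:
  assumes \<omega>: "\<omega> \<in> Forms E U k" and U: "open U" and Xs: "set Xs \<subseteq> Sec E"
  shows "smooth_on U (\<lambda>p. \<omega> p (map (\<lambda>X. X p) Xs))"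
proof (rule smooth_on_local)
  fix p assume p: "p \<in> U"
  obtain V e where V: "(V, e) \<in> frames E" "p \<in> V" by (rule frame_cover)
  have o: "open (U \<inter> V)" using U frame_open[OF V(1)] by blast
  have "smooth_on (U \<inter> V) (\<lambda>p. \<omega> p (map (\<lambda>i. e i p) J @ map (\<lambda>X. X p) Xs))"
    if "set J \<subseteq> {..<rk}" for J
    using Xs that
  proof (induction Xs arbitrary: J)
    case Nil
    then show ?case using Forms_frame_smooth[OF \<omega> U V(1)] by simp
  next
    case (Cons X Xs)
    obtain c where c: "\<forall>i<rk. smooth_on (UNIV \<inter> V) (c i)"
      "\<forall>q\<in>UNIV \<inter> V. X q = (\<Sum>i<rk. c i q *\<^sub>R e i q)"
      by (rule section_coeff[OF _ V(1), of UNIV X]) (use Cons.prems(1) in \<open>simp_all add: Sec_def\<close>)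
    have "smooth_on (U \<inter> V) (\<lambda>p. c i p * \<omega> p (map (\<lambda>i. e i p) (J @ [i]) @ map (\<lambda>X. X p) Xs))"
      if "i < rk" for i
    proof (rule smooth_on_mult)
      show "smooth_on (U \<inter> V) (c i)" using c(1)[rule_format, OF that] by (rule smooth_on_subset) auto
      show "smooth_on (U \<inter> V) (\<lambda>p. \<omega> p (map (\<lambda>i. e i p) (J @ [i]) @ map (\<lambda>X. X p) Xs))"
        by (rule Cons.IH) (use Cons.prems that in auto)
    qed
    then have "smooth_on (U \<inter> V) (\<lambda>p. \<Sum>i<rk. c i p * \<omega> p (map (\<lambda>i. e i p) (J @ [i]) @ map (\<lambda>X. X p) Xs))"
      by (intro smooth_on_sum) simp
    then show ?case
    proof (rule smooth_on_cong[OF o, rotated])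
      fix q assume q: "q \<in> U \<inter> V"
      have "e i q \<in> fibre E q" if "i \<in> {..<rk}" for i
        using framed_space.frame_in[OF frame_space[OF V(1)]] q that by auto
      note alt_forms_sum[OF Forms_alt[OF \<omega>] subspace_fibre this, where I = "{..<rk}" and us = "map (\<lambda>i. e i q) J"
          and c = "\<lambda>i. c i q" and ws = "map (\<lambda>X. X q) Xs"]
      then show "(\<Sum>i<rk. c i q * \<omega> q (map (\<lambda>i. e i q) (J @ [i]) @ map (\<lambda>X. X q) Xs)) =
        \<omega> q (map (\<lambda>i. e i q) J @ map (\<lambda>X. X q) (X # Xs))"
        using c(2)[rule_format, of q] q by simp
    qed
  qed
  from this[of "[]"] show "\<exists>W g. open W \<and> p \<in> W \<and> W \<subseteq> U \<and> smooth_on W g \<and>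
      (\<forall>q\<in>W. \<omega> q (map (\<lambda>X. X q) Xs) = g q)"
    using o p V(2) by (intro exI[of _ "U \<inter> V"] exI[of _ "\<lambda>q. \<omega> q (map (\<lambda>X. X q) Xs)"]) auto
qed

end

section \<open>Cartan's formula\<close>

text \<open>A form seen through its values on lists of sections. Contraction with a section is then
  partial application to a first argument.\<close>

type_synonym ('m, 'v) multi_operator = "('m \<Rightarrow> 'v) list \<Rightarrow> 'm \<Rightarrow> real"

text \<open>The correction term of the Lie derivative along \<open>X\<close>: the sum over all slots
  of \<open>F\<close> with the argument \<open>Y\<close> there replaced by \<open>[X, Y]\<close>.
  The second equation fixes the first argument and goes on in the remaining slots.\<close>

primrec bracket_sum ::
  "('m, 'v::real_vector) lie_algebroid \<Rightarrow> ('m \<Rightarrow> 'v) \<Rightarrow> ('m \<Rightarrow> 'v) list \<Rightarrow> ('m, 'v) multi_operator \<Rightarrow> 'm \<Rightarrow> real"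
where
  "bracket_sum E X [] F p = 0"
| "bracket_sum E X (Y # Ys) F p = F (bracket E X Y # Ys) p + bracket_sum E X Ys (\<lambda>Zs. F (Y # Zs)) p"

definition lie_deriv ::
  "('m, 'v::real_vector) lie_algebroid \<Rightarrow> ('m \<Rightarrow> 'v) \<Rightarrow> ('m \<Rightarrow> 'v) list \<Rightarrow> ('m, 'v) multi_operator \<Rightarrow> 'm \<Rightarrow> real"
where
  "lie_deriv E X Xs F p = anchor E p (X p) (F Xs) - bracket_sum E X Xs F p"

text \<open>Cartan's formula \<open>i\<^sub>X d = L\<^sub>X - d i\<^sub>X\<close>, read as a recursion for \<open>d\<close>.\<close>

primrec cartan ::
  "('m, 'v::real_vector) lie_algebroid \<Rightarrow> ('m \<Rightarrow> 'v) list \<Rightarrow> ('m, 'v) multi_operator \<Rightarrow> 'm \<Rightarrow> real"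
where
  "cartan E [] F p = 0"
| "cartan E (X # Xs) F p = lie_deriv E X Xs F p - cartan E Xs (\<lambda>Ys. F (X # Ys)) p"

locale algebroid =
  fixes E :: "('m::{t2_space,second_countable_topology}, 'v::real_vector) lie_algebroid"
  assumes smooth_lie_algebroid: "smooth_lie_algebroid E"
begin

sublocale vbundle E
  using smooth_lie_algebroid unfolding smooth_lie_algebroid_def vbundle_def by (rule conjunct1)

lemmas algebroid_axioms = smooth_lie_algebroid[unfolded smooth_lie_algebroid_def]

section \<open>Rules for the anchor and the bracket\<close>

lemma anchor_tangent: "v \<in> fibre E p \<Longrightarrow> anchor E p v \<in> tangent_space E p"
proof -
  have "\<forall>p. \<forall>v\<in>fibre E p. anchor E p v \<in> tangent_space E p"
    using algebroid_axioms by (elim conjE)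
  then show "v \<in> fibre E p \<Longrightarrow> anchor E p v \<in> tangent_space E p" by simp
qed

lemma anchor_add: "v \<in> fibre E p \<Longrightarrow> w \<in> fibre E p \<Longrightarrow> anchor E p (v + w) f = anchor E p v f + anchor E p w f"
proof -
  have "\<forall>p f. \<forall>v\<in>fibre E p. \<forall>w\<in>fibre E p. anchor E p (v + w) f = anchor E p v f + anchor E p w f"
    using algebroid_axioms by (elim conjE)
  then show "v \<in> fibre E p \<Longrightarrow> w \<in> fibre E p \<Longrightarrow> anchor E p (v + w) f = anchor E p v f + anchor E p w f" by simp
qed

lemma anchor_scale: "v \<in> fibre E p \<Longrightarrow> anchor E p (c *\<^sub>R v) f = c * anchor E p v f"
proof -
  have "\<forall>p f c. \<forall>v\<in>fibre E p. anchor E p (c *\<^sub>R v) f = c * anchor E p v f"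
    using algebroid_axioms by (elim conjE)
  then show "v \<in> fibre E p \<Longrightarrow> anchor E p (c *\<^sub>R v) f = c * anchor E p v f" by simp
qed

lemma bracket_Sec: "X \<in> Sec E \<Longrightarrow> Y \<in> Sec E \<Longrightarrow> bracket E X Y \<in> Sec E"
proof -
  have "\<forall>X\<in>Sec E. \<forall>Y\<in>Sec E. bracket E X Y \<in> Sec E"
    using algebroid_axioms by (elim conjE)
  then show "X \<in> Sec E \<Longrightarrow> Y \<in> Sec E \<Longrightarrow> bracket E X Y \<in> Sec E" by simp
qed

lemma bracket_antisym:
  assumes "X \<in> Sec E" "Y \<in> Sec E"
  shows "bracket E X Y p = - bracket E Y X p"
proof -
  have "\<forall>X\<in>Sec E. \<forall>Y\<in>Sec E. \<forall>p. bracket E X Y p = - bracket E Y X p"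
    using algebroid_axioms by (elim conjE)
  from this[rule_format, OF assms] show ?thesis .
qed

lemma bracket_add_left:
  assumes "X \<in> Sec E" "Y \<in> Sec E" "Z \<in> Sec E"
  shows "bracket E (\<lambda>q. X q + Y q) Z = (\<lambda>p. bracket E X Z p + bracket E Y Z p)"
proof -
  have "\<forall>X\<in>Sec E. \<forall>Y\<in>Sec E. \<forall>Z\<in>Sec E. \<forall>c p.
        bracket E (\<lambda>q. c *\<^sub>R X q + Y q) Z p = c *\<^sub>R bracket E X Z p + bracket E Y Z p"
    using algebroid_axioms by (elim conjE)
  from this[rule_format, OF assms, of 1] show ?thesis by (simp add: fun_eq_iff)
qed

lemma bracket_add_right:
  assumes "X \<in> Sec E" "Y \<in> Sec E" "Z \<in> Sec E"
  shows "bracket E X (\<lambda>q. Y q + Z q) = (\<lambda>p. bracket E X Y p + bracket E X Z p)"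
proof
  fix p
  have "bracket E X (\<lambda>q. Y q + Z q) p = - bracket E (\<lambda>q. Y q + Z q) X p"
    by (rule bracket_antisym) (use assms Sec_add in auto)
  also have "\<dots> = - bracket E Y X p + - bracket E Z X p"
    by (simp add: bracket_add_left assms)
  also have "\<dots> = bracket E X Y p + bracket E X Z p"
    unfolding bracket_antisym[OF assms(1,2), of p] bracket_antisym[OF assms(1,3), of p] ..
  finally show "bracket E X (\<lambda>q. Y q + Z q) p = bracket E X Y p + bracket E X Z p" .
qed

lemma bracket_scale_right:
  assumes "X \<in> Sec E" "Y \<in> Sec E" "smooth_on UNIV f"
  shows "bracket E X (\<lambda>q. f q *\<^sub>R Y q) = (\<lambda>p. f p *\<^sub>R bracket E X Y p + anchor E p (X p) f *\<^sub>R Y p)"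
proof -
  have "\<forall>X\<in>Sec E. \<forall>Y\<in>Sec E. \<forall>f. smooth_fun_on E UNIV f \<longrightarrow>
        (\<forall>p. bracket E X (\<lambda>q. f q *\<^sub>R Y q) p = f p *\<^sub>R bracket E X Y p + anchor E p (X p) f *\<^sub>R Y p)"
    using algebroid_axioms by (elim conjE)
  from this[rule_format, OF assms] show ?thesis by (simp add: fun_eq_iff)
qed

lemma bracket_self: "X \<in> Sec E \<Longrightarrow> bracket E X X = (\<lambda>_. 0)"
proof
  fix p assume X: "X \<in> Sec E"
  have "bracket E X X p + bracket E X X p = 0"
    unfolding eq_neg_iff_add_eq_0[symmetric] by (rule bracket_antisym[OF X X])
  then show "bracket E X X p = 0" by (simp flip: scaleR_2)
qed

lemma anchor_smooth:
  assumes X: "X \<in> Sec E" and U: "open U" and f: "smooth_on U f"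
  shows "smooth_on U (\<lambda>p. anchor E p (X p) f)"
proof -
  have "smooth_section_on E U X"
  proof (rule sectionI)
    show "X p \<in> fibre E p" for p using X by (rule Sec_fibre)
    fix V e assume "(V, e) \<in> frames E"
    then obtain c where c: "\<forall>i<rk. smooth_on (UNIV \<inter> V) (c i)"
      "\<forall>p\<in>UNIV \<inter> V. X p = (\<Sum>i<rk. c i p *\<^sub>R e i p)"
      by (rule section_coeff[of UNIV X, rotated]) (use X in \<open>simp_all add: Sec_def\<close>)
    show "\<exists>c. (\<forall>i<rk. smooth_on (U \<inter> V) (c i)) \<and> (\<forall>p\<in>U \<inter> V. X p = (\<Sum>i<rk. c i p *\<^sub>R e i p))"
      using c smooth_on_subset[of "UNIV \<inter> V" _ "U \<inter> V"] by (intro exI[of _ c]) auto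
  qed
  moreover have "\<forall>U X. open U \<longrightarrow> smooth_section_on E U X \<longrightarrow>
        smooth_vector_field_on E U (\<lambda>p. anchor E p (X p))"
    using algebroid_axioms by (elim conjE)
  ultimately have "smooth_vector_field_on E U (\<lambda>p. anchor E p (X p))" using U by blast
  then show ?thesis using U f unfolding smooth_vector_field_on_def by blast
qed

context
  fixes U :: "'m set" and p :: 'm and v :: 'v
  assumes U: "open U" "p \<in> U" and v: "v \<in> fibre E p"
begin

lemma smooth_nearI: "smooth_on U f \<Longrightarrow> smooth_near E p f"
  using U unfolding smooth_near_def by blast

text \<open>A tangent vector is extended by 0 to functions that are not smooth near
  \<open>p\<close>, so that this and the following rules of a derivation require smoothness on a
  neighbourhood \<open>U\<close>.\<close>

lemma anchor_cong:
  assumes "smooth_on U f" "\<And>q. q \<in> U \<Longrightarrow> f q = g q"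
  shows "anchor E p v f = anchor E p v g"
proof -
  have g: "smooth_on U g" using smooth_on_cong[OF U(1) _ assms(1)] assms(2) by blast
  have ev: "\<forall>\<^sub>F q in nhds p. f q = g q"
    using eventually_nhds_in_open[OF U] by (rule eventually_mono) (use assms(2) in auto)
  have "\<forall>f g. smooth_near E p f \<longrightarrow> smooth_near E p g \<longrightarrow> (\<forall>\<^sub>F q in nhds p. f q = g q) \<longrightarrow>
      anchor E p v f = anchor E p v g"
    using anchor_tangent[OF v] unfolding tangent_space_def mem_Collect_eq by (elim conjE)
  from this[rule_format, OF smooth_nearI[OF assms(1)] smooth_nearI[OF g] ev] show ?thesis .
qed

lemma anchor_add_fun:
  assumes "smooth_on U f" "smooth_on U g"
  shows "anchor E p v (\<lambda>q. f q + g q) = anchor E p v f + anchor E p v g"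
proof -
  have "\<forall>f g. smooth_near E p f \<longrightarrow> smooth_near E p g \<longrightarrow>
      anchor E p v (\<lambda>q. f q + g q) = anchor E p v f + anchor E p v g"
    using anchor_tangent[OF v] unfolding tangent_space_def mem_Collect_eq by (elim conjE)
  then show ?thesis using smooth_nearI[OF assms(1)] smooth_nearI[OF assms(2)] by simp
qed

lemma anchor_scale_fun:
  assumes "smooth_on U f"
  shows "anchor E p v (\<lambda>q. c * f q) = c * anchor E p v f"
proof -
  have "\<forall>c f. smooth_near E p f \<longrightarrow> anchor E p v (\<lambda>q. c * f q) = c * anchor E p v f"
    using anchor_tangent[OF v] unfolding tangent_space_def mem_Collect_eq by (elim conjE)
  then show ?thesis using smooth_nearI[OF assms(1)] by simp
qed

lemma anchor_mult_fun:
  assumes "smooth_on U f" "smooth_on U g"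
  shows "anchor E p v (\<lambda>q. f q * g q) = f p * anchor E p v g + g p * anchor E p v f"
proof -
  have "\<forall>f g. smooth_near E p f \<longrightarrow> smooth_near E p g \<longrightarrow>
      anchor E p v (\<lambda>q. f q * g q) = f p * anchor E p v g + g p * anchor E p v f"
    using anchor_tangent[OF v] unfolding tangent_space_def mem_Collect_eq by (elim conjE)
  then show ?thesis using smooth_nearI[OF assms(1)] smooth_nearI[OF assms(2)] by simp
qed

end

text \<open>Forms over \<open>U\<close> in disguise: alternating, C-infinity-multilinear operators
  from global sections to smooth functions on \<open>U\<close>. Alternation is stated for adjacent
  arguments, the shape in which the recursion preserves it; \<open>tensorial_repeat\<close> extends
  it to arbitrary positions.\<close>

definition tensorial :: "'m set \<Rightarrow> nat \<Rightarrow> ('m, 'v) multi_operator \<Rightarrow> bool" where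
  "tensorial U k F \<longleftrightarrow>
     (\<forall>Xs. set Xs \<subseteq> Sec E \<longrightarrow> length Xs = k \<longrightarrow> smooth_on U (F Xs)) \<and>
     (\<forall>us X Y ws p. set (us @ X # Y # ws) \<subseteq> Sec E \<longrightarrow> length (us @ X # ws) = k \<longrightarrow> p \<in> U \<longrightarrow>
        F (us @ (\<lambda>q. X q + Y q) # ws) p = F (us @ X # ws) p + F (us @ Y # ws) p) \<and>
     (\<forall>us X ws f p. set (us @ X # ws) \<subseteq> Sec E \<longrightarrow> smooth_on UNIV f \<longrightarrow> length (us @ X # ws) = k \<longrightarrow> p \<in> U \<longrightarrow>
        F (us @ (\<lambda>q. f q *\<^sub>R X q) # ws) p = f p * F (us @ X # ws) p) \<and>
     (\<forall>us X ws p. set (us @ X # ws) \<subseteq> Sec E \<longrightarrow> length (us @ X # X # ws) = k \<longrightarrow> p \<in> U \<longrightarrow>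
        F (us @ X # X # ws) p = 0)"

lemma tensorialI:
  assumes "\<And>Xs. set Xs \<subseteq> Sec E \<Longrightarrow> length Xs = k \<Longrightarrow> smooth_on U (F Xs)"
    "\<And>us X Y ws p. set us \<subseteq> Sec E \<Longrightarrow> X \<in> Sec E \<Longrightarrow> Y \<in> Sec E \<Longrightarrow> set ws \<subseteq> Sec E \<Longrightarrow> length (us @ X # ws) = k \<Longrightarrow> p \<in> U \<Longrightarrow>
        F (us @ (\<lambda>q. X q + Y q) # ws) p = F (us @ X # ws) p + F (us @ Y # ws) p"
    "\<And>us X ws f p. set us \<subseteq> Sec E \<Longrightarrow> X \<in> Sec E \<Longrightarrow> set ws \<subseteq> Sec E \<Longrightarrow> smooth_on UNIV f \<Longrightarrow> length (us @ X # ws) = k \<Longrightarrow> p \<in> U \<Longrightarrow>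
        F (us @ (\<lambda>q. f q *\<^sub>R X q) # ws) p = f p * F (us @ X # ws) p"
    "\<And>us X ws p. set us \<subseteq> Sec E \<Longrightarrow> X \<in> Sec E \<Longrightarrow> set ws \<subseteq> Sec E \<Longrightarrow> length (us @ X # X # ws) = k \<Longrightarrow> p \<in> U \<Longrightarrow>
        F (us @ X # X # ws) p = 0"
  shows "tensorial U k F"
  unfolding tensorial_def
  by (intro conjI allI impI; rule assms) simp_all

lemma tensorialD:
  assumes "tensorial U k F"
  shows "set Xs \<subseteq> Sec E \<Longrightarrow> length Xs = k \<Longrightarrow> smooth_on U (F Xs)"
    "set us \<subseteq> Sec E \<Longrightarrow> X \<in> Sec E \<Longrightarrow> Y \<in> Sec E \<Longrightarrow> set ws \<subseteq> Sec E \<Longrightarrow> length us + length ws + 1 = k \<Longrightarrow> p \<in> U \<Longrightarrow>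
        F (us @ (\<lambda>q. X q + Y q) # ws) p = F (us @ X # ws) p + F (us @ Y # ws) p"
    "set us \<subseteq> Sec E \<Longrightarrow> X \<in> Sec E \<Longrightarrow> set ws \<subseteq> Sec E \<Longrightarrow> smooth_on UNIV f \<Longrightarrow> length us + length ws + 1 = k \<Longrightarrow> p \<in> U \<Longrightarrow>
        F (us @ (\<lambda>q. f q *\<^sub>R X q) # ws) p = f p * F (us @ X # ws) p"
    "set us \<subseteq> Sec E \<Longrightarrow> X \<in> Sec E \<Longrightarrow> set ws \<subseteq> Sec E \<Longrightarrow> length us + length ws + 2 = k \<Longrightarrow> p \<in> U \<Longrightarrow>
        F (us @ X # X # ws) p = 0"
  using assms unfolding tensorial_def by simp_all

text \<open>Contraction with \<open>X\<close>. It keeps the recursion of \<open>cartan\<close> among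
  tensorial operators.\<close>

lemma tensorial_Cons:
  assumes F: "tensorial U (Suc k) F" and X: "X \<in> Sec E"
  shows "tensorial U k (\<lambda>Ys. F (X # Ys))"
proof (rule tensorialI)
  show "smooth_on U (F (X # Xs))" if "set Xs \<subseteq> Sec E" "length Xs = k" for Xs
    using that X by (intro tensorialD(1)[OF F]) auto
  show "F (X # us @ (\<lambda>q. Y q + Z q) # ws) p = F (X # us @ Y # ws) p + F (X # us @ Z # ws) p"
    if "set us \<subseteq> Sec E" "Y \<in> Sec E" "Z \<in> Sec E" "set ws \<subseteq> Sec E" "length (us @ Y # ws) = k" "p \<in> U" for us Y Z ws p
    using that X tensorialD(2)[OF F, of "X # us" Y Z ws p] by simp
  show "F (X # us @ (\<lambda>q. f q *\<^sub>R Y q) # ws) p = f p * F (X # us @ Y # ws) p"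
    if "set us \<subseteq> Sec E" "Y \<in> Sec E" "set ws \<subseteq> Sec E" "smooth_on UNIV f" "length (us @ Y # ws) = k" "p \<in> U" for us Y ws f p
    using that X tensorialD(3)[OF F, of "X # us" Y ws f p] by simp
  show "F (X # us @ Y # Y # ws) p = 0"
    if "set us \<subseteq> Sec E" "Y \<in> Sec E" "set ws \<subseteq> Sec E" "length (us @ Y # Y # ws) = k" "p \<in> U" for us Y ws p
    using that X tensorialD(4)[OF F, of "X # us" Y ws p] by simp
qed

lemma tensorial_swap:
  assumes F: "tensorial U k F" and l: "set us \<subseteq> Sec E" "X \<in> Sec E" "Y \<in> Sec E" "set ws \<subseteq> Sec E"
    "length us + length ws + 2 = k" "p \<in> U"
  shows "F (us @ X # Y # ws) p = - F (us @ Y # X # ws) p"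
proof -
  let ?Z = "\<lambda>q. X q + Y q"
  have Z: "?Z \<in> Sec E" using l by (intro Sec_add)
  have "0 = F (us @ ?Z # ?Z # ws) p"
    using tensorialD(4)[OF F l(1) Z l(4) l(5,6)] by simp
  also have "\<dots> = F ((us @ [X]) @ ?Z # ws) p + F ((us @ [Y]) @ ?Z # ws) p"
    using tensorialD(2)[OF F l(1,2,3), of "?Z # ws" p] Z l by simp
  also have "\<dots> = F (us @ X # Y # ws) p + F (us @ Y # X # ws) p"
    using tensorialD(2)[OF F _ l(2,3,4), of "us @ [X]" p] tensorialD(2)[OF F _ l(2,3,4), of "us @ [Y]" p]
      tensorialD(4)[OF F l(1,2,4,5,6)] tensorialD(4)[OF F l(1,3,4,5,6)] l by simp
  finally show ?thesis by simp
qed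

lemma tensorial_zero_fun: "tensorial U k (\<lambda>_ _. 0)"
  by (rule tensorialI) simp_all

section \<open>The bracket sum of a tensorial operator\<close>

lemma bracket_sum_cong:
  assumes "\<And>Ys. set Ys \<subseteq> Sec E \<Longrightarrow> length Ys = length Xs \<Longrightarrow> F Ys p = G Ys p" "set Xs \<subseteq> Sec E" "X \<in> Sec E"
  shows "bracket_sum E X Xs F p = bracket_sum E X Xs G p"
  using assms
proof (induction Xs arbitrary: F G)
  case (Cons Y Xs)
  have "bracket_sum E X Xs (\<lambda>Zs. F (Y # Zs)) p = bracket_sum E X Xs (\<lambda>Zs. G (Y # Zs)) p"
    by (rule Cons.IH) (use Cons.prems in auto)
  moreover have "F (bracket E X Y # Xs) p = G (bracket E X Y # Xs) p"
    by (rule Cons.prems(1)) (use Cons.prems bracket_Sec in auto)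
  ultimately show ?case by simp
qed simp

lemma bracket_sum_add_fun:
  "bracket_sum E X Xs (\<lambda>Ys p. F Ys p + G Ys p) p = bracket_sum E X Xs F p + bracket_sum E X Xs G p"
  by (induction Xs arbitrary: F G) (auto simp: algebra_simps)

lemma bracket_sum_scale_fun:
  "bracket_sum E X Xs (\<lambda>Ys p. c p * F Ys p) p = c p * bracket_sum E X Xs F p"
  by (induction Xs arbitrary: F) (auto simp: algebra_simps)

lemma bracket_sum_zero_fun: "bracket_sum E X Xs (\<lambda>_ _. 0) p = 0"
  by (induction Xs) auto

lemma bracket_sum_smooth:
  assumes "tensorial U (length Xs) F" "set Xs \<subseteq> Sec E" "X \<in> Sec E"
  shows "smooth_on U (bracket_sum E X Xs F)"
  using assms
proof (induction Xs arbitrary: F)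
  case Nil
  then show ?case by simp
next
  case (Cons Y Xs)
  have "smooth_on U (F (bracket E X Y # Xs))"
    using Cons.prems bracket_Sec by (intro tensorialD(1)[OF Cons.prems(1)]) auto
  moreover have "smooth_on U (bracket_sum E X Xs (\<lambda>Zs. F (Y # Zs)))"
    using Cons.prems by (intro Cons.IH tensorial_Cons) auto
  ultimately show ?case by (simp add: smooth_on_add)
qed

context
  fixes U :: "'m set" and p :: 'm
  assumes p: "p \<in> U"
begin

lemma bracket_sum_add_left:
  assumes "tensorial U (length Ys) F" "set Ys \<subseteq> Sec E" "X \<in> Sec E" "X' \<in> Sec E"
  shows "bracket_sum E (\<lambda>q. X q + X' q) Ys F p = bracket_sum E X Ys F p + bracket_sum E X' Ys F p"
  using assms
proof (induction Ys arbitrary: F)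
  case (Cons Y Ys)
  have "F (bracket E (\<lambda>q. X q + X' q) Y # Ys) p = F (bracket E X Y # Ys) p + F (bracket E X' Y # Ys) p"
    using tensorialD(2)[OF Cons.prems(1), of "[]" "bracket E X Y" "bracket E X' Y" Ys p] p Cons.prems bracket_Sec
    by (simp add: bracket_add_left)
  moreover have "tensorial U (length Ys) (\<lambda>Zs. F (Y # Zs))"
    using Cons.prems by (intro tensorial_Cons) auto
  ultimately show ?case using Cons by simp
qed simp

lemma bracket_sum_add:
  assumes "tensorial U (length us + length ws + 1) F" "set us \<subseteq> Sec E" "Y \<in> Sec E" "Z \<in> Sec E" "set ws \<subseteq> Sec E" "X \<in> Sec E"
  shows "bracket_sum E X (us @ (\<lambda>q. Y q + Z q) # ws) F p =
    bracket_sum E X (us @ Y # ws) F p + bracket_sum E X (us @ Z # ws) F p"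
  using assms
proof (induction us arbitrary: F)
  case Nil
  note D = tensorialD(2)[OF Nil(1), of "[]"]
  have "F (bracket E X (\<lambda>q. Y q + Z q) # ws) p = F (bracket E X Y # ws) p + F (bracket E X Z # ws) p"
    using D[of "bracket E X Y" "bracket E X Z" ws p] Nil p bracket_Sec by (simp add: bracket_add_right)
  moreover have "bracket_sum E X ws (\<lambda>Zs. F ((\<lambda>q. Y q + Z q) # Zs)) p =
      bracket_sum E X ws (\<lambda>Zs p. F (Y # Zs) p + F (Z # Zs) p) p"
    by (rule bracket_sum_cong) (use D[of Y Z _ p] Nil p in auto)
  ultimately show ?case by (simp add: bracket_sum_add_fun)
next
  case (Cons u us)
  have "F (bracket E X u # us @ (\<lambda>q. Y q + Z q) # ws) p =
      F (bracket E X u # us @ Y # ws) p + F (bracket E X u # us @ Z # ws) p"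
    using tensorialD(2)[OF Cons.prems(1), of "bracket E X u # us" Y Z ws p] Cons.prems p bracket_Sec by simp
  moreover have "tensorial U (length us + length ws + 1) (\<lambda>Zs. F (u # Zs))"
    using Cons.prems by (intro tensorial_Cons) auto
  ultimately show ?case using Cons by simp
qed

text \<open>The additional summand is the Leibniz term of \<open>[X, f Y]\<close> in the slot of
  \<open>Y\<close>. In \<open>lie_deriv_scale\<close> it cancels against the term in which the
  anchor differentiates \<open>f\<close>.\<close>

lemma bracket_sum_scale:
  assumes "tensorial U (length us + length ws + 1) F" "set us \<subseteq> Sec E" "Y \<in> Sec E" "set ws \<subseteq> Sec E" "X \<in> Sec E"
    and f: "smooth_on UNIV f"
  shows "bracket_sum E X (us @ (\<lambda>q. f q *\<^sub>R Y q) # ws) F p =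
    f p * bracket_sum E X (us @ Y # ws) F p + anchor E p (X p) f * F (us @ Y # ws) p"
  using assms(1-5)
proof (induction us arbitrary: F)
  case Nil
  have g: "smooth_on UNIV (\<lambda>p. anchor E p (X p) f)" using Nil f by (intro anchor_smooth) auto
  have XY: "bracket E X Y \<in> Sec E" using Nil bracket_Sec by simp
  have "F (bracket E X (\<lambda>q. f q *\<^sub>R Y q) # ws) p =
      F ((\<lambda>q. f q *\<^sub>R bracket E X Y q) # ws) p + F ((\<lambda>q. anchor E q (X q) f *\<^sub>R Y q) # ws) p"
    using tensorialD(2)[OF Nil(1), of "[]" "\<lambda>q. f q *\<^sub>R bracket E X Y q" "\<lambda>q. anchor E q (X q) f *\<^sub>R Y q" ws p]
      Nil p XY f g by (simp add: bracket_scale_right Sec_scale)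
  also have "\<dots> = f p * F (bracket E X Y # ws) p + anchor E p (X p) f * F (Y # ws) p"
    using tensorialD(3)[OF Nil(1), of "[]" "bracket E X Y" ws f p]
      tensorialD(3)[OF Nil(1), of "[]" Y ws "\<lambda>p. anchor E p (X p) f" p] Nil p XY f g by simp
  finally have "F (bracket E X (\<lambda>q. f q *\<^sub>R Y q) # ws) p =
      f p * F (bracket E X Y # ws) p + anchor E p (X p) f * F (Y # ws) p" .
  moreover have "bracket_sum E X ws (\<lambda>Zs. F ((\<lambda>q. f q *\<^sub>R Y q) # Zs)) p =
      bracket_sum E X ws (\<lambda>Zs p. f p * F (Y # Zs) p) p"
    by (rule bracket_sum_cong) (use tensorialD(3)[OF Nil(1), of "[]" Y _ f p] Nil p f in auto)
  ultimately show ?case by (simp add: bracket_sum_scale_fun algebra_simps)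
next
  case (Cons u us)
  have "F (bracket E X u # us @ (\<lambda>q. f q *\<^sub>R Y q) # ws) p = f p * F (bracket E X u # us @ Y # ws) p"
    using tensorialD(3)[OF Cons.prems(1), of "bracket E X u # us" Y ws f p] Cons.prems p f bracket_Sec by simp
  moreover have "tensorial U (length us + length ws + 1) (\<lambda>Zs. F (u # Zs))"
    using Cons.prems by (intro tensorial_Cons) auto
  ultimately show ?case using Cons by (simp add: algebra_simps)
qed

text \<open>The two slots of \<open>Y\<close> contribute \<open>F\<close> with
  \<open>[X, Y], Y\<close> and with \<open>Y, [X, Y]\<close>, which are opposite; in every other
  slot the repeated \<open>Y\<close> remains.\<close>

lemma bracket_sum_alternating:
  assumes "tensorial U (length us + length ws + 2) F" "set us \<subseteq> Sec E" "Y \<in> Sec E" "set ws \<subseteq> Sec E" "X \<in> Sec E"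
  shows "bracket_sum E X (us @ Y # Y # ws) F p = 0"
  using assms
proof (induction us arbitrary: F)
  case Nil
  have XY: "bracket E X Y \<in> Sec E" using Nil bracket_Sec by simp
  have "F (bracket E X Y # Y # ws) p = - F (Y # bracket E X Y # ws) p"
    using tensorial_swap[OF Nil(1), of "[]" "bracket E X Y" Y ws p] Nil XY p by simp
  moreover have "bracket_sum E X ws (\<lambda>Zs. F (Y # Y # Zs)) p = bracket_sum E X ws (\<lambda>_ _. 0) p"
    by (rule bracket_sum_cong) (use tensorialD(4)[OF Nil(1), of "[]" Y _ p] Nil p in auto)
  ultimately show ?case by (simp add: bracket_sum_zero_fun)
next
  case (Cons u us)
  have "F (bracket E X u # us @ Y # Y # ws) p = 0"
    using tensorialD(4)[OF Cons.prems(1), of "bracket E X u # us" Y ws p] Cons.prems p bracket_Sec by simp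
  moreover have "tensorial U (length us + length ws + 2) (\<lambda>Zs. F (u # Zs))"
    using Cons.prems by (intro tensorial_Cons) auto
  ultimately show ?case using Cons by simp
qed

end

section \<open>The Lie derivative and the recursion for the differential\<close>

lemma lie_deriv_smooth:
  assumes U: "open U" and F: "tensorial U (length Xs) F" "set Xs \<subseteq> Sec E" "X \<in> Sec E"
  shows "smooth_on U (lie_deriv E X Xs F)"
  unfolding lie_deriv_def[abs_def]
  by (intro smooth_on_diff anchor_smooth bracket_sum_smooth tensorialD(1)[OF F(1)] F U refl)

context
  fixes U :: "'m set" and p :: 'm
  assumes U: "open U" "p \<in> U"
begin

lemma lie_deriv_add_left:
  assumes "tensorial U (length Ys) F" "set Ys \<subseteq> Sec E" "X \<in> Sec E" "X' \<in> Sec E"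
  shows "lie_deriv E (\<lambda>q. X q + X' q) Ys F p = lie_deriv E X Ys F p + lie_deriv E X' Ys F p"
  using bracket_sum_add_left[OF U(2) assms] assms Sec_fibre
  by (simp add: lie_deriv_def anchor_add)

lemma lie_deriv_add:
  assumes F: "tensorial U (length us + length ws + 1) F" and l: "set us \<subseteq> Sec E" "Y \<in> Sec E" "Z \<in> Sec E" "set ws \<subseteq> Sec E" "X \<in> Sec E"
  shows "lie_deriv E X (us @ (\<lambda>q. Y q + Z q) # ws) F p =
    lie_deriv E X (us @ Y # ws) F p + lie_deriv E X (us @ Z # ws) F p"
proof -
  have s: "smooth_on U (F (us @ W # ws))" if "W \<in> Sec E" for W
    using that l by (intro tensorialD(1)[OF F]) auto
  have "anchor E p (X p) (F (us @ (\<lambda>q. Y q + Z q) # ws)) =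
      anchor E p (X p) (\<lambda>q. F (us @ Y # ws) q + F (us @ Z # ws) q)"
    by (rule anchor_cong[OF U Sec_fibre[OF l(5)]])
      (use s Sec_add l tensorialD(2)[OF F l(1-4)] in auto)
  also have "\<dots> = anchor E p (X p) (F (us @ Y # ws)) + anchor E p (X p) (F (us @ Z # ws))"
    by (rule anchor_add_fun[OF U Sec_fibre[OF l(5)] s s]) (use l in auto)
  finally show ?thesis
    using bracket_sum_add[OF U(2) assms] by (simp add: lie_deriv_def)
qed

lemma lie_deriv_scale:
  assumes F: "tensorial U (length us + length ws + 1) F" and l: "set us \<subseteq> Sec E" "Y \<in> Sec E" "set ws \<subseteq> Sec E" "X \<in> Sec E"
    and f: "smooth_on UNIV f"
  shows "lie_deriv E X (us @ (\<lambda>q. f q *\<^sub>R Y q) # ws) F p = f p * lie_deriv E X (us @ Y # ws) F p"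
proof -
  have s: "smooth_on U (F (us @ W # ws))" if "W \<in> Sec E" for W
    using that l by (intro tensorialD(1)[OF F]) auto
  have fU: "smooth_on U f" using f by (rule smooth_on_subset) simp
  have "anchor E p (X p) (F (us @ (\<lambda>q. f q *\<^sub>R Y q) # ws)) =
      anchor E p (X p) (\<lambda>q. f q * F (us @ Y # ws) q)"
    by (rule anchor_cong[OF U Sec_fibre[OF l(4)]])
      (use s Sec_scale[OF f] l tensorialD(3)[OF F l(1-3) f] in auto)
  also have "\<dots> = f p * anchor E p (X p) (F (us @ Y # ws)) + F (us @ Y # ws) p * anchor E p (X p) f"
    by (rule anchor_mult_fun[OF U Sec_fibre[OF l(4)] fU s[OF l(2)]])
  finally show ?thesis
    using bracket_sum_scale[OF U(2) assms] by (simp add: lie_deriv_def algebra_simps)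
qed

lemma anchor_zero_fun:
  assumes "v \<in> fibre E p"
  shows "anchor E p v (\<lambda>_. 0) = 0"
  using anchor_scale_fun[OF U assms smooth_on_const, of 0 0] by simp

lemma cartan_zero_fun:
  assumes "set Xs \<subseteq> Sec E"
  shows "cartan E Xs (\<lambda>_ _. 0) p = 0"
  using assms Sec_fibre
  by (induction Xs) (auto simp: lie_deriv_def anchor_zero_fun bracket_sum_zero_fun)

text \<open>Agreement on all of \<open>U\<close> and not merely at \<open>p\<close> is assumed
  because the anchor differentiates the values of the operators.\<close>

lemma cartan_cong:
  assumes "tensorial U k F" "length Xs = Suc k" "set Xs \<subseteq> Sec E"
    "\<And>Ys q. set Ys \<subseteq> Sec E \<Longrightarrow> length Ys = k \<Longrightarrow> q \<in> U \<Longrightarrow> F Ys q = G Ys q"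
  shows "cartan E Xs F p = cartan E Xs G p"
  using assms
proof (induction Xs arbitrary: F G k)
  case (Cons X Xs)
  have l: "length Xs = k" "set Xs \<subseteq> Sec E" "X \<in> Sec E" using Cons.prems by auto
  have "anchor E p (X p) (F Xs) = anchor E p (X p) (G Xs)"
    by (rule anchor_cong[OF U Sec_fibre[OF l(3)] tensorialD(1)[OF Cons.prems(1)]])
      (use l Cons.prems(4) in auto)
  moreover have "bracket_sum E X Xs F p = bracket_sum E X Xs G p"
    by (rule bracket_sum_cong) (use l Cons.prems(4) U in auto)
  moreover have "cartan E Xs (\<lambda>Ys. F (X # Ys)) p = cartan E Xs (\<lambda>Ys. G (X # Ys)) p"
  proof (cases k)
    case 0
    then show ?thesis using l by simp
  next
    case (Suc k')
    show ?thesis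
      by (rule Cons.IH[of k']) (use l Cons.prems(1,4) Suc tensorial_Cons in auto)
  qed
  ultimately show ?case by (simp add: lie_deriv_def)
qed simp

lemma cartan_add_fun:
  assumes "tensorial U k F" "tensorial U k G" "length Xs = Suc k" "set Xs \<subseteq> Sec E"
  shows "cartan E Xs (\<lambda>Ys p. F Ys p + G Ys p) p = cartan E Xs F p + cartan E Xs G p"
  using assms
proof (induction Xs arbitrary: F G k)
  case (Cons X Xs)
  have l: "length Xs = k" "set Xs \<subseteq> Sec E" "X \<in> Sec E" using Cons.prems by auto
  have "anchor E p (X p) (\<lambda>q. F Xs q + G Xs q) = anchor E p (X p) (F Xs) + anchor E p (X p) (G Xs)"
    by (rule anchor_add_fun[OF U Sec_fibre[OF l(3)] tensorialD(1)[OF Cons.prems(1)] tensorialD(1)[OF Cons.prems(2)]])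
      (use l in auto)
  moreover have "cartan E Xs (\<lambda>Ys p. F (X # Ys) p + G (X # Ys) p) p =
      cartan E Xs (\<lambda>Ys. F (X # Ys)) p + cartan E Xs (\<lambda>Ys. G (X # Ys)) p"
  proof (cases k)
    case 0
    then show ?thesis using l by simp
  next
    case (Suc k')
    show ?thesis
      by (rule Cons.IH[of k']) (use l Cons.prems(1,2) Suc tensorial_Cons in auto)
  qed
  ultimately show ?case by (simp add: lie_deriv_def bracket_sum_add_fun)
qed simp

text \<open>A sum in the first slot enters the recursion twice: as the direction of the Lie
  derivative, and as the first argument fixed in \<open>F\<close>. The second occurrence makes the
  operator itself a sum and is settled by \<open>cartan_cong\<close> and
  \<open>cartan_add_fun\<close>.\<close>

lemma cartan_add:
  assumes "tensorial U (length us + length ws) F" "set us \<subseteq> Sec E" "Y \<in> Sec E" "Z \<in> Sec E" "set ws \<subseteq> Sec E"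
  shows "cartan E (us @ (\<lambda>q. Y q + Z q) # ws) F p = cartan E (us @ Y # ws) F p + cartan E (us @ Z # ws) F p"
  using assms
proof (induction us arbitrary: F)
  case Nil
  have "cartan E ws (\<lambda>Ys. F ((\<lambda>q. Y q + Z q) # Ys)) p =
      cartan E ws (\<lambda>Ys. F (Y # Ys)) p + cartan E ws (\<lambda>Ys. F (Z # Ys)) p"
  proof (cases ws)
    case (Cons w ws')
    have k: "tensorial U (Suc (length ws')) F" using Nil Cons by simp
    have "cartan E ws (\<lambda>Ys. F ((\<lambda>q. Y q + Z q) # Ys)) p = cartan E ws (\<lambda>Ys p. F (Y # Ys) p + F (Z # Ys) p) p"
      by (rule cartan_cong[OF tensorial_Cons[OF k]])
        (use Nil Cons tensorialD(2)[OF k, of "[]" Y Z] in \<open>auto intro: Sec_add\<close>)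
    also have "\<dots> = cartan E ws (\<lambda>Ys. F (Y # Ys)) p + cartan E ws (\<lambda>Ys. F (Z # Ys)) p"
      by (rule cartan_add_fun[OF tensorial_Cons[OF k] tensorial_Cons[OF k]]) (use Nil Cons in auto)
    finally show ?thesis .
  qed simp
  then show ?case using Nil by (simp add: lie_deriv_add_left)
next
  case (Cons u us)
  have "tensorial U (length us + length ws) (\<lambda>Zs. F (u # Zs))"
    using Cons.prems by (intro tensorial_Cons) auto
  then have "cartan E (us @ (\<lambda>q. Y q + Z q) # ws) (\<lambda>Ys. F (u # Ys)) p =
      cartan E (us @ Y # ws) (\<lambda>Ys. F (u # Ys)) p + cartan E (us @ Z # ws) (\<lambda>Ys. F (u # Ys)) p"
    using Cons by simp
  moreover have "lie_deriv E u (us @ (\<lambda>q. Y q + Z q) # ws) F p =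
      lie_deriv E u (us @ Y # ws) F p + lie_deriv E u (us @ Z # ws) F p"
    by (rule lie_deriv_add) (use Cons.prems in auto)
  ultimately show ?case by simp
qed

text \<open>For \<open>us = []\<close> two steps of the recursion produce Lie derivatives along
  \<open>Y\<close> of \<open>F\<close> and of its contraction with \<open>Y\<close>. They cancel up
  to the value of \<open>F\<close> with \<open>[Y, Y] = 0\<close> in its first slot, and what
  remains is \<open>cartan\<close> of an operator that vanishes on sections.\<close>

lemma cartan_alternating:
  assumes "tensorial U (length us + length ws + 1) F" "set us \<subseteq> Sec E" "Y \<in> Sec E" "set ws \<subseteq> Sec E"
  shows "cartan E (us @ Y # Y # ws) F p = 0"
  using assms
proof (induction us arbitrary: F)
  case Nil
  have "cartan E ws (\<lambda>Zs. F (Y # Y # Zs)) p = 0"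
  proof (cases ws)
    case (Cons w ws')
    have k: "tensorial U (Suc (Suc (length ws'))) F" using Nil Cons by simp
    have "cartan E ws (\<lambda>Zs. F (Y # Y # Zs)) p = cartan E ws (\<lambda>_ _. 0) p"
      by (rule cartan_cong[OF tensorial_Cons[OF tensorial_Cons[OF k]]])
        (use Nil Cons tensorialD(4)[OF k, of "[]" Y] in auto)
    then show ?thesis using cartan_zero_fun[of ws] Nil by simp
  qed simp
  moreover have "F (bracket E Y Y # ws) p = 0"
    using tensorialD(3)[OF Nil(1), of "[]" Y ws "\<lambda>_. 0" p] Nil U(2) by (simp add: bracket_self)
  ultimately show ?case by (simp add: lie_deriv_def)
next
  case (Cons u us)
  have "tensorial U (length us + length ws + 1) (\<lambda>Zs. F (u # Zs))"
    using Cons.prems by (intro tensorial_Cons) auto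
  then have "cartan E (us @ Y # Y # ws) (\<lambda>Ys. F (u # Ys)) p = 0"
    using Cons by simp
  moreover have "lie_deriv E u (us @ Y # Y # ws) F p = 0"
  proof -
    have "anchor E p (u p) (F (us @ Y # Y # ws)) = anchor E p (u p) (\<lambda>_. 0)"
      by (rule anchor_cong[OF U Sec_fibre tensorialD(1)[OF Cons.prems(1)]])
        (use Cons.prems tensorialD(4)[OF Cons.prems(1)] in auto)
    moreover have "bracket_sum E u (us @ Y # Y # ws) F p = 0"
      by (rule bracket_sum_alternating[OF U(2)]) (use Cons.prems in auto)
    ultimately show ?thesis
      using anchor_zero_fun[OF Sec_fibre] Cons.prems(2) by (simp add: lie_deriv_def)
  qed
  ultimately show ?case by simp
qed

lemma cartan_swap:
  assumes F: "tensorial U (length us + length ws + 1) F"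
    and l: "set us \<subseteq> Sec E" "X \<in> Sec E" "Y \<in> Sec E" "set ws \<subseteq> Sec E"
  shows "cartan E (us @ X # Y # ws) F p = - cartan E (us @ Y # X # ws) F p"
proof -
  let ?Z = "\<lambda>q. X q + Y q"
  have Z: "?Z \<in> Sec E" using l by (intro Sec_add)
  have "0 = cartan E (us @ ?Z # ?Z # ws) F p"
    using cartan_alternating[OF F l(1) Z l(4)] by simp
  also have "\<dots> = cartan E ((us @ [X]) @ ?Z # ws) F p + cartan E ((us @ [Y]) @ ?Z # ws) F p"
    using cartan_add[of us "?Z # ws" F X Y] F Z l by simp
  also have "\<dots> = cartan E (us @ X # Y # ws) F p + cartan E (us @ Y # X # ws) F p"
    using cartan_add[of "us @ [X]" ws F X Y] cartan_add[of "us @ [Y]" ws F X Y] F l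
      cartan_alternating[OF F l(1,2,4)] cartan_alternating[OF F l(1,3,4)] by simp
  finally show ?thesis by simp
qed

text \<open>In all slots but the first one \<open>C\<^sup>\<infinity>\<close>-linearity is inherited from \<open>L\<^sub>X\<close>; the first slot is
  exchanged with the second one, which avoids the Leibniz terms of \<open>[f X, Y]\<close>.\<close>

lemma cartan_scale:
  assumes "tensorial U (length us + length ws) F" "set us \<subseteq> Sec E" "Y \<in> Sec E" "set ws \<subseteq> Sec E"
    and f: "smooth_on UNIV f"
  shows "cartan E (us @ (\<lambda>q. f q *\<^sub>R Y q) # ws) F p = f p * cartan E (us @ Y # ws) F p"
  using assms(1-4)
\<comment> \<open>The total length decreases also when \<open>us = []\<close> and the first element
  of \<open>ws\<close> is the one removed, after the exchange of the first two slots; a structural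
  induction on \<open>us\<close> would not cover this case.\<close>
proof (induction "length us + length ws" arbitrary: us ws F rule: less_induct)
  case less
  let ?fY = "\<lambda>q. f q *\<^sub>R Y q"
  have fY: "?fY \<in> Sec E" using f less.prems by (intro Sec_scale)
  have step: "cartan E (u # us @ ?fY # ws) F p = f p * cartan E (u # us @ Y # ws) F p"
    if k: "tensorial U (length us + length ws + 1) F" and u: "u \<in> Sec E" "set us \<subseteq> Sec E" "set ws \<subseteq> Sec E"
      and IH: "cartan E (us @ ?fY # ws) (\<lambda>Zs. F (u # Zs)) p = f p * cartan E (us @ Y # ws) (\<lambda>Zs. F (u # Zs)) p"
    for u us ws
    using lie_deriv_scale[OF k u(2) less.prems(3) u(3) u(1) f] IH by (simp add: algebra_simps)
  show ?case
  proof (cases us)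
    case (Cons u us')
    have "cartan E (us' @ ?fY # ws) (\<lambda>Zs. F (u # Zs)) p = f p * cartan E (us' @ Y # ws) (\<lambda>Zs. F (u # Zs)) p"
      by (rule less.hyps) (use less.prems Cons in \<open>auto intro: tensorial_Cons\<close>)
    then show ?thesis using step[of us' ws u] less.prems Cons by simp
  next
    case Nil
    show ?thesis
    proof (cases ws)
      case Nil': Nil
      show ?thesis
        using less.prems Sec_fibre by (simp add: Nil Nil' lie_deriv_def anchor_scale)
    next
      case (Cons w ws')
      have "cartan E ([] @ ?fY # ws') (\<lambda>Zs. F (w # Zs)) p = f p * cartan E ([] @ Y # ws') (\<lambda>Zs. F (w # Zs)) p"
        by (rule less.hyps) (use less.prems Cons Nil in \<open>auto intro: tensorial_Cons\<close>)
      then have "cartan E (w # ?fY # ws') F p = f p * cartan E (w # Y # ws') F p"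
        using step[of "[]" ws' w] less.prems Cons Nil by simp
      moreover have "cartan E (?fY # w # ws') F p = - cartan E (w # ?fY # ws') F p"
        using cartan_swap[of "[]" ws' F ?fY w] fY less.prems Cons Nil by simp
      moreover have "cartan E (Y # w # ws') F p = - cartan E (w # Y # ws') F p"
        using cartan_swap[of "[]" ws' F Y w] less.prems Cons Nil by simp
      ultimately show ?thesis using Nil Cons by (simp del: cartan.simps)
    qed
  qed
qed

end

lemma cartan_smooth:
  assumes "open U" "tensorial U k F" "length Xs = Suc k" "set Xs \<subseteq> Sec E"
  shows "smooth_on U (cartan E Xs F)"
  using assms
proof (induction Xs arbitrary: F k)
  case (Cons X Xs)
  have "smooth_on U (cartan E Xs (\<lambda>Ys. F (X # Ys)))"
  proof (cases k)
    case 0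
    then show ?thesis using Cons.prems by (simp add: fun_eq_iff[of "cartan E [] _" "\<lambda>_. 0", THEN iffD2])
  next
    case (Suc k')
    show ?thesis
      by (rule Cons.IH[of k']) (use Cons.prems Suc in \<open>auto intro: tensorial_Cons\<close>)
  qed
  moreover have "smooth_on U (lie_deriv E X Xs F)"
    using Cons.prems by (intro lie_deriv_smooth) auto
  ultimately have "smooth_on U (\<lambda>p. lie_deriv E X Xs F p - cartan E Xs (\<lambda>Ys. F (X # Ys)) p)"
    by (rule smooth_on_diff[rotated])
  then show ?case by (simp add: cartan.simps(2)[abs_def])
qed simp

lemma tensorial_cartan:
  assumes U: "open U" and F: "tensorial U k F"
  shows "tensorial U (Suc k) (\<lambda>Xs. cartan E Xs F)"
  by (rule tensorialI)
    (use F in \<open>auto intro!: cartan_smooth[OF U F] cartan_add[OF U] cartan_scale[OF U] cartan_alternating[OF U]\<close>)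

text \<open>Tensoriality implies dependence on the value at \<open>p\<close> alone: in the
  decomposition of \<open>X\<close> every summand carries a global coefficient that vanishes at
  \<open>p\<close>, and C-infinity-linearity pulls this coefficient out.\<close>

lemma tensorial_vanish:
  assumes G: "tensorial U m G" and l: "set us \<subseteq> Sec E" "X \<in> Sec E" "set ws \<subseteq> Sec E" "length us + length ws + 1 = m"
    and p: "p \<in> U" "X p = 0"
  shows "G (us @ X # ws) p = 0"
proof -
  obtain g f Y where d: "smooth_on UNIV g" "g p = 0" "\<forall>i<rk. smooth_on UNIV (f i)" "\<forall>i<rk. f i p = 0"
    "\<forall>i<rk. Y i \<in> Sec E" "X = (\<lambda>q. g q *\<^sub>R X q + (\<Sum>i<rk. f i q *\<^sub>R Y i q))"
    by (rule Sec_vanishing_decomposition[where X = X and p = p]) (use l(2) p(2) in auto)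
  have fY: "(\<lambda>q. f i q *\<^sub>R Y i q) \<in> Sec E" if "i < rk" for i using d that by (intro Sec_scale) auto
  have sum: "G (us @ (\<lambda>q. \<Sum>i<N. f i q *\<^sub>R Y i q) # ws) p = 0" if "N \<le> rk" for N
    using that
  proof (induction N)
    case 0
    then show ?case using tensorialD(3)[OF G l(1,2,3), of "\<lambda>_. 0" p] l p by simp
  next
    case (Suc N)
    have "(\<lambda>q. \<Sum>i<N. f i q *\<^sub>R Y i q) \<in> Sec E" using fY Suc.prems by (intro Sec_sum) auto
    moreover have "G (us @ (\<lambda>q. f N q *\<^sub>R Y N q) # ws) p = 0"
      using tensorialD(3)[OF G l(1) _ l(3), of "Y N" "f N" p] d Suc.prems l p by simp
    ultimately show ?case
      using tensorialD(2)[OF G l(1) _ _ l(3), of "\<lambda>q. \<Sum>i<N. f i q *\<^sub>R Y i q" "\<lambda>q. f N q *\<^sub>R Y N q" p]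
        fY[of N] Suc l p by simp
  qed
  have "G (us @ X # ws) p = G (us @ (\<lambda>q. g q *\<^sub>R X q + (\<Sum>i<rk. f i q *\<^sub>R Y i q)) # ws) p"
    using d(6) by simp
  also have "\<dots> = G (us @ (\<lambda>q. g q *\<^sub>R X q) # ws) p + G (us @ (\<lambda>q. \<Sum>i<rk. f i q *\<^sub>R Y i q) # ws) p"
    by (rule tensorialD(2)[OF G l(1) _ _ l(3,4) p(1)]) (use fY l d in \<open>auto intro: Sec_scale Sec_sum\<close>)
  also have "\<dots> = 0"
    using tensorialD(3)[OF G l(1,2,3) d(1) l(4) p(1)] d(2) sum by simp
  finally show ?thesis .
qed

lemma tensorial_value_at:
  assumes G: "tensorial U m G" and l: "set us \<subseteq> Sec E" "X \<in> Sec E" "Y \<in> Sec E" "set ws \<subseteq> Sec E" "length us + length ws + 1 = m"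
    and p: "p \<in> U" "X p = Y p"
  shows "G (us @ X # ws) p = G (us @ Y # ws) p"
proof -
  let ?Z = "\<lambda>q. 1 *\<^sub>R X q + (- 1) *\<^sub>R Y q"
  have Z: "?Z \<in> Sec E" using l by (intro Sec_lincomb smooth_on_const)
  have "X = (\<lambda>q. Y q + ?Z q)" by simp
  then have "G (us @ X # ws) p = G (us @ (\<lambda>q. Y q + ?Z q) # ws) p" by simp
  also have "\<dots> = G (us @ Y # ws) p + G (us @ ?Z # ws) p"
    by (rule tensorialD(2)[OF G l(1,3) Z l(4,5) p(1)])
  also have "G (us @ ?Z # ws) p = 0"
    by (rule tensorial_vanish[OF G l(1) Z l(4,5) p(1)]) (use p(2) in simp)
  finally show ?thesis by simp
qed

lemma tensorial_pointwise:
  assumes G: "tensorial U m G" and p: "p \<in> U"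
    and l: "set us \<subseteq> Sec E" "set Xs \<subseteq> Sec E" "set Ys \<subseteq> Sec E" "length us + length Xs = m"
    and eq: "map (\<lambda>X. X p) Xs = map (\<lambda>X. X p) Ys"
  shows "G (us @ Xs) p = G (us @ Ys) p"
  using l eq
proof (induction Xs arbitrary: us Ys)
  case (Cons X Xs)
  then obtain Y Ys' where Y: "Ys = Y # Ys'" "X p = Y p" "map (\<lambda>X. X p) Xs = map (\<lambda>X. X p) Ys'"
    by (cases Ys) auto
  have "G (us @ X # Xs) p = G (us @ Y # Xs) p"
    by (rule tensorial_value_at[OF G]) (use Cons.prems Y p in auto)
  also have "\<dots> = G ((us @ [Y]) @ Xs) p" by simp
  also have "\<dots> = G ((us @ [Y]) @ Ys') p"
    by (rule Cons.IH) (use Cons.prems Y in auto)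
  finally show ?case using Y by simp
qed simp

text \<open>Adjacent transpositions move the first copy of \<open>X\<close> past \<open>vs\<close>
  until the two copies are neighbours.\<close>

lemma tensorial_repeat:
  assumes G: "tensorial U m G" and p: "p \<in> U"
    and l: "set us \<subseteq> Sec E" "X \<in> Sec E" "set vs \<subseteq> Sec E" "set ws \<subseteq> Sec E" "length us + length vs + length ws + 2 = m"
  shows "G (us @ X # vs @ X # ws) p = 0"
  using l
proof (induction vs arbitrary: us)
  case Nil
  then show ?case using tensorialD(4)[OF G, of us X ws p] p by simp
next
  case (Cons v vs)
  have "G (us @ X # v # vs @ X # ws) p = - G (us @ v # X # vs @ X # ws) p"
    by (rule tensorial_swap[OF G]) (use Cons.prems p in auto)
  also have "G (us @ v # X # vs @ X # ws) p = G ((us @ [v]) @ X # vs @ X # ws) p" by simp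
  also have "\<dots> = 0" by (rule Cons.IH) (use Cons.prems in auto)
  finally show ?case by simp
qed

end

section \<open>The de Rham differential\<close>

text \<open>\<open>koszul\<close> for an operator on sections. This generality is needed because the
  induction passes from \<open>F\<close> to its contraction with the first section.\<close>

definition koszul_op ::
  "('m, 'v::real_vector) lie_algebroid \<Rightarrow> ('m, 'v) multi_operator \<Rightarrow> ('m \<Rightarrow> 'v) list \<Rightarrow> 'm \<Rightarrow> real" where
  "koszul_op E F Xs p =
     (\<Sum>i<length Xs. (-1) ^ i * anchor E p ((Xs ! i) p) (F (remove_nth i Xs))) +
     (\<Sum>j<length Xs. \<Sum>i<j. (-1) ^ (i + j) *
        F (bracket E (Xs ! i) (Xs ! j) # remove_nth i (remove_nth j Xs)) p)"

lemma koszul_eq_koszul_op: "koszul E \<omega> = koszul_op E (\<lambda>Ys q. \<omega> q (map (\<lambda>X. X q) Ys))"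
  by (simp add: fun_eq_iff koszul_def koszul_op_def)

lemma remove_nth_0 [simp]: "remove_nth 0 (x # xs) = xs"
  by (simp add: remove_nth_def)

lemma remove_nth_Suc [simp]: "remove_nth (Suc i) (x # xs) = x # remove_nth i xs"
  by (simp add: remove_nth_def)

lemma set_remove_nth: "set (remove_nth i xs) \<subseteq> set xs"
  unfolding remove_nth_def using set_take_subset[of i xs] set_drop_subset[of "Suc i" xs] by simp

lemma length_remove_nth: "i < length xs \<Longrightarrow> length (remove_nth i xs) = length xs - 1"
  by (simp add: remove_nth_def)

context algebroid
begin

text \<open>The Koszul formula places the bracket in front, \<open>bracket_sum\<close> leaves it in
  slot \<open>j\<close>; the sign (-1)^j accounts for the \<open>j\<close> transpositions between
  the two positions.\<close>

lemma bracket_sum_eq_alternating_sum: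
  assumes "tensorial U k F" "set Ys \<subseteq> Sec E" "length Ys = k" "X \<in> Sec E" "p \<in> U"
  shows "(\<Sum>j<k. (-1) ^ j * F (bracket E X (Ys ! j) # remove_nth j Ys) p) = bracket_sum E X Ys F p"
  using assms
proof (induction Ys arbitrary: F k)
  case (Cons Y Ys)
  then obtain k' where k: "k = Suc k'" "length Ys = k'" by auto
  have l: "Y \<in> Sec E" "set Ys \<subseteq> Sec E" using Cons.prems by auto
  have "(\<Sum>j<k. (-1) ^ j * F (bracket E X ((Y # Ys) ! j) # remove_nth j (Y # Ys)) p) =
      F (bracket E X Y # Ys) p +
      (\<Sum>j<k'. - ((-1) ^ j * F (bracket E X (Ys ! j) # Y # remove_nth j Ys) p))"
    unfolding k(1) sum.lessThan_Suc_shift by simp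
  \<comment> \<open>Exchanging the bracket with \<open>Y\<close> absorbs the sign that comes from
    the index shift.\<close>
  also have "(\<Sum>j<k'. - ((-1) ^ j * F (bracket E X (Ys ! j) # Y # remove_nth j Ys) p)) =
      (\<Sum>j<k'. (-1) ^ j * F (Y # bracket E X (Ys ! j) # remove_nth j Ys) p)"
  proof (rule sum.cong[OF refl])
    fix j assume j: "j \<in> {..<k'}"
    have "F ([] @ bracket E X (Ys ! j) # Y # remove_nth j Ys) p = - F ([] @ Y # bracket E X (Ys ! j) # remove_nth j Ys) p"
    proof (rule tensorial_swap[OF Cons.prems(1)])
      have "Ys ! j \<in> Sec E" using j k l by auto
      then show "bracket E X (Ys ! j) \<in> Sec E" using Cons.prems(4) by (intro bracket_Sec)
      show "set (remove_nth j Ys) \<subseteq> Sec E" using set_remove_nth[of j Ys] l by blast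
      show "length [] + length (remove_nth j Ys) + 2 = k"
        using j k by (simp add: length_remove_nth)
    qed (use l Cons.prems in auto)
    then show "- ((-1) ^ j * F (bracket E X (Ys ! j) # Y # remove_nth j Ys) p) =
        (-1) ^ j * F (Y # bracket E X (Ys ! j) # remove_nth j Ys) p" by simp
  qed
  also have "\<dots> = bracket_sum E X Ys (\<lambda>Zs. F (Y # Zs)) p"
    by (rule Cons.IH) (use Cons.prems k l tensorial_Cons in auto)
  finally show ?case by simp
qed simp

text \<open>The terms with smallest index 0 make up the Lie derivative along the first section
  \<open>X\<close>. All other terms keep \<open>X\<close> as an argument and form, with the opposite
  sign, the Koszul expression of the contraction with \<open>X\<close>; this is one step of the
  recursion.\<close>

lemma koszul_op_eq_cartan:
  assumes "tensorial U k F" "set Xs \<subseteq> Sec E" "length Xs = Suc k" "p \<in> U"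
  shows "koszul_op E F Xs p = cartan E Xs F p"
  using assms
proof (induction Xs arbitrary: F k)
  case (Cons X Ys)
  then have l: "length Ys = k" "X \<in> Sec E" "set Ys \<subseteq> Sec E" by auto
  let ?G = "\<lambda>Zs. F (X # Zs)"
  let ?t = "\<lambda>i j. (-1) ^ (i + j) * F (bracket E ((X # Ys) ! i) ((X # Ys) ! j) # remove_nth i (remove_nth j (X # Ys))) p"
  let ?b = "\<lambda>j. (-1) ^ j * F (bracket E X (Ys ! j) # remove_nth j Ys) p"
  let ?u = "\<lambda>i j. (-1) ^ (i + j) * ?G (bracket E (Ys ! i) (Ys ! j) # remove_nth i (remove_nth j Ys)) p"
  have first: "(\<Sum>i<Suc k. (-1) ^ i * anchor E p (((X # Ys) ! i) p) (F (remove_nth i (X # Ys)))) =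
      anchor E p (X p) (F Ys) - (\<Sum>i<k. (-1) ^ i * anchor E p ((Ys ! i) p) (?G (remove_nth i Ys)))"
    unfolding sum.lessThan_Suc_shift by (simp add: sum_negf)
  have term0: "?t 0 (Suc j) =
      - ?b j" for j by simp
  \<comment> \<open>The two index shifts leave the sign (-1)^(i + j) unchanged; the minus arises
    from moving \<open>X\<close> past the bracket to the front.\<close>
  have terms: "?t (Suc i) (Suc j) =
      - ?u i j" if "j < k" "i < j" for i j
  proof -
    have "F ([] @ bracket E (Ys ! i) (Ys ! j) # X # remove_nth i (remove_nth j Ys)) p =
        - F ([] @ X # bracket E (Ys ! i) (Ys ! j) # remove_nth i (remove_nth j Ys)) p"
    proof (rule tensorial_swap[OF Cons.prems(1)])
      have "Ys ! i \<in> Sec E" "Ys ! j \<in> Sec E" using that l by auto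
      then show "bracket E (Ys ! i) (Ys ! j) \<in> Sec E" by (rule bracket_Sec)
      show "set (remove_nth i (remove_nth j Ys)) \<subseteq> Sec E"
        using set_remove_nth[of i "remove_nth j Ys"] set_remove_nth[of j Ys] l by blast
      show "length [] + length (remove_nth i (remove_nth j Ys)) + 2 = k"
        using that l(1) by (simp add: length_remove_nth)
    qed (use l Cons.prems in auto)
    then show ?thesis by simp
  qed
  have "(\<Sum>j<Suc k. \<Sum>i<j. ?t i j) =
      (\<Sum>j<k. \<Sum>i<Suc j. ?t i (Suc j))"
    unfolding sum.lessThan_Suc_shift[of _ k] by simp
  also have "\<dots> = (\<Sum>j<k. - ?b j -
      (\<Sum>i<j. ?u i j))"
  proof (rule sum.cong[OF refl])
    fix j assume "j \<in> {..<k}"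
    then have "(\<Sum>i<j. ?t (Suc i) (Suc j)) =
        (\<Sum>i<j. - ?u i j)"
      by (intro sum.cong[OF refl] terms) auto
    then show "(\<Sum>i<Suc j. ?t i (Suc j)) =
        - ?b j -
        (\<Sum>i<j. ?u i j)"
      unfolding sum.lessThan_Suc_shift term0 by (simp only: sum_negf diff_conv_add_uminus)
  qed
  also have "\<dots> = - bracket_sum E X Ys F p -
      (\<Sum>j<k. \<Sum>i<j. ?u i j)"
    using bracket_sum_eq_alternating_sum[OF Cons.prems(1) l(3,1,2) Cons.prems(4)]
    by (simp add: sum_subtractf sum_negf)
  finally have "koszul_op E F (X # Ys) p = lie_deriv E X Ys F p - koszul_op E ?G Ys p"
    using first l(1) by (simp add: koszul_op_def lie_deriv_def del: sum.lessThan_Suc)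
  moreover have "koszul_op E ?G Ys p = cartan E Ys ?G p"
  proof (cases k)
    case 0
    then show ?thesis using l by (simp add: koszul_op_def)
  next
    case (Suc k')
    show ?thesis
      by (rule Cons.IH[of k']) (use Cons.prems Suc l tensorial_Cons in auto)
  qed
  ultimately show ?case by simp
qed simp

section \<open>From the Koszul formula back to a form\<close>

lemma tensorial_form:
  assumes \<omega>: "\<omega> \<in> Forms E U (int k)" and U: "open U"
  shows "tensorial U k (\<lambda>Xs q. \<omega> q (map (\<lambda>X. X q) Xs))"
proof (rule tensorialI)
  show "smooth_on U (\<lambda>q. \<omega> q (map (\<lambda>X. X q) Xs))" if "set Xs \<subseteq> Sec E" for Xs
    using Forms_Sec_smooth[OF \<omega> U that] .
qed (use alt_forms_add[OF Forms_alt[OF \<omega>] subspace_fibre] alt_forms_scale[OF Forms_alt[OF \<omega>] subspace_fibre]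
    alt_forms_not_distinct[OF Forms_alt[OF \<omega>] subspace_fibre] Sec_fibre in simp_all)

lemma tensorial_koszul:
  assumes \<omega>: "\<omega> \<in> Forms E U k" and U: "open U" and m: "int m = k + 1"
  obtains G where "tensorial U m G" "\<forall>Xs p. set Xs \<subseteq> Sec E \<longrightarrow> length Xs = m \<longrightarrow> p \<in> U \<longrightarrow> koszul E \<omega> Xs p = G Xs p"
proof (cases m)
  \<comment> \<open>Here \<open>k = -1\<close> and the Koszul expression consists of empty sums. In
    the other case the degree is a natural number, as \<open>tensorial\<close> requires.\<close>
  case 0
  show ?thesis
    by (rule that[of "\<lambda>_ _. 0"]) (simp_all add: tensorial_zero_fun 0 koszul_def)
next
  case (Suc k')
  then have k: "k = int k'" using m by simp
  note F = tensorial_form[OF \<omega>[unfolded k] U]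
  show ?thesis
    by (rule that[OF tensorial_cartan[OF U F, folded Suc]])
      (use koszul_op_eq_cartan[OF F] Suc in \<open>simp add: koszul_eq_koszul_op\<close>)
qed

text \<open>A non-canonical choice; by \<open>tensorial_pointwise\<close> the values of tensorial
  operators at \<open>p\<close> do not depend on it.\<close>

definition section_through :: "'m \<Rightarrow> 'v \<Rightarrow> 'm \<Rightarrow> 'v" where
  "section_through p v = (SOME X. X \<in> Sec E \<and> X p = v)"

lemma section_through:
  assumes "v \<in> fibre E p"
  shows "section_through p v \<in> Sec E" "section_through p v p = v"
proof -
  obtain X where "X \<in> Sec E" "X p = v" by (rule Sec_extends_vector[OF assms])
  then have "\<exists>X. X \<in> Sec E \<and> X p = v" by (intro exI[of _ X] conjI)
  then have "section_through p v \<in> Sec E \<and> section_through p v p = v"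
    unfolding section_through_def by (rule someI_ex)
  then show "section_through p v \<in> Sec E" "section_through p v p = v" by auto
qed

lemma sections_through:
  assumes "set vs \<subseteq> fibre E p"
  shows "set (map (section_through p) vs) \<subseteq> Sec E" "map (\<lambda>X. X p) (map (section_through p) vs) = vs"
  using assms section_through by (auto simp: map_idI subset_iff)

text \<open>The inverse passage to \<open>tensorial_form\<close>. The value 0 in all remaining cases
  follows the conventions of \<open>alt_forms\<close> and \<open>Forms\<close>.\<close>

definition form_of :: "'m set \<Rightarrow> nat \<Rightarrow> ('m, 'v) multi_operator \<Rightarrow> 'm \<Rightarrow> 'v form" where
  "form_of U m G p vs =
    (if p \<in> U \<and> length vs = m \<and> set vs \<subseteq> fibre E p then G (map (section_through p) vs) p else 0)"

lemma form_of_sections: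
  assumes G: "tensorial U m G" and p: "p \<in> U" and Xs: "set Xs \<subseteq> Sec E" "length Xs = m"
  shows "form_of U m G p (map (\<lambda>X. X p) Xs) = G Xs p"
proof -
  let ?vs = "map (\<lambda>X. X p) Xs"
  have vs: "set ?vs \<subseteq> fibre E p" using Xs(1) Sec_fibre by auto
  have "G ([] @ map (section_through p) ?vs) p = G ([] @ Xs) p"
    by (rule tensorial_pointwise[OF G p]) (use sections_through[OF vs] Xs in simp_all)
  then show ?thesis using p Xs vs by (simp add: form_of_def)
qed

text \<open>One slot may be filled with any section of the right value at \<open>p\<close>. For
  linearity this allows the sum of the sections through \<open>x\<close> and \<open>y\<close> in
  place of the unrelated section chosen through \<open>x + y\<close>.\<close>

lemma form_of_slot:
  assumes G: "tensorial U m G" "p \<in> U" and l: "length us + length ws + 1 = m"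
    and f: "set us \<subseteq> fibre E p" "set ws \<subseteq> fibre E p" and X: "X \<in> Sec E" "X p = x"
  shows "form_of U m G p (us @ x # ws) = G (map (section_through p) us @ X # map (section_through p) ws) p"
proof -
  let ?s = "map (section_through p)"
  note s = sections_through[OF f(1)] sections_through[OF f(2)]
  have "form_of U m G p (map (\<lambda>X. X p) (?s us @ X # ?s ws)) = G (?s us @ X # ?s ws) p"
    by (rule form_of_sections[OF G]) (use s X l in auto)
  then show ?thesis by (simp only: map_append list.map s X(2))
qed

lemma form_of_alt_forms:
  assumes G: "tensorial U m G" and p: "p \<in> U"
  shows "form_of U m G p \<in> alt_forms (fibre E p) (int m)"
  unfolding alt_forms_def mem_Collect_eq
proof (intro conjI allI impI)
  let ?s = "section_through p"
  fix us x y ws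
  assume l: "int (length (us @ x # ws)) = int m" and "set (us @ x # y # ws) \<subseteq> fibre E p"
  then have f: "set us \<subseteq> fibre E p" "set ws \<subseteq> fibre E p" and x: "x \<in> fibre E p" and y: "y \<in> fibre E p" by auto
  have m: "length us + length ws + 1 = m" using l by simp
  note slot = form_of_slot[OF G p m f]
  have "form_of U m G p (us @ (x + y) # ws) = G (map ?s us @ (\<lambda>q. ?s x q + ?s y q) # map ?s ws) p"
    by (rule slot) (use section_through[OF x] section_through[OF y] Sec_add in auto)
  also have "\<dots> = G (map ?s us @ ?s x # map ?s ws) p + G (map ?s us @ ?s y # map ?s ws) p"
    by (rule tensorialD(2)[OF G])
      (use sections_through(1)[OF f(1)] sections_through(1)[OF f(2)] section_through[OF x] section_through[OF y] m p in simp_all)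
  finally show "form_of U m G p (us @ (x + y) # ws) = form_of U m G p (us @ x # ws) + form_of U m G p (us @ y # ws)"
    using slot[OF section_through[OF x]] slot[OF section_through[OF y]] by simp
next
  let ?s = "section_through p"
  fix us x ws and c :: real
  assume l: "int (length (us @ x # ws)) = int m" and "set (us @ x # ws) \<subseteq> fibre E p"
  then have f: "set us \<subseteq> fibre E p" "set ws \<subseteq> fibre E p" and x: "x \<in> fibre E p" by auto
  have m: "length us + length ws + 1 = m" using l by simp
  note slot = form_of_slot[OF G p m f]
  have "form_of U m G p (us @ (c *\<^sub>R x) # ws) = G (map ?s us @ (\<lambda>q. c *\<^sub>R ?s x q) # map ?s ws) p"
    by (rule slot) (use section_through[OF x] Sec_scale[OF smooth_on_const] in auto)
  also have "\<dots> = c * G (map ?s us @ ?s x # map ?s ws) p"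
    by (rule tensorialD(3)[OF G])
      (use sections_through(1)[OF f(1)] sections_through(1)[OF f(2)] section_through[OF x] m p in simp_all)
  finally show "form_of U m G p (us @ (c *\<^sub>R x) # ws) = c * form_of U m G p (us @ x # ws)"
    using slot[OF section_through[OF x]] by simp
next
  fix vs :: "'v list"
  assume "\<not> (int (length vs) = int m \<and> set vs \<subseteq> fibre E p)"
  then show "form_of U m G p vs = 0" by (auto simp: form_of_def)
next
  fix vs :: "'v list"
  assume "\<not> distinct vs"
  then obtain us x xs ws where vs: "vs = us @ [x] @ xs @ [x] @ ws" using not_distinct_decomp by blast
  show "form_of U m G p vs = 0"
  proof (cases "length vs = m \<and> set vs \<subseteq> fibre E p")
    case True
    let ?s = "section_through p"
    have "G (map ?s us @ ?s x # map ?s xs @ ?s x # map ?s ws) p = 0"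
      by (rule tensorial_repeat[OF G p]) (use True vs section_through in auto)
    then show ?thesis by (simp add: form_of_def vs)
  next
    case False
    then show ?thesis by (auto simp: form_of_def)
  qed
qed

lemma form_of_Forms:
  assumes U: "open U" and G: "tensorial U m G"
  shows "form_of U m G \<in> Forms E U (int m)"
proof (rule FormsI)
  fix V e I assume V: "(V, e) \<in> frames E" and I: "I \<in> increasing_lists rk (int m)"
  show "smooth_on (U \<inter> V) (\<lambda>p. form_of U m G p (map (\<lambda>i. e i p) I))"
  proof (rule smooth_on_local)
    fix p assume p: "p \<in> U \<inter> V"
    then have "p \<in> V" by simp
    obtain Y N where Y: "\<forall>i<rk. Y i \<in> Sec E" "open N" "p \<in> N" "N \<subseteq> V" "\<forall>i. \<forall>q\<in>N. Y i q = e i q"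
      by (rule local_frame_extension[OF V \<open>p \<in> V\<close>])
    have Ys: "set (map Y I) \<subseteq> Sec E" "length (map Y I) = m" using increasing_listsD[OF I] Y(1) by auto
    \<comment> \<open>\<open>form_of\<close> chooses new sections at every point \<open>q\<close>,
      which says nothing about smoothness. The fixed global sections \<open>Y\<close> have the same
      values on \<open>N\<close> and therefore give the same result.\<close>
    have "form_of U m G q (map (\<lambda>i. e i q) I) = G (map Y I) q" if "q \<in> U \<inter> N" for q
    proof -
      have "map (\<lambda>i. e i q) I = map (\<lambda>X. X q) (map Y I)" using Y(5) that by simp
      then show ?thesis using form_of_sections[OF G _ Ys, of q] that by (simp only: Int_iff)
    qed
    moreover have "smooth_on (U \<inter> N) (G (map Y I))"
      by (rule smooth_on_subset[OF tensorialD(1)[OF G Ys]]) simp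
    ultimately show "\<exists>W g. open W \<and> p \<in> W \<and> W \<subseteq> U \<inter> V \<and> smooth_on W g \<and>
        (\<forall>q\<in>W. form_of U m G q (map (\<lambda>i. e i q) I) = g q)"
      using U Y p by (intro exI[of _ "U \<inter> N"] exI[of _ "G (map Y I)"]) auto
  qed
qed (use form_of_alt_forms[OF G] in \<open>auto simp: form_of_def fun_eq_iff\<close>)

section \<open>Existence, uniqueness and locality of the differential\<close>

lemma zero_Forms: "(\<lambda>_ _. 0) \<in> Forms E U k"
  by (rule FormsI) (simp_all add: zero_alt_forms)

lemma Forms_eqI:
  assumes "\<eta> \<in> Forms E U k" "\<eta>' \<in> Forms E U k"
    "\<And>Xs p. set Xs \<subseteq> Sec E \<Longrightarrow> int (length Xs) = k \<Longrightarrow> p \<in> U \<Longrightarrow> \<eta> p (map (\<lambda>X. X p) Xs) = \<eta>' p (map (\<lambda>X. X p) Xs)"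
  shows "\<eta> = \<eta>'"
proof (intro ext)
  fix p vs
  show "\<eta> p vs = \<eta>' p vs"
  proof (cases "p \<in> U \<and> int (length vs) = k \<and> set vs \<subseteq> fibre E p")
    case True
    then have "set vs \<subseteq> fibre E p" by simp
    note s = sections_through[OF this]
    show ?thesis using assms(3)[OF s(1), of p] True unfolding s(2) by simp
  next
    case False
    have "\<theta> p vs = 0" if "\<theta> \<in> Forms E U k" for \<theta>
    proof (cases "p \<in> U")
      case True
      with False have "\<not> (int (length vs) = k \<and> set vs \<subseteq> fibre E p)" by blast
      then show ?thesis by (rule alt_forms_zero[OF Forms_alt[OF that] subspace_fibre])
    qed (simp add: FormsD(2)[OF that])
    from this[OF assms(1)] this[OF assms(2)] show ?thesis by simp
  qed
qed

lemma dR_ex1: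
  assumes \<omega>: "\<omega> \<in> Forms E U k" and U: "open U"
  shows "\<exists>!\<eta>. \<eta> \<in> Forms E U (k + 1) \<and>
     (\<forall>Xs. set Xs \<subseteq> Sec E \<longrightarrow> int (length Xs) = k + 1 \<longrightarrow>
        (\<forall>p\<in>U. \<eta> p (map (\<lambda>X. X p) Xs) = koszul E \<omega> Xs p))"
proof (rule ex_ex1I)
  show "\<exists>\<eta>. \<eta> \<in> Forms E U (k + 1) \<and> (\<forall>Xs. set Xs \<subseteq> Sec E \<longrightarrow> int (length Xs) = k + 1 \<longrightarrow>
        (\<forall>p\<in>U. \<eta> p (map (\<lambda>X. X p) Xs) = koszul E \<omega> Xs p))"
  proof (cases "k + 1 < 0")
    \<comment> \<open>No list has negative length, so that the condition is vacuous and the zero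
      form satisfies it.\<close>
    case True
    then show ?thesis using zero_Forms by (intro exI[of _ "\<lambda>_ _. 0"]) auto
  next
    case False
    then have m: "int (nat (k + 1)) = k + 1" by simp
    obtain G where G: "tensorial U (nat (k + 1)) G"
      "\<forall>Xs p. set Xs \<subseteq> Sec E \<longrightarrow> length Xs = nat (k + 1) \<longrightarrow> p \<in> U \<longrightarrow> koszul E \<omega> Xs p = G Xs p"
      by (rule tensorial_koszul[OF \<omega> U m])
    show ?thesis
      using form_of_Forms[OF U G(1)] form_of_sections[OF G(1)] G(2) m
      by (intro exI[of _ "form_of U (nat (k + 1)) G"]) auto
  qed
qed (rule Forms_eqI[of _ U "k + 1"]; simp)

lemma dR_Forms:
  assumes "\<omega> \<in> Forms E U k" "open U"
  shows "dR E U k \<omega> \<in> Forms E U (k + 1)"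
  using theI'[OF dR_ex1[OF assms]] unfolding dR_def by (rule conjunct1)

lemma dR_koszul:
  assumes "\<omega> \<in> Forms E U k" "open U" "set Xs \<subseteq> Sec E" "int (length Xs) = k + 1" "p \<in> U"
  shows "dR E U k \<omega> p (map (\<lambda>X. X p) Xs) = koszul E \<omega> Xs p"
  using theI'[OF dR_ex1[OF assms(1,2)], THEN conjunct2] assms(3-5) unfolding dR_def by blast

text \<open>The anchor depends on germs only and the bracket part on the value at \<open>p\<close>.
  The constant \<open>c\<close> is present for the sign between two representatives of an odd volume
  form and for global scaling in \<open>dR_scale\<close>.\<close>

lemma dR_local:
  assumes \<omega>: "\<omega> \<in> Forms E U k" "open U" and \<eta>: "\<eta> \<in> Forms E U' k" "open U'"
    and W: "open W" "W \<subseteq> U" "W \<subseteq> U'" "p \<in> W" and eq: "\<And>q. q \<in> W \<Longrightarrow> \<omega> q = (\<lambda>vs. c * \<eta> q vs)"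
  shows "dR E U k \<omega> p = (\<lambda>vs. c * dR E U' k \<eta> p vs)"
proof
  fix vs
  have p: "p \<in> U" "p \<in> U'" using W by auto
  show "dR E U k \<omega> p vs = c * dR E U' k \<eta> p vs"
  proof (cases "int (length vs) = k + 1 \<and> set vs \<subseteq> fibre E p")
    case True
    then have "set vs \<subseteq> fibre E p" by simp
    note s = sections_through[OF this]
    define Xs where "Xs = map (section_through p) vs"
    have Xs: "set Xs \<subseteq> Sec E" "int (length Xs) = k + 1" "map (\<lambda>X. X p) Xs = vs" using s True by (auto simp: Xs_def)
    have anchor: "anchor E p v (\<lambda>q. \<omega> q (map (\<lambda>X. X q) Ys)) = c * anchor E p v (\<lambda>q. \<eta> q (map (\<lambda>X. X q) Ys))"
      if "v \<in> fibre E p" "set Ys \<subseteq> Sec E" for v Ys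
    proof -
      have sm: "smooth_on W (\<lambda>q. \<omega> q (map (\<lambda>X. X q) Ys))" "smooth_on W (\<lambda>q. \<eta> q (map (\<lambda>X. X q) Ys))"
        using Forms_Sec_smooth[OF \<omega> that(2)] Forms_Sec_smooth[OF \<eta> that(2)] W smooth_on_subset by blast+
      have "anchor E p v (\<lambda>q. \<omega> q (map (\<lambda>X. X q) Ys)) = anchor E p v (\<lambda>q. c * \<eta> q (map (\<lambda>X. X q) Ys))"
        by (rule anchor_cong[OF W(1,4) that(1) sm(1)]) (simp add: eq)
      also have "\<dots> = c * anchor E p v (\<lambda>q. \<eta> q (map (\<lambda>X. X q) Ys))"
        by (rule anchor_scale_fun[OF W(1,4) that(1) sm(2)])
      finally show ?thesis .
    qed
    have "anchor E p ((Xs ! i) p) (\<lambda>q. \<omega> q (map (\<lambda>X. X q) (remove_nth i Xs))) =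
        c * anchor E p ((Xs ! i) p) (\<lambda>q. \<eta> q (map (\<lambda>X. X q) (remove_nth i Xs)))" if "i < length Xs" for i
    proof (rule anchor)
      show "(Xs ! i) p \<in> fibre E p" using that Xs(1) nth_mem[OF that] Sec_fibre by blast
      show "set (remove_nth i Xs) \<subseteq> Sec E" using set_remove_nth[of i Xs] Xs(1) by blast
    qed
    then have "koszul E \<omega> Xs p = c * koszul E \<eta> Xs p"
      using W(4) by (simp add: koszul_def eq sum_distrib_left algebra_simps)
    then show ?thesis
      using dR_koszul[OF \<omega> Xs(1,2) p(1)] dR_koszul[OF \<eta> Xs(1,2) p(2)] Xs(3) by simp
  next
    case False
    then show ?thesis
      using alt_forms_zero[OF Forms_alt[OF dR_Forms[OF \<omega>]] subspace_fibre, of vs p]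
        alt_forms_zero[OF Forms_alt[OF dR_Forms[OF \<eta>]] subspace_fibre, of vs p] by simp
  qed
qed

end

section \<open>Contraction with a volume form on a single fibre\<close>

context framed_space
begin

lemma ext_power_frame_comb:
  assumes "a \<in> ext_power V k"
  obtains c where "a = frame_comb V e n k c"
proof -
  obtain N b vs where b: "\<forall>j<N. int (length (vs j)) = k \<and> set (vs j) \<subseteq> V"
    "a = (\<lambda>\<omega>. \<Sum>j<(N::nat). b j * wedge V (vs j) \<omega>)"
    using assms unfolding ext_power_def mem_Collect_eq by (elim exE conjE)
  have "\<exists>c. \<forall>\<omega>\<in>alt_forms V k. \<omega> (vs j) = (\<Sum>I\<in>increasing_lists n k. c I * \<omega> (map e I))" if "j < N" for j
    using frame_expansion_forms[of "vs j" "[]" k] b(1) that by simp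
  then obtain c where c: "\<forall>j<N. \<forall>\<omega>\<in>alt_forms V k. \<omega> (vs j) = (\<Sum>I\<in>increasing_lists n k. c j I * \<omega> (map e I))"
    by metis
  have "a \<omega> = frame_comb V e n k (\<lambda>I. \<Sum>j<N. b j * c j I) \<omega>" for \<omega>
  proof (cases "\<omega> \<in> alt_forms V k")
    case True
    have w: "wedge V ws \<omega> = \<omega> ws" if "int (length ws) = k" for ws using True that by (simp add: wedge_def)
    have "a \<omega> = (\<Sum>j<N. \<Sum>I\<in>increasing_lists n k. b j * (c j I * \<omega> (map e I)))"
      unfolding b(2)
      by (intro sum.cong[OF refl]) (use b(1) w c[rule_format, OF _ True] in \<open>simp add: sum_distrib_left\<close>)
    also have "\<dots> = (\<Sum>I\<in>increasing_lists n k. \<Sum>j<N. b j * (c j I * \<omega> (map e I)))" by (rule sum.swap)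
    also have "\<dots> = frame_comb V e n k (\<lambda>I. \<Sum>j<N. b j * c j I) \<omega>"
      unfolding frame_comb_def
      by (rule sum.cong[OF refl]) (simp add: w increasing_listsD(4) sum_distrib_right mult.assoc)
    finally show ?thesis .
  next
    case False
    have w: "wedge V ws \<omega> = 0" if "int (length ws) = k" for ws using False that by (simp add: wedge_def)
    have "(\<Sum>j<N. b j * wedge V (vs j) \<omega>) = 0" by (rule sum.neutral) (use b(1) w in auto)
    moreover have "frame_comb V e n k d \<omega> = 0" for d
      unfolding frame_comb_def by (rule sum.neutral) (auto simp: w increasing_listsD(4))
    ultimately show ?thesis unfolding b(2) by simp
  qed
  then show ?thesis by (intro that[of "\<lambda>I. \<Sum>j<N. b j * c j I"] ext)
qed

lemma contract_inj:
  assumes "a \<in> ext_power V k" "b \<in> ext_power V k" and \<mu>: "\<mu> \<in> alt_forms V (int n)" "\<mu> \<noteq> (\<lambda>_. 0)"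
    and eq: "contract a \<mu> = contract b \<mu>"
  shows "a = b"
proof -
  obtain c where c: "a = frame_comb V e n k c" by (rule ext_power_frame_comb[OF assms(1)])
  obtain d where d: "b = frame_comb V e n k d" by (rule ext_power_frame_comb[OF assms(2)])
  have "c I = d I" if "I \<in> increasing_lists n k" for I
    using volume_coeff_contract[OF \<mu> that, of c] volume_coeff_contract[OF \<mu> that, of d] eq c d by simp
  then show ?thesis unfolding c d by (rule frame_comb_cong)
qed

lemma contract_scale_form:
  assumes "a \<in> ext_power V k" and \<mu>: "\<mu> \<in> alt_forms V (int n)"
  shows "contract a (\<lambda>vs. h * \<mu> vs) = (\<lambda>ws. h * contract a \<mu> ws)"
proof -
  obtain c where c: "a = frame_comb V e n k c" by (rule ext_power_frame_comb[OF assms(1)])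
  show ?thesis
    unfolding c contract_frame_comb[OF \<mu> subspace] contract_frame_comb[OF alt_forms_scaled[OF \<mu>] subspace]
    by (simp add: sum_distrib_left algebra_simps)
qed

lemma contract_alt:
  assumes "a \<in> ext_power V k" and \<mu>: "\<mu> \<in> alt_forms V (int n)"
  shows "contract a \<mu> \<in> alt_forms V (int n - k)"
proof -
  obtain c where c: "a = frame_comb V e n k c" by (rule ext_power_frame_comb[OF assms(1)])
  show ?thesis unfolding c by (rule contract_frame_comb_alt[OF \<mu>])
qed

lemma volume_ratio:
  assumes "\<mu> \<in> alt_forms V (int n)" "\<mu> \<noteq> (\<lambda>_. 0)" "\<eta> \<in> alt_forms V (int n)"
  shows "\<eta> = (\<lambda>vs. \<eta> (map e [0..<n]) / \<mu> (map e [0..<n]) * \<mu> vs)"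
  by (rule frame_eqI[OF assms(3) alt_forms_scaled[OF assms(1)]])
    (use volume_frame_nonzero[OF assms(1,2)] increasing_lists_full in auto)

end

section \<open>Contraction with a volume form\<close>

lemma contract_scale_multivector: "contract (\<lambda>x. h * a x) \<mu> = (\<lambda>ws. h * contract a \<mu> ws)"
  by (simp add: contract_def)

context manifold
begin

text \<open>By continuity \<open>f\<close> keeps the sign that it has at \<open>p\<close> on a
  neighbourhood, and there the absolute value is a constant multiple of \<open>f\<close>.\<close>

lemma smooth_on_abs:
  assumes "open U" "smooth_on U f" "\<And>q. q \<in> U \<Longrightarrow> f q \<noteq> 0"
  shows "smooth_on U (\<lambda>q. \<bar>f q\<bar>)"
proof (rule smooth_on_local)
  fix p assume p: "p \<in> U"
  define s where "s = sgn (f p)"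
  define W where "W = (\<lambda>q. s * f q) -` {0<..} \<inter> U"
  have "continuous_on U (\<lambda>q. s * f q)"
    by (intro continuous_intros smooth_on_imp_continuous_on assms)
  then have "open W"
    unfolding W_def using iffD1[OF continuous_on_open_vimage[OF assms(1)]] open_greaterThan by blast
  moreover have "p \<in> W" using p assms(3)[OF p] by (simp add: W_def s_def sgn_mult_self_eq abs_sgn[symmetric] mult.commute)
  moreover have "\<bar>f q\<bar> = s * f q" if "q \<in> W" for q
    using that assms(3)[OF p] by (auto simp: W_def s_def sgn_if split: if_splits)
  moreover have "smooth_on W (\<lambda>q. s * f q)"
    using smooth_on_subset[OF assms(2), of W] by (intro smooth_on_mult smooth_on_const) (auto simp: W_def)
  ultimately show "\<exists>W g. open W \<and> p \<in> W \<and> W \<subseteq> U \<and> smooth_on W g \<and> (\<forall>q\<in>W. \<bar>f q\<bar> = g q)"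
    by (intro exI[of _ W] exI[of _ "\<lambda>q. s * f q"]) (auto simp: W_def)
qed

end

context vbundle
begin

section \<open>Multivector fields and smoothness through contraction\<close>

lemma Multivectors_ext_power: "a \<in> Multivectors E k \<Longrightarrow> a p \<in> ext_power (fibre E p) k"
  by (simp add: Multivectors_def)

lemma Multivectors_frame:
  assumes "a \<in> Multivectors E k" "(V, e) \<in> frames E"
  obtains c where "\<forall>I\<in>increasing_lists rk k. smooth_on V (c I)"
    "\<forall>p\<in>V. a p = frame_comb (fibre E p) (\<lambda>i. e i p) rk k (\<lambda>I. c I p)"
proof -
  have "\<forall>(V, e)\<in>frames E. \<exists>c.
        (\<forall>I\<in>increasing_lists rk k. smooth_on V (c I)) \<and>
        (\<forall>p\<in>V. a p = (\<lambda>\<omega>. \<Sum>I\<in>increasing_lists rk k. c I p * wedge (fibre E p) (map (\<lambda>i. e i p) I) \<omega>))"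
    using assms(1) unfolding Multivectors_def mem_Collect_eq by (elim conjE)
  from bspec[OF this assms(2)] obtain c where
    "(\<forall>I\<in>increasing_lists rk k. smooth_on V (c I)) \<and>
        (\<forall>p\<in>V. a p = (\<lambda>\<omega>. \<Sum>I\<in>increasing_lists rk k. c I p * wedge (fibre E p) (map (\<lambda>i. e i p) I) \<omega>))"
    by auto
  then show ?thesis by (intro that[of c]) (simp_all add: frame_comb_def)
qed

lemma MultivectorsI:
  assumes "\<And>V e. (V, e) \<in> frames E \<Longrightarrow> \<exists>c. (\<forall>I\<in>increasing_lists rk k. smooth_on V (c I)) \<and>
    (\<forall>p\<in>V. a p = frame_comb (fibre E p) (\<lambda>i. e i p) rk k (\<lambda>I. c I p))"
  shows "a \<in> Multivectors E k"
proof -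
  have "a p \<in> ext_power (fibre E p) k" for p
  proof -
    obtain V e where V: "(V, e) \<in> frames E" "p \<in> V" by (rule frame_cover)
    from assms[OF V(1)] V(2) obtain c where "a p = frame_comb (fibre E p) (\<lambda>i. e i p) rk k (\<lambda>I. c I p)" by blast
    then show ?thesis using framed_space.frame_comb_ext_power[OF frame_space[OF V]] by simp
  qed
  then show ?thesis using assms unfolding Multivectors_def frame_comb_def by auto
qed

lemma Multivectors_lincomb:
  assumes "smooth_on UNIV f" "a \<in> Multivectors E k" "b \<in> Multivectors E k"
  shows "(\<lambda>p x. f p * a p x + b p x) \<in> Multivectors E k"
proof (rule MultivectorsI)
  fix V e assume V: "(V, e) \<in> frames E"
  obtain c where c: "\<forall>I\<in>increasing_lists rk k. smooth_on V (c I)"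
    "\<forall>p\<in>V. a p = frame_comb (fibre E p) (\<lambda>i. e i p) rk k (\<lambda>I. c I p)" by (rule Multivectors_frame[OF assms(2) V])
  obtain d where d: "\<forall>I\<in>increasing_lists rk k. smooth_on V (d I)"
    "\<forall>p\<in>V. b p = frame_comb (fibre E p) (\<lambda>i. e i p) rk k (\<lambda>I. d I p)" by (rule Multivectors_frame[OF assms(3) V])
  have "smooth_on V (\<lambda>p. f p * c I p + d I p)" if "I \<in> increasing_lists rk k" for I
    using c(1) d(1) that by (intro smooth_on_add smooth_on_mult smooth_on_subset[OF assms(1)]) auto
  moreover have "(\<lambda>x. f p * a p x + b p x) = frame_comb (fibre E p) (\<lambda>i. e i p) rk k (\<lambda>I. f p * c I p + d I p)" if "p \<in> V" for p
    using c(2) d(2) that by (simp add: frame_comb_def sum_distrib_left sum.distrib algebra_simps)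
  ultimately show "\<exists>c. (\<forall>I\<in>increasing_lists rk k. smooth_on V (c I)) \<and>
      (\<forall>p\<in>V. (\<lambda>x. f p * a p x + b p x) = frame_comb (fibre E p) (\<lambda>i. e i p) rk k (\<lambda>I. c I p))"
    by (intro exI[of _ "\<lambda>I p. f p * c I p + d I p"]) simp
qed

lemma Multivectors_zero: "(\<lambda>_ _. 0) \<in> Multivectors E k"
  by (rule MultivectorsI) (auto simp: frame_comb_def intro!: exI[of _ "\<lambda>_ _. 0"])

lemma Multivectors_scale:
  "smooth_on UNIV f \<Longrightarrow> a \<in> Multivectors E k \<Longrightarrow> (\<lambda>p x. f p * a p x) \<in> Multivectors E k"
  using Multivectors_lincomb[of f a k "\<lambda>_ _. 0"] Multivectors_zero by simp

lemma Forms_lincomb: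
  assumes "smooth_on UNIV f" "\<omega> \<in> Forms E U k" "\<eta> \<in> Forms E U k"
  shows "(\<lambda>p x. f p * \<omega> p x + \<eta> p x) \<in> Forms E U k"
proof (rule FormsI)
  show "(\<lambda>x. f p * \<omega> p x + \<eta> p x) \<in> alt_forms (fibre E p) k" for p
    using alt_forms_lincomb[OF Forms_alt[OF assms(2), of p] Forms_alt[OF assms(3), of p], where c = "f p" and d = 1] by simp
  show "(\<lambda>x. f p * \<omega> p x + \<eta> p x) = (\<lambda>_. 0)" if "p \<notin> U" for p
    using FormsD(2)[OF assms(2) that] FormsD(2)[OF assms(3) that] by simp
  fix V e I assume "(V, e) \<in> frames E" "I \<in> increasing_lists rk k"
  then show "smooth_on (U \<inter> V) (\<lambda>p. f p * \<omega> p (map (\<lambda>i. e i p) I) + \<eta> p (map (\<lambda>i. e i p) I))"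
    using assms by (intro smooth_on_add smooth_on_mult FormsD(3) smooth_on_subset[OF assms(1)]) auto
qed

lemma Forms_scale:
  assumes "smooth_on UNIV f" "\<omega> \<in> Forms E U k"
  shows "(\<lambda>p x. f p * \<omega> p x) \<in> Forms E U k"
proof -
  have "(\<lambda>_ _. 0) \<in> Forms E U k" by (rule FormsI) (simp_all add: zero_alt_forms)
  from Forms_lincomb[OF assms this] show ?thesis by simp
qed

lemma contract_Forms:
  assumes a: "a \<in> Multivectors E k" and \<mu>: "\<mu> \<in> Forms E U (int rk)" and U: "open U"
  shows "(\<lambda>q. contract (a q) (\<mu> q)) \<in> Forms E U (int rk - k)"
proof (rule FormsI)
  fix p
  obtain V e where V: "(V, e) \<in> frames E" "p \<in> V" by (rule frame_cover)
  interpret framed_space "fibre E p" "\<lambda>i. e i p" rk by (rule frame_space[OF V])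
  show "contract (a p) (\<mu> p) \<in> alt_forms (fibre E p) (int rk - k)"
    by (rule contract_alt[OF Multivectors_ext_power[OF a] Forms_alt[OF \<mu>]])
  show "contract (a p) (\<mu> p) = (\<lambda>_. 0)" if "p \<notin> U"
    \<comment> \<open>Off \<open>U\<close> the form is 0, that is, 0 times itself, and the factor 0
      comes out of the contraction.\<close>
    using contract_scale_form[OF Multivectors_ext_power[OF a] Forms_alt[OF \<mu>], of 0] FormsD(2)[OF \<mu> that]
    by simp
next
  fix V e J assume V: "(V, e) \<in> frames E" and J: "J \<in> increasing_lists rk (int rk - k)"
  obtain c where c: "\<forall>I\<in>increasing_lists rk k. smooth_on V (c I)"
    "\<forall>p\<in>V. a p = frame_comb (fibre E p) (\<lambda>i. e i p) rk k (\<lambda>I. c I p)" by (rule Multivectors_frame[OF a V])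
  have o: "open (U \<inter> V)" using U frame_open[OF V] by blast
  have "smooth_on (U \<inter> V) (\<lambda>p. \<Sum>I\<in>increasing_lists rk k. c I p * \<mu> p (map (\<lambda>i. e i p) (I @ J)))"
  proof (intro smooth_on_sum smooth_on_mult)
    fix I assume I: "I \<in> increasing_lists rk k"
    show "smooth_on (U \<inter> V) (c I)" using c(1) I by (auto intro: smooth_on_subset)
    show "smooth_on (U \<inter> V) (\<lambda>p. \<mu> p (map (\<lambda>i. e i p) (I @ J)))"
      by (rule Forms_frame_smooth[OF \<mu> U V]) (use increasing_listsD(3)[OF I] increasing_listsD(3)[OF J] in auto)
  qed
  then show "smooth_on (U \<inter> V) (\<lambda>p. contract (a p) (\<mu> p) (map (\<lambda>i. e i p) J))"
    by (rule smooth_on_cong[OF o, rotated]) (use c(2) in \<open>simp add: contract_frame_comb[OF Forms_alt[OF \<mu>] subspace_fibre]\<close>)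
qed

text \<open>Smoothness is tested after contraction: the components of \<open>b\<close> are, up to
  sign, components of the smooth form \<open>\<theta>\<close> divided by the nowhere vanishing
  component of \<open>\<mu>\<close>. Both forms may change from point to point, as local
  representatives do.\<close>

lemma Multivectors_localI:
  assumes ext: "\<And>p. b p \<in> ext_power (fibre E p) k"
    and loc: "\<And>p. \<exists>U \<mu> \<theta>. open U \<and> p \<in> U \<and> \<mu> \<in> Forms E U (int rk) \<and> \<theta> \<in> Forms E U (int rk - k) \<and>
      (\<forall>q\<in>U. \<mu> q \<noteq> (\<lambda>_. 0) \<and> contract (b q) (\<mu> q) = \<theta> q)"
  shows "b \<in> Multivectors E k"
proof (rule MultivectorsI)
  fix V e assume V: "(V, e) \<in> frames E"
  have "\<exists>c. b p = frame_comb (fibre E p) (\<lambda>i. e i p) rk k c" if "p \<in> V" for p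
    using framed_space.ext_power_frame_comb[OF frame_space[OF V that] ext[of p]] by metis
  then obtain c where c: "\<forall>p\<in>V. b p = frame_comb (fibre E p) (\<lambda>i. e i p) rk k (c p)" by metis
  have "smooth_on V (\<lambda>p. c p I)" if I: "I \<in> increasing_lists rk k" for I
  proof (rule smooth_on_local)
    fix p assume p: "p \<in> V"
    obtain U \<mu> \<theta> where U: "open U" "p \<in> U" "\<mu> \<in> Forms E U (int rk)" "\<theta> \<in> Forms E U (int rk - k)"
      "\<forall>q\<in>U. \<mu> q \<noteq> (\<lambda>_. 0) \<and> contract (b q) (\<mu> q) = \<theta> q" using loc[of p] by (elim exE conjE)
    \<comment> \<open>This is \<open>volume_coeff\<close> in the basis at \<open>q\<close>, written
      out so that its smoothness in \<open>q\<close> is visible.\<close>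
    let ?g = "\<lambda>q. sort_sign (I @ compl_list rk I) * \<theta> q (map (\<lambda>i. e i q) (compl_list rk I)) /
        \<mu> q (map (\<lambda>i. e i q) [0..<rk])"
    have "smooth_on (U \<inter> V) ?g"
    proof (intro smooth_on_divide smooth_on_mult smooth_on_const)
      show "smooth_on (U \<inter> V) (\<lambda>q. \<theta> q (map (\<lambda>i. e i q) (compl_list rk I)))"
        by (rule FormsD(3)[OF U(4) V compl_list_increasing[OF I]])
      show "smooth_on (U \<inter> V) (\<lambda>q. \<mu> q (map (\<lambda>i. e i q) [0..<rk]))"
        by (rule FormsD(3)[OF U(3) V upt_increasing])
      show "\<mu> q (map (\<lambda>i. e i q) [0..<rk]) \<noteq> 0" if "q \<in> U \<inter> V" for q
        using framed_space.volume_frame_nonzero[OF frame_space[OF V] Forms_alt[OF U(3)]] U(5) that by auto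
    qed
    moreover have "c q I = ?g q" if q: "q \<in> U \<inter> V" for q
    proof -
      interpret framed_space "fibre E q" "\<lambda>i. e i q" rk by (rule frame_space[OF V]) (use q in simp)
      have "volume_coeff (\<mu> q) (contract (b q) (\<mu> q)) I = c q I"
        using volume_coeff_contract[OF Forms_alt[OF U(3)] _ I] c U(5) q by simp
      then show ?thesis using U(5) q by (simp add: volume_coeff_def)
    qed
    ultimately show "\<exists>W g. open W \<and> p \<in> W \<and> W \<subseteq> V \<and> smooth_on W g \<and> (\<forall>q\<in>W. c q I = g q)"
      using U(1,2) frame_open[OF V] p by (intro exI[of _ "U \<inter> V"] exI[of _ ?g]) auto
  qed
  with c show "\<exists>c. (\<forall>I\<in>increasing_lists rk k. smooth_on V (c I)) \<and>
      (\<forall>p\<in>V. b p = frame_comb (fibre E p) (\<lambda>i. e i p) rk k (\<lambda>I. c I p))"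
    by (intro exI[of _ "\<lambda>I p. c p I"]) simp
qed

lemma contract_inj_fibre:
  assumes "a \<in> ext_power (fibre E p) k" "b \<in> ext_power (fibre E p) k"
    "\<mu> \<in> alt_forms (fibre E p) (int rk)" "\<mu> \<noteq> (\<lambda>_. 0)" "contract a \<mu> = contract b \<mu>"
  shows "a = b"
proof -
  obtain V e where V: "(V, e) \<in> frames E" "p \<in> V" by (rule frame_cover)
  show ?thesis by (rule framed_space.contract_inj[OF frame_space[OF V] assms])
qed

lemma contract_surj_fibre:
  assumes "\<mu> \<in> alt_forms (fibre E p) (int rk)" "\<mu> \<noteq> (\<lambda>_. 0)" "\<theta> \<in> alt_forms (fibre E p) (int rk - k)"
  obtains a where "a \<in> ext_power (fibre E p) k" "contract a \<mu> = \<theta>"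
proof -
  obtain V e where V: "(V, e) \<in> frames E" "p \<in> V" by (rule frame_cover)
  interpret framed_space "fibre E p" "\<lambda>i. e i p" rk by (rule frame_space[OF V])
  show ?thesis by (rule that[OF frame_comb_ext_power contract_volume_coeff[OF assms]])
qed

lemma contract_scale_form_fibre:
  assumes "a \<in> ext_power (fibre E p) k" "\<mu> \<in> alt_forms (fibre E p) (int rk)"
  shows "contract a (\<lambda>vs. h * \<mu> vs) = (\<lambda>ws. h * contract a \<mu> ws)"
proof -
  obtain V e where V: "(V, e) \<in> frames E" "p \<in> V" by (rule frame_cover)
  show ?thesis by (rule framed_space.contract_scale_form[OF frame_space[OF V] assms])
qed

section \<open>Local representatives of an odd volume form\<close>

lemma local_representativeD:
  assumes "local_representative E \<nu> U \<mu>"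
  shows "open U" "\<mu> \<in> Forms E U (int rk)" "p \<in> U \<Longrightarrow> \<mu> p \<noteq> (\<lambda>_. 0)"
    "p \<in> U \<Longrightarrow> \<nu> p = {\<mu> p, (\<lambda>vs. - \<mu> p vs)}"
  using assms unfolding local_representative_def by auto

text \<open>At each point the two representatives agree up to sign. The sign is locally constant by
  continuity, which puts the pair within reach of \<open>dR_local\<close>.\<close>

lemma local_representative_sign:
  assumes 1: "local_representative E \<nu> U \<mu>" and 2: "local_representative E \<nu> U' \<mu>'" and p: "p \<in> U" "p \<in> U'"
  obtains W s where "open W" "p \<in> W" "W \<subseteq> U" "W \<subseteq> U'" "s \<noteq> 0" "\<forall>q\<in>W. \<mu>' q = (\<lambda>vs. s * \<mu> q vs)"
proof -
  note D1 = local_representativeD[OF 1] and D2 = local_representativeD[OF 2]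
  obtain V e where V: "(V, e) \<in> frames E" "p \<in> V" by (rule frame_cover)
  define Q where "Q = U \<inter> U' \<inter> V"
  have Q: "open Q" "p \<in> Q" using D1(1) D2(1) frame_open[OF V(1)] p V(2) by (auto simp: Q_def)
  define f where "f q = \<mu> q (map (\<lambda>i. e i q) [0..<rk])" for q
  define g where "g q = \<mu>' q (map (\<lambda>i. e i q) [0..<rk])" for q
  have "continuous_on Q f" "continuous_on Q g"
    using smooth_on_subset[OF FormsD(3)[OF D1(2) V(1) upt_increasing], of Q]
      smooth_on_subset[OF FormsD(3)[OF D2(2) V(1) upt_increasing], of Q]
      smooth_on_imp_continuous_on[OF Q(1)] unfolding f_def g_def by (auto simp: Q_def)
  have sgn: "\<mu>' q = \<mu> q \<or> \<mu>' q = (\<lambda>vs. - \<mu> q vs)" if "q \<in> Q" for q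
    using D1(4)[of q] D2(4)[of q] that unfolding Q_def by blast
  then obtain s :: real where s: "s = 1 \<or> s = -1" "\<mu>' p = (\<lambda>vs. s * \<mu> p vs)"
    using Q(2) by (metis mult_1 mult_minus1)
  have f0: "f q \<noteq> 0" if "q \<in> Q" for q
    using framed_space.volume_frame_nonzero[OF frame_space[OF V(1)] Forms_alt[OF D1(2)]] D1(3) that
    unfolding f_def Q_def by auto
  \<comment> \<open>With \<open>s\<close> the sign at \<open>p\<close>, positivity of this product
    is an open condition that holds at \<open>p\<close> and singles out the points with the same
    sign.\<close>
  define W where "W = (\<lambda>q. s * g q * f q) -` {0<..} \<inter> Q"
  have "continuous_on Q (\<lambda>q. s * g q * f q)"
    by (intro continuous_intros) fact+
  then have "open W"
    unfolding W_def using iffD1[OF continuous_on_open_vimage[OF Q(1)]] open_greaterThan by blast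
  moreover have "p \<in> W"
  proof -
    have "g p = s * f p" by (simp add: f_def g_def s(2))
    then have "s * g p * f p = (s * f p) * (s * f p)" by simp
    moreover have "s * f p \<noteq> 0" using f0[OF Q(2)] s(1) by auto
    ultimately have "s * g p * f p > 0" using not_real_square_gt_zero[of "s * f p"] by metis
    then show ?thesis using Q(2) by (simp add: W_def)
  qed
  moreover have "\<mu>' q = (\<lambda>vs. s * \<mu> q vs)" if "q \<in> W" for q
  proof -
    have q: "q \<in> Q" "s * g q * f q > 0" using that by (auto simp: W_def)
    have ff: "f q * f q > 0" using f0[OF q(1)] not_real_square_gt_zero[of "f q"] by metis
    show ?thesis using sgn[OF q(1)]
    proof
      assume m: "\<mu>' q = \<mu> q"
      then have "s * (f q * f q) > 0" using q(2) by (simp add: f_def g_def)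
      then have "s = 1" using s(1) ff by auto
      with m show ?thesis by simp
    next
      assume m: "\<mu>' q = (\<lambda>vs. - \<mu> q vs)"
      then have "s * (f q * f q) < 0" using q(2) by (simp add: f_def g_def)
      then have "s = -1" using s(1) ff by auto
      with m show ?thesis by simp
    qed
  qed
  ultimately show ?thesis using s(1) by (intro that[of W s]) (auto simp: W_def Q_def)
qed

end

section \<open>Homology operators\<close>

context algebroid
begin

definition is_boundary ::
  "('m \<Rightarrow> 'v form set) \<Rightarrow> int \<Rightarrow> ('m \<Rightarrow> 'v multivector) \<Rightarrow> ('m \<Rightarrow> 'v multivector) \<Rightarrow> bool" where
  "is_boundary \<nu> k a b \<longleftrightarrow> b \<in> Multivectors E (k - 1) \<and>
     (\<forall>U \<mu>. local_representative E \<nu> U \<mu> \<longrightarrow>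
        (\<forall>p\<in>U. contract (b p) (\<mu> p) =
           (\<lambda>ws. (-1) powi k * dR E U (int rk - k) (\<lambda>q. contract (a q) (\<mu> q)) p ws)))"

lemma homology_op_is_boundary: "homology_op E \<nu> k a = (THE b. is_boundary \<nu> k a b)"
  by (simp add: homology_op_def is_boundary_def)

context
  fixes \<nu> :: "'m \<Rightarrow> 'v form set"
  assumes \<nu>: "\<nu> \<in> odd_volume_forms E"
begin

lemma odd_volume_form_representative:
  obtains U \<mu> where "p \<in> U" "local_representative E \<nu> U \<mu>"
  using \<nu> unfolding odd_volume_forms_def by blast

text \<open>One representative is chosen for each point and the contraction is inverted in the fibre
  there. For another representative a locally constant factor appears on both sides of the required
  equation, which therefore holds for all representatives. Uniqueness is injectivity of the
  contraction in each fibre.\<close>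

lemma homology_op_ex1:
  assumes a: "a \<in> Multivectors E k"
  shows "\<exists>!b. is_boundary \<nu> k a b"
proof (rule ex_ex1I)
  have "\<forall>p. \<exists>U \<mu>. p \<in> U \<and> local_representative E \<nu> U \<mu>"
    using \<nu> unfolding odd_volume_forms_def by blast
  then obtain UU mm where rep: "\<And>p. p \<in> UU p" "\<And>p. local_representative E \<nu> (UU p) (mm p)" by metis
  let ?d = "\<lambda>U \<mu>. dR E U (int rk - k) (\<lambda>q. contract (a q) (\<mu> q))"
  have d_Forms: "(\<lambda>p ws. (-1) powi k * ?d U \<mu> p ws) \<in> Forms E U (int rk - (k - 1))"
    if "local_representative E \<nu> U \<mu>" for U \<mu>
    using Forms_scale[OF smooth_on_const[of UNIV "(-1) powi k"] dR_Forms[OF contract_Forms[OF a]]]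
      local_representativeD(1,2)[OF that] by (simp add: algebra_simps)
  have "\<exists>b. b \<in> ext_power (fibre E p) (k - 1) \<and> contract b (mm p p) = (\<lambda>ws. (-1) powi k * ?d (UU p) (mm p) p ws)" for p
  proof -
    obtain c where "c \<in> ext_power (fibre E p) (k - 1)"
      "contract c (mm p p) = (\<lambda>ws. (-1) powi k * ?d (UU p) (mm p) p ws)"
      by (rule contract_surj_fibre[OF Forms_alt[OF local_representativeD(2)[OF rep(2)[of p]]]
        local_representativeD(3)[OF rep(2,1)] Forms_alt[OF d_Forms[OF rep(2)[of p]]]])
    then show ?thesis by (intro exI[of _ c] conjI)
  qed
  then obtain b where b: "\<And>p. b p \<in> ext_power (fibre E p) (k - 1)"
    "\<And>p. contract (b p) (mm p p) = (\<lambda>ws. (-1) powi k * ?d (UU p) (mm p) p ws)" by metis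
  have spec: "contract (b p) (\<mu> p) = (\<lambda>ws. (-1) powi k * ?d U \<mu> p ws)"
    if r: "local_representative E \<nu> U \<mu>" and p: "p \<in> U" for U \<mu> p
  proof -
    note D = local_representativeD[OF r] and D' = local_representativeD[OF rep(2)[of p]]
    obtain W s where W: "open W" "p \<in> W" "W \<subseteq> UU p" "W \<subseteq> U" "s \<noteq> 0" "\<forall>q\<in>W. \<mu> q = (\<lambda>vs. s * mm p q vs)"
      by (rule local_representative_sign[OF rep(2)[of p] r rep(1)[of p] p])
    have "?d U \<mu> p = (\<lambda>vs. s * ?d (UU p) (mm p) p vs)"
      by (rule dR_local[OF contract_Forms[OF a D(2,1)] D(1) contract_Forms[OF a D'(2,1)] D'(1) W(1,4,3,2)])
        (use W(6) contract_scale_form_fibre[OF Multivectors_ext_power[OF a] Forms_alt[OF D'(2)]] in simp)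
    moreover have "contract (b p) (\<mu> p) = (\<lambda>ws. s * contract (b p) (mm p p) ws)"
      using W(2,6) contract_scale_form_fibre[OF b(1) Forms_alt[OF D'(2)]] by simp
    ultimately show ?thesis by (simp add: b(2) algebra_simps)
  qed
  have "b \<in> Multivectors E (k - 1)"
  proof (rule Multivectors_localI[OF b(1)])
    fix p
    show "\<exists>U \<mu> \<theta>. open U \<and> p \<in> U \<and> \<mu> \<in> Forms E U (int rk) \<and> \<theta> \<in> Forms E U (int rk - (k - 1)) \<and>
        (\<forall>q\<in>U. \<mu> q \<noteq> (\<lambda>_. 0) \<and> contract (b q) (\<mu> q) = \<theta> q)"
      using rep(1)[of p] local_representativeD[OF rep(2)[of p]] d_Forms[OF rep(2)[of p]] spec[OF rep(2)[of p]]
      by (intro exI[of _ "UU p"] exI[of _ "mm p"] exI[of _ "\<lambda>q ws. (-1) powi k * ?d (UU p) (mm p) q ws"]) auto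
  qed
  with spec show "\<exists>b. is_boundary \<nu> k a b"
    unfolding is_boundary_def by (intro exI[of _ b]) simp
next
  fix b b'
  assume "is_boundary \<nu> k a b" "is_boundary \<nu> k a b'"
  note b = this(1)[unfolded is_boundary_def] and b' = this(2)[unfolded is_boundary_def]
  show "b = b'"
  proof
    fix p
    obtain U \<mu> where r: "p \<in> U" "local_representative E \<nu> U \<mu>" by (rule odd_volume_form_representative)
    note D = local_representativeD[OF r(2)]
    show "b p = b' p"
    proof (rule contract_inj_fibre[OF _ _ Forms_alt[OF D(2)] D(3)[OF r(1)]])
      show "b p \<in> ext_power (fibre E p) (k - 1)" "b' p \<in> ext_power (fibre E p) (k - 1)"
        using b b' Multivectors_ext_power by auto
      show "contract (b p) (\<mu> p) = contract (b' p) (\<mu> p)"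
        using conjunct2[OF b, rule_format, OF r(2,1)] conjunct2[OF b', rule_format, OF r(2,1)] by simp
    qed
  qed
qed

lemma homology_op_spec: "a \<in> Multivectors E k \<Longrightarrow> is_boundary \<nu> k a (homology_op E \<nu> k a)"
  unfolding homology_op_is_boundary by (rule theI'[OF homology_op_ex1])

lemma homology_op_Multivectors:
  "a \<in> Multivectors E k \<Longrightarrow> homology_op E \<nu> k a \<in> Multivectors E (k - 1)"
  using homology_op_spec by (simp add: is_boundary_def)

lemma contract_homology_op:
  assumes "a \<in> Multivectors E k" "local_representative E \<nu> U \<mu>" "p \<in> U"
  shows "contract (homology_op E \<nu> k a p) (\<mu> p) =
    (\<lambda>ws. (-1) powi k * dR E U (int rk - k) (\<lambda>q. contract (a q) (\<mu> q)) p ws)"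
  using homology_op_spec[OF assms(1)] assms(2,3) unfolding is_boundary_def by blast

lemma homology_op_eqI:
  assumes "a \<in> Multivectors E k" "b \<in> Multivectors E (k - 1)"
    "\<And>U \<mu> p. local_representative E \<nu> U \<mu> \<Longrightarrow> p \<in> U \<Longrightarrow> contract (b p) (\<mu> p) =
      (\<lambda>ws. (-1) powi k * dR E U (int rk - k) (\<lambda>q. contract (a q) (\<mu> q)) p ws)"
  shows "homology_op E \<nu> k a = b"
  unfolding homology_op_is_boundary
  by (rule the1_equality[OF homology_op_ex1[OF assms(1)]]) (use assms(2,3) in \<open>simp add: is_boundary_def\<close>)

end

section \<open>Change of the odd volume form\<close>

lemma odd_volume_forms_ratio:
  assumes \<nu>: "\<nu> \<in> odd_volume_forms E" and \<nu>': "\<nu>' \<in> odd_volume_forms E"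
  obtains h where "smooth_on UNIV h" "\<forall>p. h p > 0" "\<forall>p. \<nu>' p = (\<lambda>\<mu> vs. h p * \<mu> vs) ` \<nu> p"
proof -
  have "\<exists>c>0. \<nu>' p = (\<lambda>\<mu> vs. c * \<mu> vs) ` \<nu> p" for p
  proof -
    obtain U \<mu> where r: "p \<in> U" "local_representative E \<nu> U \<mu>" by (rule odd_volume_form_representative[OF \<nu>])
    obtain U' \<mu>' where r': "p \<in> U'" "local_representative E \<nu>' U' \<mu>'" by (rule odd_volume_form_representative[OF \<nu>'])
    note D = local_representativeD[OF r(2)] and D' = local_representativeD[OF r'(2)]
    obtain V e where V: "(V, e) \<in> frames E" "p \<in> V" by (rule frame_cover)
    have "\<exists>x. \<mu>' p = (\<lambda>vs. x * \<mu> p vs)"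
      by (rule exI) (rule framed_space.volume_ratio[OF frame_space[OF V] Forms_alt[OF D(2)] D(3)[OF r(1)] Forms_alt[OF D'(2)]])
    then obtain x where x: "\<mu>' p = (\<lambda>vs. x * \<mu> p vs)" by (rule exE)
    have x0: "x \<noteq> 0" using D'(3)[OF r'(1)] x by auto
    \<comment> \<open>The factor \<open>x\<close> between representatives depends on their signs,
      but \<open>x\<close> and its absolute value give the same unordered pair. The positive factor
      is thus globally meaningful.\<close>
    then have "{(\<lambda>vs. x * \<mu> p vs), (\<lambda>vs. - (x * \<mu> p vs))} = {(\<lambda>vs. \<bar>x\<bar> * \<mu> p vs), (\<lambda>vs. \<bar>x\<bar> * - \<mu> p vs)}"
      by (cases "x > 0") auto
    then show ?thesis
      using x0 by (intro exI[of _ "\<bar>x\<bar>"]) (simp add: D(4)[OF r(1)] D'(4)[OF r'(1)] x)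
  qed
  then obtain h where h: "\<forall>p. h p > 0 \<and> \<nu>' p = (\<lambda>\<mu> vs. h p * \<mu> vs) ` \<nu> p" by metis
  have "smooth_on UNIV h"
  proof (rule smooth_on_local)
    fix p
    obtain U \<mu> where r: "p \<in> U" "local_representative E \<nu> U \<mu>" by (rule odd_volume_form_representative[OF \<nu>])
    obtain U' \<mu>' where r': "p \<in> U'" "local_representative E \<nu>' U' \<mu>'" by (rule odd_volume_form_representative[OF \<nu>'])
    note D = local_representativeD[OF r(2)] and D' = local_representativeD[OF r'(2)]
    obtain V e where V: "(V, e) \<in> frames E" "p \<in> V" by (rule frame_cover)
    define W where "W = U \<inter> U' \<inter> V"
    have W: "open W" "p \<in> W" using D(1) D'(1) frame_open[OF V(1)] r(1) r'(1) V(2) by (auto simp: W_def)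
    define f where "f q = \<mu> q (map (\<lambda>i. e i q) [0..<rk])" for q
    define g where "g q = \<mu>' q (map (\<lambda>i. e i q) [0..<rk])" for q
    have nz: "f q \<noteq> 0" "g q \<noteq> 0" if "q \<in> W" for q
    proof -
      have q: "q \<in> U" "q \<in> U'" "q \<in> V" using that by (auto simp: W_def)
      show "f q \<noteq> 0" "g q \<noteq> 0"
        using framed_space.volume_frame_nonzero[OF frame_space[OF V(1) q(3)] Forms_alt[OF D(2)] D(3)[OF q(1)]]
          framed_space.volume_frame_nonzero[OF frame_space[OF V(1) q(3)] Forms_alt[OF D'(2)] D'(3)[OF q(2)]]
        by (simp_all add: f_def g_def)
    qed
    have "smooth_on W f" "smooth_on W g"
      using smooth_on_subset[OF FormsD(3)[OF D(2) V(1) upt_increasing], of W]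
        smooth_on_subset[OF FormsD(3)[OF D'(2) V(1) upt_increasing], of W]
      unfolding f_def g_def by (auto simp: W_def)
    then have "smooth_on W (\<lambda>q. \<bar>g q / f q\<bar>)"
      using nz by (intro smooth_on_abs smooth_on_divide W) simp_all
    moreover have "h q = \<bar>g q / f q\<bar>" if q: "q \<in> W" for q
    proof -
      have hq: "h q > 0" "\<nu>' q = (\<lambda>\<mu> vs. h q * \<mu> vs) ` \<nu> q" using h by auto
      have "\<mu>' q = (\<lambda>vs. h q * \<mu> q vs) \<or> \<mu>' q = (\<lambda>vs. h q * - \<mu> q vs)"
      proof -
        have qU: "q \<in> U" "q \<in> U'" using q by (auto simp: W_def)
        have "\<mu>' q \<in> (\<lambda>\<mu> vs. h q * \<mu> vs) ` \<nu> q" unfolding hq(2)[symmetric] D'(4)[OF qU(2)] by simp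
        then show ?thesis unfolding D(4)[OF qU(1)] by auto
      qed
      then have "g q = h q * f q \<or> g q = h q * - f q" unfolding f_def g_def by auto
      then show ?thesis using hq(1) nz[OF q] by (auto simp: abs_mult)
    qed
    ultimately show "\<exists>W g. open W \<and> p \<in> W \<and> W \<subseteq> UNIV \<and> smooth_on W g \<and> (\<forall>q\<in>W. h q = g q)"
      using W by (intro exI[of _ W] exI[of _ "\<lambda>q. \<bar>g q / f q\<bar>"]) auto
  qed
  then show ?thesis using h by (intro that[of h]) auto
qed

lemma local_representative_scale:
  assumes r: "local_representative E \<nu> U \<mu>" and h: "smooth_on UNIV h" "\<forall>p. h p > 0" "\<forall>p. \<nu>' p = (\<lambda>\<mu> vs. h p * \<mu> vs) ` \<nu> p"
  shows "local_representative E \<nu>' U (\<lambda>p vs. h p * \<mu> p vs)"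
proof -
  note D = local_representativeD[OF r]
  have "(\<lambda>vs. h p * \<mu> p vs) \<noteq> (\<lambda>_. 0)" if "p \<in> U" for p
    using D(3)[OF that] h(2) by (auto simp: fun_eq_iff less_le)
  moreover have "\<nu>' p = {(\<lambda>vs. h p * \<mu> p vs), (\<lambda>vs. - (h p * \<mu> p vs))}" if "p \<in> U" for p
    using D(4)[OF that] h(3) by simp
  ultimately show ?thesis
    unfolding local_representative_def using D(1) Forms_scale[OF h(1) D(2)] by simp
qed

text \<open>The direction matters: \<open>\<nu>'\<close> is \<open>h\<close> times
  \<open>\<nu>\<close>, and multiplication by \<open>h\<close> carries the operator of
  \<open>\<nu>'\<close> to that of \<open>\<nu>\<close>.\<close>

lemma homology_op_scale:
  assumes \<nu>: "\<nu> \<in> odd_volume_forms E" and \<nu>': "\<nu>' \<in> odd_volume_forms E"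
    and h: "smooth_on UNIV h" "\<forall>p. h p > 0" "\<forall>p. \<nu>' p = (\<lambda>\<mu> vs. h p * \<mu> vs) ` \<nu> p"
    and a: "a \<in> Multivectors E k"
  shows "homology_op E \<nu> k (\<lambda>p x. h p * a p x) = (\<lambda>p x. h p * homology_op E \<nu>' k a p x)"
proof (rule homology_op_eqI[OF \<nu> Multivectors_scale[OF h(1) a] Multivectors_scale[OF h(1) homology_op_Multivectors[OF \<nu>' a]]])
  fix U \<mu> p assume r: "local_representative E \<nu> U \<mu>" and p: "p \<in> U"
  note D = local_representativeD[OF r]
  have "contract (\<lambda>x. h p * homology_op E \<nu>' k a p x) (\<mu> p) =
      contract (homology_op E \<nu>' k a p) (\<lambda>vs. h p * \<mu> p vs)"
    unfolding contract_scale_multivector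
    by (rule contract_scale_form_fibre[symmetric, OF Multivectors_ext_power[OF homology_op_Multivectors[OF \<nu>' a]] Forms_alt[OF D(2)]])
  also have "\<dots> = (\<lambda>ws. (-1) powi k * dR E U (int rk - k) (\<lambda>q. contract (a q) (\<lambda>vs. h q * \<mu> q vs)) p ws)"
    by (rule contract_homology_op[OF \<nu>' a local_representative_scale[OF r h] p])
  also have "(\<lambda>q. contract (a q) (\<lambda>vs. h q * \<mu> q vs)) = (\<lambda>q. contract (\<lambda>x. h q * a q x) (\<mu> q))"
    unfolding contract_scale_multivector
    using contract_scale_form_fibre[OF Multivectors_ext_power[OF a] Forms_alt[OF D(2)]] by (rule ext)
  finally show "contract (\<lambda>x. h p * homology_op E \<nu>' k a p x) (\<mu> p) =
      (\<lambda>ws. (-1) powi k * dR E U (int rk - k) (\<lambda>q. contract (\<lambda>x. h q * a q x) (\<mu> q)) p ws)" .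
qed

end

section \<open>Isomorphisms of quotients\<close>

lemma image_setcompr2:
  assumes "\<And>y z. y \<in> P \<Longrightarrow> z \<in> Q \<Longrightarrow> T (F y z) = G (T y) (T z)"
  shows "T ` {F y z | y z. y \<in> P \<and> z \<in> Q} = {G y z | y z. y \<in> T ` P \<and> z \<in> T ` Q}"
proof -
  have "T ` {F y z | y z. y \<in> P \<and> z \<in> Q} = {T (F y z) | y z. y \<in> P \<and> z \<in> Q}" by blast
  also have "\<dots> = {G (T y) (T z) | y z. y \<in> P \<and> z \<in> Q}"
    by (intro Collect_cong iffI; elim exE conjE; intro exI conjI; simp add: assms)
  also have "\<dots> = {G y z | y z. y \<in> T ` P \<and> z \<in> T ` Q}" by blast
  finally show ?thesis .
qed

text \<open>\<open>S\<close> is a space on which \<open>T\<close> is linear and injective and which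
  contains all cosets. The induced map is the image map on cosets; it is injective because the image
  map is injective on subsets of \<open>S\<close>.\<close>

lemma quotient_vspace_iso:
  fixes T :: "('m \<Rightarrow> 'x \<Rightarrow> real) \<Rightarrow> ('m \<Rightarrow> 'y \<Rightarrow> real)"
  assumes lin: "\<And>c y z. y \<in> S \<Longrightarrow> z \<in> S \<Longrightarrow> T (\<lambda>p x. c * y p x + z p x) = (\<lambda>p x. c * T y p x + T z p x)"
    and S: "\<And>c y z. y \<in> S \<Longrightarrow> z \<in> S \<Longrightarrow> (\<lambda>p x. c * y p x + z p x) \<in> S"
    and inj: "inj_on T S" and sub: "Z \<subseteq> S" "B \<subseteq> S"
  shows "vspace_iso ((`) T) (quotient_vspace Z B) (quotient_vspace (T ` Z) (T ` B))"
proof -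
  have lin1: "T (\<lambda>p x. y p x + z p x) = (\<lambda>p x. T y p x + T z p x)"
    and S1: "(\<lambda>p x. y p x + z p x) \<in> S" if "y \<in> S" "z \<in> S" for y z
    using lin[OF that, of 1] S[OF that, of 1] by simp_all
  have carrier: "P \<subseteq> S" if P: "P \<in> vcarrier (quotient_vspace Z B)" for P
  proof
    fix w assume "w \<in> P"
    then obtain z b where "z \<in> Z" "b \<in> B" "w = (\<lambda>p x. z p x + b p x)"
      using P by (auto simp: quotient_vspace_def)
    then show "w \<in> S" using S1[of z b] sub by blast
  qed
  have coset: "T ` {(\<lambda>p x. z p x + b p x) | b. b \<in> B} = {(\<lambda>p x. T z p x + b p x) | b. b \<in> T ` B}" if "z \<in> Z" for z
  proof -
    have "T (\<lambda>p x. z p x + b p x) = (\<lambda>p x. T z p x + T b p x)" if "b \<in> B" for b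
      using lin1 \<open>z \<in> Z\<close> that sub by blast
    then show ?thesis unfolding setcompr_eq_image Collect_mem_eq image_image by (rule image_cong[OF refl])
  qed
  have "bij_betw ((`) T) (vcarrier (quotient_vspace Z B)) (vcarrier (quotient_vspace (T ` Z) (T ` B)))"
  proof (rule bij_betw_imageI)
    show "inj_on ((`) T) (vcarrier (quotient_vspace Z B))"
      by (rule inj_on_subset[OF inj_on_image_Pow[OF inj]]) (use carrier in auto)
    have "(`) T ` (\<lambda>z. {(\<lambda>p x. z p x + b p x) | b. b \<in> B}) ` Z =
        (\<lambda>z. {(\<lambda>p x. z p x + b p x) | b. b \<in> T ` B}) ` T ` Z"
      unfolding image_image[of "(`) T"] image_image[of _ T] by (rule image_cong[OF refl coset])
    then show "(`) T ` vcarrier (quotient_vspace Z B) = vcarrier (quotient_vspace (T ` Z) (T ` B))"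
      by (simp only: quotient_vspace_def vspace.simps)
  qed
  moreover have "T ` vadd (quotient_vspace Z B) P Q = vadd (quotient_vspace (T ` Z) (T ` B)) (T ` P) (T ` Q)"
    if "P \<in> vcarrier (quotient_vspace Z B)" "Q \<in> vcarrier (quotient_vspace Z B)" for P Q
    unfolding quotient_vspace_def vspace.simps
    by (rule image_setcompr2) (use carrier[OF that(1)] carrier[OF that(2)] lin1 in blast)
  moreover have "T ` vscale (quotient_vspace Z B) c P = vscale (quotient_vspace (T ` Z) (T ` B)) c (T ` P)"
    if "P \<in> vcarrier (quotient_vspace Z B)" for P c
    unfolding quotient_vspace_def vspace.simps
    by (rule image_setcompr2) (use carrier[OF that] sub(2) lin in blast)
  ultimately show ?thesis unfolding vspace_iso_def by simp
qed

text \<open>Contraction leads from multivector fields to forms, whereas duality is stated in the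
  opposite direction. The previous lemma is applied to the inverse of \<open>T\<close>.\<close>

lemma quotient_vspace_iso_inv:
  fixes T :: "('m \<Rightarrow> 'x \<Rightarrow> real) \<Rightarrow> ('m \<Rightarrow> 'y \<Rightarrow> real)"
  assumes lin: "\<And>c y z. y \<in> S \<Longrightarrow> z \<in> S \<Longrightarrow> T (\<lambda>p x. c * y p x + z p x) = (\<lambda>p x. c * T y p x + T z p x)"
    and S: "\<And>c y z. y \<in> S \<Longrightarrow> z \<in> S \<Longrightarrow> (\<lambda>p x. c * y p x + z p x) \<in> S"
    and inj: "inj_on T S" and sub: "Z \<subseteq> S" "B \<subseteq> S"
  shows "vspace_isomorphic (quotient_vspace (T ` Z) (T ` B)) (quotient_vspace Z B)"
proof -
  let ?R = "inv_into S T"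
  have "vspace_iso ((`) ?R) (quotient_vspace (T ` Z) (T ` B)) (quotient_vspace (?R ` T ` Z) (?R ` T ` B))"
  proof (rule quotient_vspace_iso[where S = "T ` S"])
    fix c y z assume "y \<in> T ` S" "z \<in> T ` S"
    then obtain y' z' where y: "y = T y'" "y' \<in> S" and z: "z = T z'" "z' \<in> S" by blast
    have yz: "(\<lambda>p x. c * y p x + z p x) = T (\<lambda>p x. c * y' p x + z' p x)"
      using lin[OF y(2) z(2)] y(1) z(1) by simp
    show "?R (\<lambda>p x. c * y p x + z p x) = (\<lambda>p x. c * ?R y p x + ?R z p x)"
      unfolding yz using inv_into_f_f[OF inj S[OF y(2) z(2)]] inv_into_f_f[OF inj y(2)] inv_into_f_f[OF inj z(2)] y(1) z(1)
      by simp
    show "(\<lambda>p x. c * y p x + z p x) \<in> T ` S"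
      unfolding yz using S[OF y(2) z(2)] by (rule imageI)
  qed (use sub in \<open>auto intro: inj_on_inv_into\<close>)
  then show ?thesis
    unfolding inv_into_image_cancel[OF inj sub(1)] inv_into_image_cancel[OF inj sub(2)] vspace_isomorphic_def
    by blast
qed

section \<open>Independence of the volume form and duality\<close>

context algebroid
begin

lemma homology_scale_iso:
  assumes \<nu>: "\<nu> \<in> odd_volume_forms E" and \<nu>': "\<nu>' \<in> odd_volume_forms E"
    and h: "smooth_on UNIV h" "\<forall>p. h p > 0" "\<forall>p. \<nu>' p = (\<lambda>\<mu> vs. h p * \<mu> vs) ` \<nu> p"
  shows "vspace_iso ((`) (\<lambda>a p x. h p * a p x)) (homology E \<nu>' k) (homology E \<nu> k)"
proof -
  let ?T = "\<lambda>a p x. h p * a p x"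
  note op = homology_op_scale[OF \<nu> \<nu>' h]
  have h0: "h p \<noteq> 0" for p using h(2) by (metis less_irrefl)
  have hinv: "smooth_on UNIV (\<lambda>p. inverse (h p))" using smooth_on_inverse[OF h(1)] h0 by blast
  have surj: "?T ` Multivectors E j = Multivectors E j" for j
  proof (intro equalityI subsetI)
    fix a assume a: "a \<in> Multivectors E j"
    have "a = ?T (\<lambda>p x. inverse (h p) * a p x)" using h0 by (simp add: fun_eq_iff flip: mult.assoc)
    then show "a \<in> ?T ` Multivectors E j"
      by (rule image_eqI[where f = ?T]) (rule Multivectors_scale[OF hinv a])
  qed (auto intro: Multivectors_scale[OF h(1)])
  have inj: "inj_on ?T S" for S :: "('m \<Rightarrow> 'v multivector) set"
    using h0 by (intro inj_onI) (simp add: fun_eq_iff)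
  have Z: "?T ` {a \<in> Multivectors E k. homology_op E \<nu>' k a = (\<lambda>_ _. 0)} =
      {a \<in> Multivectors E k. homology_op E \<nu> k a = (\<lambda>_ _. 0)}" (is "?T ` ?Z' = ?Z")
  proof (intro equalityI subsetI)
    fix a assume "a \<in> ?Z"
    then obtain a' where a': "a' \<in> Multivectors E k" "a = ?T a'" "homology_op E \<nu> k a = (\<lambda>_ _. 0)"
      using surj[of k] by blast
    then have "(\<lambda>p x. h p * homology_op E \<nu>' k a' p x) = (\<lambda>_ _. 0)" using op[OF a'(1)] by simp
    then have "homology_op E \<nu>' k a' = (\<lambda>_ _. 0)" using h0 by (simp add: fun_eq_iff)
    then show "a \<in> ?T ` ?Z'" using a' by blast
  next
    fix a assume "a \<in> ?T ` ?Z'"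
    then obtain a' where a': "a' \<in> Multivectors E k" "a = ?T a'" "homology_op E \<nu>' k a' = (\<lambda>_ _. 0)" by blast
    then show "a \<in> ?Z" using op[OF a'(1)] Multivectors_scale[OF h(1) a'(1)] by simp
  qed
  have B: "?T ` homology_op E \<nu>' (k + 1) ` Multivectors E (k + 1) = homology_op E \<nu> (k + 1) ` Multivectors E (k + 1)"
  proof -
    have "?T ` homology_op E \<nu>' (k + 1) ` Multivectors E (k + 1) =
        homology_op E \<nu> (k + 1) ` ?T ` Multivectors E (k + 1)"
      unfolding image_image using op by (intro image_cong) simp_all
    then show ?thesis unfolding surj .
  qed
  have "vspace_iso ((`) ?T) (homology E \<nu>' k)
      (quotient_vspace (?T ` ?Z') (?T ` homology_op E \<nu>' (k + 1) ` Multivectors E (k + 1)))"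
    unfolding homology_def
    by (rule quotient_vspace_iso[where S = "Multivectors E k"])
      (use homology_op_Multivectors[OF \<nu>', of _ "k + 1"] Multivectors_lincomb[OF smooth_on_const] inj in
        \<open>auto simp: algebra_simps\<close>)
  then show ?thesis unfolding Z B by (simp add: homology_def)
qed

lemma homology_independent:
  assumes "\<nu> \<in> odd_volume_forms E" "\<nu>' \<in> odd_volume_forms E"
  shows "graded_isomorphic (homology E \<nu>) (homology E \<nu>')"
proof -
  \<comment> \<open>The ratio is taken with the roles exchanged, so that the resulting map starts
    from the homology of \<open>\<nu>\<close>.\<close>
  obtain h where "smooth_on UNIV h" "\<forall>p. h p > 0" "\<forall>p. \<nu> p = (\<lambda>\<mu> vs. h p * \<mu> vs) ` \<nu>' p"
    by (rule odd_volume_forms_ratio[OF assms(2,1)])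
  from homology_scale_iso[OF assms(2,1) this] show ?thesis
    unfolding graded_isomorphic_def by (intro exI[of _ "\<lambda>k. (`) (\<lambda>a p x. h p * a p x)"] allI)
qed

lemma global_representative:
  assumes triv: "top_power_trivializable E" and \<nu>: "\<nu> \<in> odd_volume_forms E"
  obtains \<mu> where "local_representative E \<nu> UNIV \<mu>"
proof -
  let ?A = "\<lambda>p. alt_forms (fibre E p) (int rk)"
  obtain \<Phi> :: "'m \<Rightarrow> 'v form \<Rightarrow> real" where
    \<Phi>: "\<forall>p. bij_betw (\<Phi> p) (?A p) UNIV \<and> (\<forall>\<omega>\<in>?A p. \<forall>\<eta>\<in>?A p. \<forall>c.
      \<Phi> p (\<lambda>vs. c * \<omega> vs + \<eta> vs) = c * \<Phi> p \<omega> + \<Phi> p \<eta>)"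
    and sm: "\<forall>U \<omega>. open U \<longrightarrow> (\<forall>p\<in>U. \<omega> p \<in> ?A p) \<longrightarrow>
      (smooth_form_on E U (int rk) \<omega> \<longleftrightarrow> smooth_on U (\<lambda>p. \<Phi> p (\<omega> p)))"
    using triv unfolding top_power_trivializable_def by (elim exE conjE)
  have lin: "\<Phi> p (\<lambda>vs. c * \<omega> vs + \<eta> vs) = c * \<Phi> p \<omega> + \<Phi> p \<eta>" if "\<omega> \<in> ?A p" "\<eta> \<in> ?A p" for p c \<omega> \<eta>
    using \<Phi> that by blast
  have zero: "\<Phi> p (\<lambda>_. 0) = 0" for p
    using lin[OF zero_alt_forms zero_alt_forms, of p 1] by simp
  have scale: "\<Phi> p (\<lambda>vs. c * \<omega> vs) = c * \<Phi> p \<omega>" if "\<omega> \<in> ?A p" for p c \<omega>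
    using lin[OF that zero_alt_forms, of c] zero by simp
  have nonzero: "\<Phi> p \<omega> \<noteq> 0" if "\<omega> \<in> ?A p" "\<omega> \<noteq> (\<lambda>_. 0)" for p \<omega>
  proof
    assume "\<Phi> p \<omega> = 0"
    then have "\<Phi> p \<omega> = \<Phi> p (\<lambda>_. 0)" using zero by simp
    moreover have "inj_on (\<Phi> p) (?A p)" using \<Phi> by (simp add: bij_betw_def)
    ultimately show False using that zero_alt_forms by (metis inj_onD)
  qed
  have "\<forall>p. \<exists>U \<mu>. p \<in> U \<and> local_representative E \<nu> U \<mu>"
    using \<nu> unfolding odd_volume_forms_def by blast
  then obtain UU mm where rep: "\<And>p. p \<in> UU p" "\<And>p. local_representative E \<nu> (UU p) (mm p)" by metis
  \<comment> \<open>Among the two values at \<open>p\<close> this is the one on which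
    \<open>\<Phi>\<close> is positive, so that it no longer depends on the local representative
    chosen there.\<close>
  define w where "w p = (\<lambda>vs. sgn (\<Phi> p (mm p p)) * mm p p vs)" for p
  have wA: "w p \<in> ?A p" and w\<nu>: "\<nu> p = {w p, (\<lambda>vs. - w p vs)}" and wp: "\<Phi> p (w p) > 0" for p
  proof -
    note D = local_representativeD[OF rep(2)[of p]]
    have A: "mm p p \<in> ?A p" by (rule Forms_alt[OF D(2)])
    have x: "\<Phi> p (mm p p) \<noteq> 0" by (rule nonzero[OF A D(3)[OF rep(1)]])
    show "w p \<in> ?A p" unfolding w_def by (rule alt_forms_scaled[OF A])
    show "\<Phi> p (w p) > 0" unfolding w_def scale[OF A] using x by (simp add: sgn_if)
    show "\<nu> p = {w p, (\<lambda>vs. - w p vs)}"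
      unfolding w_def D(4)[OF rep(1)] using x by (cases "\<Phi> p (mm p p) > 0") auto
  qed
  have w0: "w p \<noteq> (\<lambda>_. 0)" for p using wp[of p] zero by auto
  \<comment> \<open>The pointwise choice is smooth because near each point its image under
    \<open>\<Phi>\<close> is the absolute value of the nowhere vanishing smooth function obtained
    from a local representative.\<close>
  have "smooth_on UNIV (\<lambda>p. \<Phi> p (w p))"
  proof (rule smooth_on_local)
    fix p
    obtain U \<mu> where r: "p \<in> U" "local_representative E \<nu> U \<mu>" by (rule odd_volume_form_representative[OF \<nu>])
    note D = local_representativeD[OF r(2)]
    have "smooth_form_on E U (int rk) \<mu>" using D(2) unfolding Forms_def by simp
    moreover have "\<forall>p\<in>U. \<mu> p \<in> ?A p" using D(2) Forms_alt by blast
    ultimately have "smooth_on U (\<lambda>q. \<Phi> q (\<mu> q))" using sm D(1) by blast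
    then have "smooth_on U (\<lambda>q. \<bar>\<Phi> q (\<mu> q)\<bar>)"
      by (rule smooth_on_abs[OF D(1)]) (rule nonzero[OF Forms_alt[OF D(2)] D(3)])
    moreover have "\<Phi> q (w q) = \<bar>\<Phi> q (\<mu> q)\<bar>" if q: "q \<in> U" for q
    proof -
      have A: "\<mu> q \<in> ?A q" using D(2) Forms_alt by blast
      have "w q = \<mu> q \<or> w q = (\<lambda>vs. - \<mu> q vs)"
        using w\<nu>[of q] D(4)[OF q] by blast
      then have "\<Phi> q (w q) = \<Phi> q (\<mu> q) \<or> \<Phi> q (w q) = - \<Phi> q (\<mu> q)"
        using scale[OF A, of "-1"] by auto
      then show ?thesis using wp[of q] by auto
    qed
    ultimately show "\<exists>W g. open W \<and> p \<in> W \<and> W \<subseteq> UNIV \<and> smooth_on W g \<and> (\<forall>q\<in>W. \<Phi> q (w q) = g q)"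
      using D(1) r(1) by (intro exI[of _ U] exI[of _ "\<lambda>q. \<bar>\<Phi> q (\<mu> q)\<bar>"]) auto
  qed
  then have "smooth_form_on E UNIV (int rk) w" using sm wA open_UNIV by blast
  then have "w \<in> Forms E UNIV (int rk)" by (simp add: Forms_def)
  then have "local_representative E \<nu> UNIV w"
    unfolding local_representative_def using w0 w\<nu> by (intro conjI ballI open_UNIV)
  then show ?thesis by (rule that)
qed

lemma dR_scale:
  assumes "\<omega> \<in> Forms E UNIV k"
  shows "dR E UNIV k (\<lambda>p x. c * \<omega> p x) = (\<lambda>p x. c * dR E UNIV k \<omega> p x)"
  by (intro ext) (subst dR_local[OF Forms_scale[OF smooth_on_const assms] open_UNIV assms open_UNIV open_UNIV subset_UNIV subset_UNIV UNIV_I], auto)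

lemma poincare_duality:
  assumes \<nu>: "\<nu> \<in> odd_volume_forms E" and r: "local_representative E \<nu> UNIV \<mu>"
  shows "vspace_isomorphic (cohomology E k) (homology E \<nu> (int rk - k))"
proof -
  let ?T = "\<lambda>a q. contract (a q) (\<mu> q)"
  note D = local_representativeD[OF r]
  let ?j = "int rk - k"
  have T_Forms: "?T a \<in> Forms E UNIV (int rk - j)" if "a \<in> Multivectors E j" for a j
    by (rule contract_Forms[OF that D(2,1)])
  have inj: "inj_on ?T (Multivectors E j)" for j
  proof (rule inj_onI, rule ext)
    fix a b p assume ab: "a \<in> Multivectors E j" "b \<in> Multivectors E j" "?T a = ?T b"
    show "a p = b p"
      by (rule contract_inj_fibre[OF Multivectors_ext_power[OF ab(1)] Multivectors_ext_power[OF ab(2)]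
            Forms_alt[OF D(2)] D(3)[OF UNIV_I]]) (rule fun_cong[OF ab(3)])
  qed
  have surj: "?T ` Multivectors E j = Forms E UNIV (int rk - j)" for j
  proof (intro equalityI subsetI)
    fix \<theta> assume \<theta>: "\<theta> \<in> Forms E UNIV (int rk - j)"
    have "\<exists>c. c \<in> ext_power (fibre E p) j \<and> contract c (\<mu> p) = \<theta> p" for p
    proof -
      obtain c where "c \<in> ext_power (fibre E p) j" "contract c (\<mu> p) = \<theta> p"
        by (rule contract_surj_fibre[OF Forms_alt[OF D(2)] D(3)[OF UNIV_I] Forms_alt[OF \<theta>]])
      then show ?thesis by blast
    qed
    then obtain b where b: "\<And>p. b p \<in> ext_power (fibre E p) j" "\<And>p. contract (b p) (\<mu> p) = \<theta> p" by metis
    have "b \<in> Multivectors E j"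
      by (rule Multivectors_localI[OF b(1)])
        (use D \<theta> b(2) in \<open>intro exI[of _ UNIV] exI[of _ \<mu>] exI[of _ \<theta>]; simp\<close>)
    moreover have "\<theta> = ?T b" using b(2) by simp
    ultimately show "\<theta> \<in> ?T ` Multivectors E j" by blast
  qed (use T_Forms in auto)
  have chain: "?T (homology_op E \<nu> j a) = (\<lambda>p ws. (-1) powi j * dR E UNIV (int rk - j) (?T a) p ws)"
    if "a \<in> Multivectors E j" for a j
    using contract_homology_op[OF \<nu> that r UNIV_I] by (rule ext)
  have sign: "(-1) powi j * ((-1) powi j * x) = (x::real)" for j x
    by (simp add: power_int_minus_one_mult_self flip: mult.assoc)
  have sign0: "(-1) powi j \<noteq> (0::real)" for j by simp
  have Z: "?T ` {a \<in> Multivectors E ?j. homology_op E \<nu> ?j a = (\<lambda>_ _. 0)} =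
      {\<omega> \<in> Forms E UNIV k. dR E UNIV k \<omega> = (\<lambda>_ _. 0)}" (is "?T ` ?Z = ?Z'")
  proof -
    have iff: "homology_op E \<nu> ?j a = (\<lambda>_ _. 0) \<longleftrightarrow> dR E UNIV k (?T a) = (\<lambda>_ _. 0)" if a: "a \<in> Multivectors E ?j" for a
    proof -
      \<comment> \<open>Contraction is injective, so that vanishing of the boundary may be tested
        after it, where the boundary becomes \<open>dR\<close> up to sign.\<close>
      have "homology_op E \<nu> ?j a = (\<lambda>_ _. 0) \<longleftrightarrow> ?T (homology_op E \<nu> ?j a) = ?T (\<lambda>_ _. 0)"
        using inj_on_eq_iff[OF inj homology_op_Multivectors[OF \<nu> a] Multivectors_zero] by simp
      also have "?T (\<lambda>_ _. 0) = (\<lambda>_ _. 0)" by (simp add: contract_def)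
      also have "?T (homology_op E \<nu> ?j a) = (\<lambda>_ _. 0) \<longleftrightarrow> dR E UNIV k (?T a) = (\<lambda>_ _. 0)"
        unfolding chain[OF a] using sign0 by (simp add: fun_eq_iff)
      finally show ?thesis .
    qed
    have "?T ` ?Z = {\<omega> \<in> ?T ` Multivectors E ?j. dR E UNIV k \<omega> = (\<lambda>_ _. 0)}" using iff by blast
    then show ?thesis unfolding surj by simp
  qed
  \<comment> \<open>Degree \<open>?j + 1\<close> on the side of multivector fields corresponds to
    degree \<open>k - 1\<close> of forms. The sign from \<open>chain\<close> is moved inside
    \<open>dR\<close>, and multiplication by it maps the space of forms onto itself.\<close>
  have B: "?T ` homology_op E \<nu> (?j + 1) ` Multivectors E (?j + 1) = dR E UNIV (k - 1) ` Forms E UNIV (k - 1)"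
  proof -
    let ?s = "(-1) powi (?j + 1) :: real"
    have e: "int rk - (?j + 1) = k - 1" by simp
    have "?T ` homology_op E \<nu> (?j + 1) ` Multivectors E (?j + 1) =
        (\<lambda>\<theta> p ws. ?s * dR E UNIV (k - 1) \<theta> p ws) ` ?T ` Multivectors E (?j + 1)"
      unfolding image_image using chain[of _ "?j + 1", unfolded e] by (intro image_cong) simp_all
    also have "\<dots> = (\<lambda>\<theta> p ws. ?s * dR E UNIV (k - 1) \<theta> p ws) ` Forms E UNIV (k - 1)"
      unfolding surj e ..
    also have "\<dots> = dR E UNIV (k - 1) ` (\<lambda>\<theta> p ws. ?s * \<theta> p ws) ` Forms E UNIV (k - 1)"
      unfolding image_image using dR_scale by (intro image_cong) simp_all
    also have "(\<lambda>\<theta> p ws. ?s * \<theta> p ws) ` Forms E UNIV (k - 1) = Forms E UNIV (k - 1)"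
    proof (intro equalityI subsetI)
      fix \<theta> assume \<theta>: "\<theta> \<in> Forms E UNIV (k - 1)"
      have "\<theta> = (\<lambda>p ws. ?s * (?s * \<theta> p ws))" by (simp only: sign)
      then show "\<theta> \<in> (\<lambda>\<theta> p ws. ?s * \<theta> p ws) ` Forms E UNIV (k - 1)"
        by (rule image_eqI[where f = "\<lambda>\<theta> p ws. ?s * \<theta> p ws"]) (rule Forms_scale[OF smooth_on_const \<theta>])
    qed (auto intro: Forms_scale[OF smooth_on_const])
    finally show ?thesis .
  qed
  have "vspace_isomorphic
      (quotient_vspace (?T ` ?Z) (?T ` homology_op E \<nu> (?j + 1) ` Multivectors E (?j + 1))) (homology E \<nu> ?j)"
    unfolding homology_def
    by (rule quotient_vspace_iso_inv[where S = "Multivectors E ?j"])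
      (use homology_op_Multivectors[OF \<nu>, of _ "?j + 1"] Multivectors_lincomb[OF smooth_on_const] inj in
        \<open>auto simp: contract_def\<close>)
  then show ?thesis unfolding Z B by (simp add: cohomology_def)
qed

end

theorem theorem3p6:
  fixes E :: "('m::{t2_space,second_countable_topology}, 'v::real_vector) lie_algebroid"
    and n :: nat
  assumes "smooth_lie_algebroid E"
    and "bundle_rank E = n"
  shows "(\<forall>\<mu>\<^sub>1\<in>odd_volume_forms E. \<forall>\<mu>\<^sub>2\<in>odd_volume_forms E.
            graded_isomorphic (homology E \<mu>\<^sub>1) (homology E \<mu>\<^sub>2)) \<and>
         (top_power_trivializable E \<longrightarrow>
            (\<forall>\<mu>\<in>odd_volume_forms E. \<forall>k::int.
               vspace_isomorphic (cohomology E k) (homology E \<mu> (int n - k))))"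
proof -
  interpret algebroid E by unfold_locales (rule assms(1))
  have "vspace_isomorphic (cohomology E k) (homology E \<nu> (int n - k))"
    if triv: "top_power_trivializable E" and \<nu>: "\<nu> \<in> odd_volume_forms E" for \<nu> k
  proof -
    obtain \<mu> where "local_representative E \<nu> UNIV \<mu>" by (rule global_representative[OF triv \<nu>])
    from poincare_duality[OF \<nu> this] show ?thesis unfolding assms(2) .
  qed
  then show ?thesis using homology_independent by blast
qed

end
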